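(* Fix $d\ge1$. Let $(\mathcal{F},s)$ be a uniformly random $d$-Shuffled Simon's instance of size $n$, and let $\mathcal{C}^{\mathcal{F}}$ be any $\mathrm{CQ}_d$ circuit with oracle access to $\mathcal{F}$. Then $\Pr[s\leftarrow\mathcal{C}^{\mathcal{F}}]\le\mathrm{negl}(n)$.
   Context: Identify $\{0,1\}^n$ with $\{0,\dots,N-1\}$, $N=2^n$, embedded in $\{0,1\}^{2n}$ by prefixing zeros. A $d$-Shuffler for $f:\{0,1\}^n\to\{0,1\}^n$ is $(f_0,\dots,f_d)$ on $\{0,1\}^{2n}\cup\{\perp\}$ sampled by: $t_{-1}=(0,\dots,N-1)$; $t_0,\dots,t_{d-1}$ independent uniformly random tuples of $N$ distinct elements of $\{0,1\}^{2n}$; $t_d=(f(0),\dots,f(N-1))$; $f_i(x)$ is the $j$-th entry of $t_i$ if $x$ is the $j$-th entry of $t_{i-1}$, and $\perp$ otherwise. $d$-Shuffled Simon's instance: uniformly random Simon function $(g,s)$ ($s\ne0^n$, $g(x)=g(y)\iff y\in\{x,x\oplus s\}$), a $d$-Shuffler for $g$, and $\mathcal{F}$ the standard oracle (quantum: $|x\rangle|a\rangle\mapsto|x\rangle|a\oplus F(x)\rangle$; classical: returns $F(x)$) for $(f_0,\dots,f_d)$. Goal: output $s$. $\mathrm{CQ}_d$ circuit with oracle $\mathcal{O}$: for some $m=\mathrm{poly}(n)$, $\mathcal{A}_{m+1}\circ\mathcal{C}_m\circ\cdots\circ\mathcal{C}_1$ with $\mathcal{C}_i=\Pi_i\circ U_{d+1,i}\circ\mathcal{O}\circ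 U_{d,i}\circ\cdots\circ\mathcal{O}\circ U_{1,i}\circ\mathcal{A}_i$, where $\mathcal{A}_i$ are polynomial-size randomised classical circuits with classical query access to $\mathcal{O}$, $U_{j,i}$ are single-layer unitaries (one- and two-qubit gates on disjoint qubits) on $\mathrm{poly}(n)$ qubits determined by the classical data, each oracle application allows polynomially many parallel queries, and $\Pi_i$ measures all qubits in the computational basis, passing the outcome to $\mathcal{A}_{i+1}$. Negligible: eventually below $1/q(n)$ for every polynomial $q$. *)

theory Defs
  imports "HOL-Probability.Probability" "HOL-Computational_Algebra.Polynomial"
begin

text \<open>Elements of {0,1}^k are identified with naturals below 2^k (big-endian).\<close>

definition bits_to_nat :: "bool list \<Rightarrow> nat" where
  "bits_to_nat bs = (\<Sum>j<length bs. if bs ! j then 2 ^ (length bs - 1 - j) else 0)"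

definition nat_to_bits :: "nat \<Rightarrow> nat \<Rightarrow> bool list" where
  "nat_to_bits w v = map (\<lambda>j. bit v (w - 1 - j)) [0..<w]"

text \<open>Encoding of {0,1}^(2n) plus bottom (None) on 2n+1 qubits: a flag bit
  (True = bottom) followed by the 2n-bit string.\<close>

definition enc_val :: "nat \<Rightarrow> nat option \<Rightarrow> bool list" where
  "enc_val n v = (case v of None \<Rightarrow> True # replicate (2*n) False
                        | Some x \<Rightarrow> False # nat_to_bits (2*n) x)"

definition dec_val :: "bool list \<Rightarrow> nat option" where
  "dec_val bs = (if bs = [] \<or> hd bs then None else Some (bits_to_nat (tl bs)))"

definition simon_pairs :: "nat \<Rightarrow> ((nat \<Rightarrow> nat) \<times> nat) set" where
  "simon_pairs n = {(g, s). s \<in> {1..<2^n} \<and> g \<in> {..<2^n} \<rightarrow>\<^sub>E {..<2^n} \<and>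
      (\<forall>x<2^n. \<forall>y<2^n. g x = g y \<longleftrightarrow> (y = x \<or> y = xor x s))}"

definition dist_tuples :: "nat \<Rightarrow> (nat \<Rightarrow> nat) set" where
  "dist_tuples n = {t \<in> {..<2^n} \<rightarrow>\<^sub>E {..<2^(2*n)}. inj_on t {..<2^n}}"

text \<open>d independent uniform tuples t_0..t_(d-1) = uniform on lists of length d.\<close>
definition shuffle_lists :: "nat \<Rightarrow> nat \<Rightarrow> (nat \<Rightarrow> nat) list set" where
  "shuffle_lists n d = {ts. length ts = d \<and> set ts \<subseteq> dist_tuples n}"

text \<open>shuffle_T k = t_(k-1): shuffle_T 0 = t_(-1) = identity, shuffle_T (d+1) = t_d = g.\<close>
definition shuffle_T :: "nat \<Rightarrow> (nat \<Rightarrow> nat) \<Rightarrow> (nat \<Rightarrow> nat) list \<Rightarrow> nat \<Rightarrow> nat \<Rightarrow> nat" where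
  "shuffle_T d g ts k = (if k = 0 then id else if k \<le> d then ts ! (k - 1) else g)"

definition shuffle_f :: "nat \<Rightarrow> nat \<Rightarrow> (nat \<Rightarrow> nat) \<Rightarrow> (nat \<Rightarrow> nat) list \<Rightarrow> nat \<Rightarrow> nat option \<Rightarrow> nat option" where
  "shuffle_f n d g ts i x = (case x of None \<Rightarrow> None | Some v \<Rightarrow>
      (if \<exists>j<2^n. shuffle_T d g ts i j = v
       then Some (shuffle_T d g ts (Suc i) (THE j. j < 2^n \<and> shuffle_T d g ts i j = v))
       else None))"

type_synonym coracle = "nat \<Rightarrow> nat option \<Rightarrow> nat option"

definition shuffle_oracle :: "nat \<Rightarrow> nat \<Rightarrow> (nat \<Rightarrow> nat) \<Rightarrow> (nat \<Rightarrow> nat) list \<Rightarrow> coracle" where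
  "shuffle_oracle n d g ts i x = (if i \<le> d then shuffle_f n d g ts i x else None)"

datatype 'a calg = Ret 'a | Flip "bool \<Rightarrow> 'a calg" | Qry nat "nat option" "nat option \<Rightarrow> 'a calg"

primrec run_calg :: "'a calg \<Rightarrow> coracle \<Rightarrow> 'a pmf" where
  "run_calg (Ret a) F = return_pmf a"
| "run_calg (Flip f) F = bind_pmf (bernoulli_pmf (1/2)) (\<lambda>b. run_calg (f b) F)"
| "run_calg (Qry i x g) F = run_calg (g (F i x)) F"

primrec calg_ok :: "'a calg \<Rightarrow> nat \<Rightarrow> ('a \<Rightarrow> bool) \<Rightarrow> bool" where
  "calg_ok (Ret a) k P = P a"
| "calg_ok (Flip f) k P = (\<forall>b. calg_ok (f b) k P)"
| "calg_ok (Qry i x g) k P = (0 < k \<and> (\<forall>y. calg_ok (g y) (k - 1) P))"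

type_synonym qstate = "bool list \<Rightarrow> complex"
text \<open>A gate: qubit positions and its matrix, U out in = <out|U|in>.\<close>
type_synonym gate = "nat list \<times> (bool list \<Rightarrow> bool list \<Rightarrow> complex)"
text \<open>A query slot: index register, input register, output register.\<close>
type_synonym qslot = "nat list \<times> nat list \<times> nat list"
text \<open>(number of qubits, initial basis state, layers U_1..U_(d+1), oracle layers 1..d)\<close>
type_synonym qspec = "nat \<times> bool list \<times> gate list list \<times> qslot list list"

definition get_reg :: "bool list \<Rightarrow> nat list \<Rightarrow> bool list" where
  "get_reg b ps = map (\<lambda>p. b ! p) ps"

fun set_reg :: "bool list \<Rightarrow> nat list \<Rightarrow> bool list \<Rightarrow> bool list" where
  "set_reg b (p # ps) (c # cs) = set_reg (b[p := c]) ps cs"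
| "set_reg b _ _ = b"

definition unitary_on :: "nat \<Rightarrow> (bool list \<Rightarrow> bool list \<Rightarrow> complex) \<Rightarrow> bool" where
  "unitary_on k U = (\<forall>x y. length x = k \<longrightarrow> length y = k \<longrightarrow>
      (\<Sum>z\<in>{z. length z = k}. cnj (U z x) * U z y) = (if x = y then 1 else 0))"

definition apply_gate :: "gate \<Rightarrow> qstate \<Rightarrow> qstate" where
  "apply_gate G \<psi> = (\<lambda>b. \<Sum>c\<in>{c. length c = length (fst G)}.
      snd G (get_reg b (fst G)) c * \<psi> (set_reg b (fst G) c))"

definition apply_layer :: "gate list \<Rightarrow> qstate \<Rightarrow> qstate" where
  "apply_layer L \<psi> = fold apply_gate L \<psi>"

text \<open>Standard oracle on one slot: |i>|x>|a> -> |i>|x>|a xor F(i,x)>.\<close>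
definition apply_slot :: "nat \<Rightarrow> coracle \<Rightarrow> qslot \<Rightarrow> qstate \<Rightarrow> qstate" where
  "apply_slot n F S \<psi> = (case S of (ir, xr, ar) \<Rightarrow> (\<lambda>b. \<psi> (set_reg b ar
      (map2 (\<noteq>) (get_reg b ar) (enc_val n (F (bits_to_nat (get_reg b ir)) (dec_val (get_reg b xr))))))))"

definition apply_oracle :: "nat \<Rightarrow> coracle \<Rightarrow> qslot list \<Rightarrow> qstate \<Rightarrow> qstate" where
  "apply_oracle n F Ss \<psi> = fold (apply_slot n F) Ss \<psi>"

definition wf_gate :: "nat \<Rightarrow> gate \<Rightarrow> bool" where
  "wf_gate q G = (length (fst G) \<in> {1, 2} \<and> distinct (fst G) \<and> set (fst G) \<subseteq> {..<q}
      \<and> unitary_on (length (fst G)) (snd G))"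

definition wf_layer :: "nat \<Rightarrow> gate list \<Rightarrow> bool" where
  "wf_layer q L = ((\<forall>G\<in>set L. wf_gate q G) \<and> distinct (concat (map fst L)))"

definition slot_regs :: "qslot \<Rightarrow> nat list" where
  "slot_regs S = (case S of (ir, xr, ar) \<Rightarrow> ir @ xr @ ar)"

definition wf_slot :: "nat \<Rightarrow> nat \<Rightarrow> qslot \<Rightarrow> bool" where
  "wf_slot n q S = (case S of (ir, xr, ar) \<Rightarrow> length xr = 2*n+1 \<and> length ar = 2*n+1
      \<and> set (ir @ xr @ ar) \<subseteq> {..<q})"

definition wf_qlayer :: "nat \<Rightarrow> nat \<Rightarrow> nat \<Rightarrow> qslot list \<Rightarrow> bool" where
  "wf_qlayer n q k Ss = ((\<forall>S\<in>set Ss. wf_slot n q S) \<and> distinct (concat (map slot_regs Ss))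
      \<and> length Ss \<le> k)"

definition wf_spec :: "nat \<Rightarrow> nat \<Rightarrow> nat \<Rightarrow> qspec \<Rightarrow> bool" where
  "wf_spec n d k sp = (case sp of (q, init, Ls, Qs) \<Rightarrow>
      q \<le> k \<and> length init = q \<and> length Ls = Suc d \<and> length Qs = d
      \<and> (\<forall>L\<in>set Ls. wf_layer q L) \<and> (\<forall>S\<in>set Qs. wf_qlayer n q k S))"

definition qrun :: "nat \<Rightarrow> coracle \<Rightarrow> qspec \<Rightarrow> qstate" where
  "qrun n F sp = (case sp of (q, init, Ls, Qs) \<Rightarrow>
      apply_layer (Ls ! length Qs)
        (fold (\<lambda>(L, Ss) \<psi>. apply_oracle n F Ss (apply_layer L \<psi>)) (zip Ls Qs)
              (\<lambda>b. if b = init then 1 else 0)))"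

definition measure_all :: "nat \<Rightarrow> qstate \<Rightarrow> bool list pmf" where
  "measure_all q \<psi> = embed_pmf (\<lambda>y. if length y = q then (cmod (\<psi> y))\<^sup>2 else 0)"

text \<open>A family of CQ_d circuits (indexed by n): number of rounds m n, classical parts
  A n i (i = 1..m n) producing new classical memory and the quantum-circuit description,
  final classical part A_(m+1), and initial classical memory.\<close>
type_synonym 'm cqcircuit =
  "(nat \<Rightarrow> nat) \<times> (nat \<Rightarrow> nat \<Rightarrow> 'm \<times> bool list \<Rightarrow> ('m \<times> qspec) calg)
   \<times> (nat \<Rightarrow> 'm \<times> bool list \<Rightarrow> nat calg) \<times> (nat \<Rightarrow> 'm)"

primrec cq_rounds :: "nat \<Rightarrow> coracle \<Rightarrow> (nat \<Rightarrow> 'm \<times> bool list \<Rightarrow> ('m \<times> qspec) calg)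
     \<Rightarrow> nat \<Rightarrow> nat \<Rightarrow> 'm \<times> bool list \<Rightarrow> ('m \<times> bool list) pmf" where
  "cq_rounds n F A 0 i st = return_pmf st"
| "cq_rounds n F A (Suc k) i st =
     bind_pmf (run_calg (A i st) F) (\<lambda>(mem, sp).
       bind_pmf (measure_all (fst sp) (qrun n F sp)) (\<lambda>y. cq_rounds n F A k (Suc i) (mem, y)))"

definition cq_output :: "'m cqcircuit \<Rightarrow> nat \<Rightarrow> coracle \<Rightarrow> nat pmf" where
  "cq_output C n F = (case C of (m, A, Afin, init) \<Rightarrow>
      bind_pmf (cq_rounds n F (A n) (m n) 1 (init n, [])) (\<lambda>st. run_calg (Afin n st) F))"

definition is_CQ :: "nat \<Rightarrow> 'm cqcircuit \<Rightarrow> bool" where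
  "is_CQ d C = (case C of (m, A, Afin, init) \<Rightarrow> \<exists>p :: nat poly. \<forall>n.
      m n \<le> poly p n
      \<and> (\<forall>i\<in>{1..m n}. \<forall>st. calg_ok (A n i st) (poly p n) (\<lambda>(mem, sp). wf_spec n d (poly p n) sp))
      \<and> (\<forall>st. calg_ok (Afin n st) (poly p n) (\<lambda>_. True)))"

definition shuffled_simon_success :: "nat \<Rightarrow> 'm cqcircuit \<Rightarrow> nat \<Rightarrow> real" where
  "shuffled_simon_success d C n = pmf
     (bind_pmf (pmf_of_set (simon_pairs n)) (\<lambda>(g, s).
      bind_pmf (pmf_of_set (shuffle_lists n d)) (\<lambda>ts.
      map_pmf (\<lambda>out. out = s) (cq_output C n (shuffle_oracle n d g ts))))) True"

definition negl_fn :: "(nat \<Rightarrow> real) \<Rightarrow> bool" where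
  "negl_fn \<epsilon> = (\<forall>q :: nat poly. q \<noteq> 0 \<longrightarrow> (\<forall>\<^sub>F n in sequentially. \<epsilon> n < 1 / real (poly q n)))"

end

theory Submission
  imports Defs
begin

text \<open>Fix the tuples of the shuffler. In each quantum round the oracle of query layer \<open>c\<close> is replaced by
  a shadow that reveals the functions with index above \<open>c\<close> only along the paths of a set \<open>J\<close> of
  polynomially many indices. The simulated circuit needs the Simon function only on these sets and
  at its classical queries, so the classical lower bound for Simon's problem bounds its success.

  The state before layer \<open>c\<close> of the shadow run depends on the tuples occurring above level \<open>c\<close> only
  through the paths of \<open>J\<close>, and the remaining entries are hidden in an exponentially sparse random
  set. For a fixed specification of a round, a moment bound shows that all but an exponentially
  small fraction of the shuffles admit sets \<open>J\<close> outside of which the query weight is exponentially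
  small. The exponent is a polynomial of our choice (the size of \<open>J\<close>), so the bound survives a union
  bound over all histories, which consist of polynomially many bits. No conditioning on measurement
  outcomes is needed.\<close>

section \<open>Quantum states, gates and queries\<close>

text \<open>A circuit may enter a round already knowing some paths, learnt from classical queries or
  earlier measurements, and its specification may put all its query weight on them. No hidden set
  fixed in advance withstands this, so J has to be chosen from the shuffle itself. Such a choice
  spoils the uniformity of the hidden entries, and it is paid for by counting: adding r indices
  leaves an exceptional fraction \<rho>^r of the shuffles, but gives (2^n)^r possible choices which
  the next layer must survive. The increments of J therefore grow geometrically from layer to layer,
  which stays polynomial because d is constant. The number of histories is paid for by a common
  factor b of all increments.

  The depth enters through the indices alone. The functions are f_0, ..., f_d, the query layers are
  0, ..., d-1, and layer c sees in full only the functions up to index c. Hence f_d, the only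
  function that contains the Simon function, is visible to every layer only along J.\<close>

abbreviation bitstrings :: "nat \<Rightarrow> bool list set" where
  "bitstrings q \<equiv> {b. length b = q}"

lemma finite_bitstrings [simp]: "finite (bitstrings q)"
  using finite_lists_length_eq[of "UNIV :: bool set" q] by simp

lemma card_bitstrings [simp]: "card (bitstrings q) = 2 ^ q"
  using card_lists_length_eq[of "UNIV :: bool set" q] by simp

lemma length_set_reg [simp]: "length (set_reg b ps cs) = length b"
  by (induction b ps cs rule: set_reg.induct) auto

lemma length_get_reg [simp]: "length (get_reg b ps) = length ps"
  by (simp add: get_reg_def)

lemma nth_set_reg_notin: "p \<notin> set ps \<Longrightarrow> set_reg b ps cs ! p = b ! p"
  by (induction b ps cs rule: set_reg.induct) auto

lemma get_set_reg_disjoint: "set rs \<inter> set ps = {} \<Longrightarrow> get_reg (set_reg b ps cs) rs = get_reg b rs"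
  unfolding get_reg_def by (intro map_cong refl nth_set_reg_notin) auto

lemma get_set_reg:
  "distinct ps \<Longrightarrow> set ps \<subseteq> {..<length b} \<Longrightarrow> length cs = length ps \<Longrightarrow> get_reg (set_reg b ps cs) ps = cs"
proof (induction b ps cs rule: set_reg.induct)
  case (1 b p ps c cs)
  then have "get_reg (set_reg (b[p := c]) ps cs) ps = cs" by simp
  moreover have "set_reg (b[p := c]) ps cs ! p = c"
    using 1 by (simp add: nth_set_reg_notin)
  ultimately show ?case by (simp add: get_reg_def)
qed (auto simp: get_reg_def)

lemma set_reg_update_commute:
  "p \<notin> set ps \<Longrightarrow> (set_reg b ps cs)[p := x] = set_reg (b[p := x]) ps cs"
  by (induction b ps cs rule: set_reg.induct) (auto simp: list_update_swap)

lemma set_reg_set_reg: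
  "distinct ps \<Longrightarrow> length cs = length ps \<Longrightarrow> length ds = length ps \<Longrightarrow>
   set_reg (set_reg b ps cs) ps ds = set_reg b ps ds"
proof (induction ps arbitrary: b cs ds)
  case (Cons p ps)
  then obtain c cs' e ds' where "cs = c # cs'" "ds = e # ds'"
    by (metis length_Suc_conv)
  with Cons show ?case by (simp add: set_reg_update_commute)
qed auto

lemma set_reg_get_reg: "set_reg b ps (get_reg b ps) = b"
  by (induction ps arbitrary: b) (auto simp: get_reg_def)

text \<open>Exchanging the content of the register with the loose string z is an involution on the
  pairs (b, z). It lets a sum over basis states be split into fibres on which a gate acts as a small
  matrix, without naming the other qubits.\<close>

lemma sum_set_reg:
  fixes f :: "bool list \<Rightarrow> real"
  assumes "distinct ps" "set ps \<subseteq> {..<q}"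
  shows "(\<Sum>b\<in>bitstrings q. \<Sum>z\<in>bitstrings (length ps). f (set_reg b ps z))
    = 2 ^ length ps * (\<Sum>b\<in>bitstrings q. f b)"
proof -
  have "(\<Sum>b\<in>bitstrings q. \<Sum>z\<in>bitstrings (length ps). f (set_reg b ps z))
    = (\<Sum>(b, z)\<in>bitstrings q \<times> bitstrings (length ps). f (set_reg b ps z))"
    by (simp add: sum.cartesian_product)
  also have "\<dots> = (\<Sum>(b, z)\<in>bitstrings q \<times> bitstrings (length ps). f b)"
    by (rule sum.reindex_bij_witness[where i = "\<lambda>(b, z). (set_reg b ps z, get_reg b ps)"
          and j = "\<lambda>(b, z). (set_reg b ps z, get_reg b ps)"])
      (use assms in \<open>auto simp: set_reg_set_reg get_set_reg set_reg_get_reg\<close>)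
  also have "\<dots> = 2 ^ length ps * (\<Sum>b\<in>bitstrings q. f b)"
    by (simp add: sum.cartesian_product[symmetric] sum_distrib_left)
  finally show ?thesis .
qed

definition sqnorm :: "nat \<Rightarrow> qstate \<Rightarrow> real" where
  "sqnorm q \<psi> = (\<Sum>b\<in>bitstrings q. (cmod (\<psi> b))\<^sup>2)"

definition l2norm :: "nat \<Rightarrow> qstate \<Rightarrow> real" where
  "l2norm q \<psi> = L2_set (\<lambda>b. cmod (\<psi> b)) (bitstrings q)"

lemma l2norm_sqrt: "l2norm q \<psi> = sqrt (sqnorm q \<psi>)"
  by (simp add: l2norm_def L2_set_def sqnorm_def)

lemma l2norm_triangle:
  "l2norm q (\<lambda>b. \<phi> b - \<psi> b) \<le> l2norm q (\<lambda>b. \<phi> b - \<xi> b) + l2norm q (\<lambda>b. \<xi> b - \<psi> b)"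
proof -
  have "l2norm q (\<lambda>b. \<phi> b - \<psi> b)
      \<le> L2_set (\<lambda>b. cmod (\<phi> b - \<xi> b) + cmod (\<xi> b - \<psi> b)) (bitstrings q)"
    unfolding l2norm_def
    by (intro L2_set_mono) (metis norm_diff_triangle_ineq norm_triangle_ineq diff_add_cancel add_diff_eq, simp)
  also have "\<dots> \<le> l2norm q (\<lambda>b. \<phi> b - \<xi> b) + l2norm q (\<lambda>b. \<xi> b - \<psi> b)"
    unfolding l2norm_def by (rule L2_set_triangle_ineq)
  finally show ?thesis .
qed

lemma unitary_on_isometry:
  assumes "unitary_on k U"
  shows "(\<Sum>z\<in>bitstrings k. (cmod (\<Sum>c\<in>bitstrings k. U z c * v c))\<^sup>2)
    = (\<Sum>c\<in>bitstrings k. (cmod (v c))\<^sup>2)"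
proof -
  let ?B = "bitstrings k"
  have "complex_of_real (\<Sum>z\<in>?B. (cmod (\<Sum>c\<in>?B. U z c * v c))\<^sup>2)
    = (\<Sum>z\<in>?B. (\<Sum>c\<in>?B. U z c * v c) * (\<Sum>c'\<in>?B. cnj (U z c') * cnj (v c')))"
    unfolding of_real_sum complex_norm_square by (simp add: cnj_sum)
  also have "\<dots> = (\<Sum>z\<in>?B. \<Sum>c\<in>?B. \<Sum>c'\<in>?B. v c * cnj (v c') * (cnj (U z c') * U z c))"
    by (simp add: sum_product algebra_simps)
  also have "\<dots> = (\<Sum>c\<in>?B. \<Sum>c'\<in>?B. v c * cnj (v c') * (\<Sum>z\<in>?B. cnj (U z c') * U z c))"
    by (subst sum.swap, rule sum.cong[OF refl], subst sum.swap, simp add: sum_distrib_left)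
  also have "\<dots> = (\<Sum>c\<in>?B. \<Sum>c'\<in>?B. v c * cnj (v c') * (if c' = c then 1 else 0))"
    by (intro sum.cong refl arg_cong2[where f = "(*)"])
      (use assms in \<open>auto simp: unitary_on_def\<close>)
  also have "\<dots> = (\<Sum>c\<in>?B. v c * cnj (v c))"
    by (intro sum.cong refl) (simp add: if_distrib[where f = "\<lambda>x. _ * x"] cong: if_cong)
  also have "\<dots> = complex_of_real (\<Sum>c\<in>?B. (cmod (v c))\<^sup>2)"
    unfolding of_real_sum complex_norm_square ..
  finally show ?thesis using of_real_eq_iff by blast
qed

lemma sqnorm_apply_gate:
  assumes "wf_gate q G"
  shows "sqnorm q (apply_gate G \<psi>) = sqnorm q \<psi>"
proof -
  obtain ps U where G: "G = (ps, U)" by (cases G)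
  have ps: "distinct ps" "set ps \<subseteq> {..<q}" and U: "unitary_on (length ps) U"
    using assms by (auto simp: wf_gate_def G)
  let ?k = "length ps"
  \<comment> \<open>The factor pays for letting the basis state and the register content run
    independently; on each fibre the matrix acts on the vector with entries
    \<open>\<psi> (set_reg b ps c)\<close>.\<close>
  have "2 ^ ?k * sqnorm q (apply_gate G \<psi>)
    = (\<Sum>b\<in>bitstrings q. \<Sum>z\<in>bitstrings ?k. (cmod (apply_gate G \<psi> (set_reg b ps z)))\<^sup>2)"
    unfolding sqnorm_def by (rule sum_set_reg[OF ps, symmetric])
  also have "\<dots> = (\<Sum>b\<in>bitstrings q. \<Sum>z\<in>bitstrings ?k.
      (cmod (\<Sum>c\<in>bitstrings ?k. U z c * \<psi> (set_reg b ps c)))\<^sup>2)"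
    using ps by (intro sum.cong refl) (simp add: apply_gate_def G get_set_reg set_reg_set_reg)
  also have "\<dots> = (\<Sum>b\<in>bitstrings q. \<Sum>c\<in>bitstrings ?k. (cmod (\<psi> (set_reg b ps c)))\<^sup>2)"
    by (intro sum.cong refl unitary_on_isometry U)
  also have "\<dots> = 2 ^ ?k * sqnorm q \<psi>"
    unfolding sqnorm_def by (rule sum_set_reg[OF ps])
  finally show ?thesis by simp
qed

lemma apply_gate_diff:
  "apply_gate G (\<lambda>b. \<phi> b - \<psi> b) = (\<lambda>b. apply_gate G \<phi> b - apply_gate G \<psi> b)"
  by (simp add: apply_gate_def fun_eq_iff algebra_simps sum_subtractf)

lemma sqnorm_apply_layer:
  assumes "wf_layer q L"
  shows "sqnorm q (apply_layer L \<psi>) = sqnorm q \<psi>"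
proof -
  have "\<forall>G\<in>set L. wf_gate q G" using assms by (simp add: wf_layer_def)
  then have "sqnorm q (fold apply_gate L \<psi>) = sqnorm q \<psi>"
    by (induction L arbitrary: \<psi>) (auto simp: sqnorm_apply_gate)
  then show ?thesis by (simp add: apply_layer_def)
qed

lemma apply_layer_diff:
  "apply_layer L (\<lambda>b. \<phi> b - \<psi> b) = (\<lambda>b. apply_layer L \<phi> b - apply_layer L \<psi> b)"
  unfolding apply_layer_def
  by (induction L arbitrary: \<phi> \<psi>) (auto simp: apply_gate_diff)

section \<open>Oracle layers as permutations of the basis states\<close>

definition slot_query :: "qslot \<Rightarrow> bool list \<Rightarrow> nat \<times> nat option" where
  "slot_query S b = (case S of (ir, xr, ar) \<Rightarrow> (bits_to_nat (get_reg b ir), dec_val (get_reg b xr)))"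

definition slot_perm :: "nat \<Rightarrow> coracle \<Rightarrow> qslot \<Rightarrow> bool list \<Rightarrow> bool list" where
  "slot_perm n F S b = set_reg b (snd (snd S))
     (map2 (\<noteq>) (get_reg b (snd (snd S))) (enc_val n (case_prod F (slot_query S b))))"

lemma apply_slot_perm: "apply_slot n F S \<psi> = \<psi> \<circ> slot_perm n F S"
  by (auto simp: apply_slot_def slot_perm_def slot_query_def fun_eq_iff split: prod.splits)

text \<open>Applying a slot composes the state with a permutation on the right, so the slot applied
  first to the state acts last on the basis string.\<close>

fun oracle_perm :: "nat \<Rightarrow> coracle \<Rightarrow> qslot list \<Rightarrow> bool list \<Rightarrow> bool list" where
  "oracle_perm n F [] b = b"
| "oracle_perm n F (S # Ss) b = slot_perm n F S (oracle_perm n F Ss b)"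

lemma apply_oracle_perm: "apply_oracle n F Ss \<psi> = \<psi> \<circ> oracle_perm n F Ss"
  unfolding apply_oracle_def
  by (induction Ss arbitrary: \<psi>) (auto simp: apply_slot_perm fun_eq_iff)

lemma length_oracle_perm [simp]: "length (oracle_perm n F Ss b) = length b"
  by (induction Ss) (auto simp: slot_perm_def)

lemma length_enc_val [simp]: "length (enc_val n v) = 2 * n + 1"
  by (auto simp: enc_val_def nat_to_bits_def split: option.splits)

lemma map2_xor_xor: "length xs = length ys \<Longrightarrow> map2 (\<noteq>) (map2 (\<noteq>) xs ys) ys = xs"
  by (induction xs ys rule: list_induct2) auto

lemma get_reg_slot_perm:
  "set rs \<inter> set (snd (snd S)) = {} \<Longrightarrow> get_reg (slot_perm n F S b) rs = get_reg b rs"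
  by (simp add: slot_perm_def get_set_reg_disjoint)

text \<open>The output register is disjoint from the index and input registers, so the second
  application makes the same query and xors the same string again.\<close>

lemma slot_perm_involution:
  assumes "wf_slot n q S" "distinct (slot_regs S)" "length b = q"
  shows "slot_perm n F S (slot_perm n F S b) = b"
proof -
  obtain ir xr ar where S: "S = (ir, xr, ar)" by (cases S)
  have "set ir \<inter> set (snd (snd S)) = {}" "set xr \<inter> set (snd (snd S)) = {}"
    using assms(2) by (auto simp: S slot_regs_def)
  then have q: "slot_query S (slot_perm n F S b) = slot_query S b"
    unfolding slot_query_def using S by (simp add: get_reg_slot_perm)
  define e where "e = enc_val n (case_prod F (slot_query S b))"
  have ar: "distinct ar" "set ar \<subseteq> {..<q}" "length ar = 2 * n + 1"
    using assms by (auto simp: S wf_slot_def slot_regs_def)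
  have p: "slot_perm n F S b = set_reg b ar (map2 (\<noteq>) (get_reg b ar) e)"
    by (simp add: slot_perm_def e_def S)
  have "slot_perm n F S (slot_perm n F S b)
    = set_reg (slot_perm n F S b) ar (map2 (\<noteq>) (get_reg (slot_perm n F S b) ar) e)"
    by (subst slot_perm_def) (simp only: q, simp add: e_def S)
  also have "get_reg (slot_perm n F S b) ar = map2 (\<noteq>) (get_reg b ar) e"
    unfolding p using ar assms(3) by (intro get_set_reg) (auto simp: e_def)
  also have "map2 (\<noteq>) (map2 (\<noteq>) (get_reg b ar) e) e = get_reg b ar"
    using ar by (intro map2_xor_xor) (simp add: e_def)
  also have "set_reg (slot_perm n F S b) ar (get_reg b ar) = set_reg b ar (get_reg b ar)"
    unfolding p using ar by (intro set_reg_set_reg) (auto simp: e_def)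
  finally show ?thesis by (simp add: set_reg_get_reg)
qed

lemma wf_qlayer_slotD:
  assumes "wf_qlayer n q k Ss" "S \<in> set Ss"
  shows "wf_slot n q S" "distinct (slot_regs S)"
  using assms by (auto simp: wf_qlayer_def distinct_concat_iff)

lemma wf_qlayer_Cons:
  "wf_qlayer n q k (S # Ss) \<Longrightarrow> wf_qlayer n q k Ss"
  by (auto simp: wf_qlayer_def)

lemma bij_betw_oracle_perm:
  assumes "wf_qlayer n q k Ss"
  shows "bij_betw (oracle_perm n F Ss) (bitstrings q) (bitstrings q)"
  using assms
proof (induction Ss)
  case Nil
  show ?case by (simp add: bij_betw_def inj_on_def)
next
  case (Cons S Ss)
  have "bij_betw (slot_perm n F S) (bitstrings q) (bitstrings q)"
    by (rule bij_betw_byWitness[where f' = "slot_perm n F S"])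
      (use wf_qlayer_slotD[OF Cons.prems, of S] slot_perm_involution in \<open>auto simp: slot_perm_def\<close>)
  then have "bij_betw (slot_perm n F S \<circ> oracle_perm n F Ss) (bitstrings q) (bitstrings q)"
    using Cons.IH[OF wf_qlayer_Cons[OF Cons.prems]] bij_betw_trans by blast
  then show ?case by (simp add: comp_def)
qed

lemma sqnorm_apply_oracle:
  assumes "wf_qlayer n q k Ss"
  shows "sqnorm q (apply_oracle n F Ss \<psi>) = sqnorm q \<psi>"
  unfolding sqnorm_def apply_oracle_perm comp_def
  by (rule sum.reindex_bij_betw[OF bij_betw_oracle_perm[OF assms]])

lemma apply_oracle_diff:
  "apply_oracle n F Ss (\<lambda>b. \<phi> b - \<psi> b) = (\<lambda>b. apply_oracle n F Ss \<phi> b - apply_oracle n F Ss \<psi> b)"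
  by (simp add: apply_oracle_perm fun_eq_iff)

lemma get_reg_oracle_perm:
  "\<forall>S\<in>set Ss. set rs \<inter> set (snd (snd S)) = {} \<Longrightarrow> get_reg (oracle_perm n F Ss b) rs = get_reg b rs"
  by (induction Ss) (auto simp: get_reg_slot_perm)

lemma distinct_concat_map_disjoint:
  "distinct (concat (map f xs)) \<Longrightarrow> x \<in> set xs \<Longrightarrow> y \<in> set xs \<Longrightarrow> x \<noteq> y \<Longrightarrow> set (f x) \<inter> set (f y) = {}"
  by (induction xs) auto

lemma wf_qlayer_disjoint:
  assumes "wf_qlayer n q k Ss" "S \<in> set Ss" "S' \<in> set Ss"
  shows "(set (fst S) \<union> set (fst (snd S))) \<inter> set (snd (snd S')) = {}"
proof (cases "S = S'")
  case True
  with wf_qlayer_slotD(2)[OF assms(1,2)] show ?thesis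
    by (auto simp: slot_regs_def split: prod.splits)
next
  case False
  have "distinct (concat (map slot_regs Ss))" using assms by (simp add: wf_qlayer_def)
  then have "set (slot_regs S) \<inter> set (slot_regs S') = {}"
    by (rule distinct_concat_map_disjoint) (use assms False in auto)
  then show ?thesis by (cases S; cases S') (auto simp: slot_regs_def)
qed

text \<open>Every output register of a layer is disjoint from every query register. Only part of the
  layer acts here, because an induction over the slots meets a tail while the disjointness is known
  for the whole list.\<close>

lemma slot_query_oracle_perm_subset:
  assumes "wf_qlayer n q k Ss" "S \<in> set Ss" "set Ss' \<subseteq> set Ss"
  shows "slot_query S (oracle_perm n F Ss' b) = slot_query S b"
proof -
  obtain ir xr ar where S: "S = (ir, xr, ar)" by (cases S)
  have "\<forall>S'\<in>set Ss'. (set ir \<union> set xr) \<inter> set (snd (snd S')) = {}"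
    using wf_qlayer_disjoint[OF assms(1,2)] assms(3) unfolding S by simp blast
  then have "get_reg (oracle_perm n F Ss' b) ir = get_reg b ir"
    "get_reg (oracle_perm n F Ss' b) xr = get_reg b xr"
    by (simp_all add: get_reg_oracle_perm Int_Un_distrib2)
  then show ?thesis by (simp add: slot_query_def S)
qed

lemmas slot_query_oracle_perm = slot_query_oracle_perm_subset[OF _ _ subset_refl]

lemma oracle_perm_cong:
  assumes "wf_qlayer n q k Ss" "\<And>S. S \<in> set Ss \<Longrightarrow> case_prod F (slot_query S b) = case_prod G (slot_query S b)"
  shows "oracle_perm n F Ss b = oracle_perm n G Ss b"
  using assms
proof (induction Ss)
  case (Cons S Ss)
  then have "oracle_perm n F Ss b = oracle_perm n G Ss b" using wf_qlayer_Cons by auto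
  moreover have "case_prod F (slot_query S (oracle_perm n G Ss b))
    = case_prod G (slot_query S (oracle_perm n G Ss b))"
    using slot_query_oracle_perm_subset[OF Cons.prems(1), of S Ss G b] Cons.prems(2)[of S]
    by (simp add: subset_insertI)
  ultimately show ?case by (simp add: slot_perm_def)
qed auto

definition differing :: "nat \<Rightarrow> coracle \<Rightarrow> coracle \<Rightarrow> qslot list \<Rightarrow> bool list set" where
  "differing q F G Ss = {b \<in> bitstrings q. \<exists>S\<in>set Ss. case_prod F (slot_query S b) \<noteq> case_prod G (slot_query S b)}"

text \<open>One-way-to-hiding for a single parallel query: both oracles permute the basis states while
  fixing all query registers, so they map the set of basis states on which they differ to itself.\<close>

lemma sqnorm_apply_oracle_diff_le:
  assumes wf: "wf_qlayer n q k Ss"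
  shows "sqnorm q (\<lambda>b. apply_oracle n F Ss \<phi> b - apply_oracle n G Ss \<phi> b)
    \<le> 4 * (\<Sum>b\<in>differing q F G Ss. (cmod (\<phi> b))\<^sup>2)"
proof -
  let ?H = "differing q F G Ss"
  have fin: "finite ?H" by (simp add: differing_def)
  have bij: "bij_betw (oracle_perm n E Ss) ?H ?H" for E
  proof -
    have inj: "inj_on (oracle_perm n E Ss) ?H"
      using bij_betw_oracle_perm[OF wf, of E]
      by (auto simp: bij_betw_def differing_def intro: inj_on_subset)
    have sub: "oracle_perm n E Ss ` ?H \<subseteq> ?H"
      by (auto simp: differing_def slot_query_oracle_perm[OF wf])
    show ?thesis unfolding bij_betw_def using inj endo_inj_surj[OF fin sub inj] by simp
  qed
  \<comment> \<open>Source of the constant 4: no cancellation between the two images is exploited,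
    and each contributes twice its weight on the differing basis states.\<close>
  have tri: "(cmod (x - y))\<^sup>2 \<le> 2 * (cmod x)\<^sup>2 + 2 * (cmod y)\<^sup>2" for x y :: complex
  proof -
    have "(cmod (x - y))\<^sup>2 \<le> (cmod x + cmod y)\<^sup>2"
      by (intro power_mono norm_triangle_ineq4) simp
    also have "\<dots> \<le> 2 * (cmod x)\<^sup>2 + 2 * (cmod y)\<^sup>2"
      using sum_squares_bound[of "cmod x" "cmod y"] by (simp add: power2_sum)
    finally show ?thesis .
  qed
  have "sqnorm q (\<lambda>b. apply_oracle n F Ss \<phi> b - apply_oracle n G Ss \<phi> b)
    = (\<Sum>b\<in>?H. (cmod (\<phi> (oracle_perm n F Ss b) - \<phi> (oracle_perm n G Ss b)))\<^sup>2)"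
    unfolding sqnorm_def apply_oracle_perm comp_def
  proof (rule sum.mono_neutral_right)
    show "\<forall>b\<in>bitstrings q - ?H. (cmod (\<phi> (oracle_perm n F Ss b) - \<phi> (oracle_perm n G Ss b)))\<^sup>2 = 0"
      using oracle_perm_cong[OF wf, of F _ G] by (auto simp: differing_def)
  qed (auto simp: differing_def)
  also have "\<dots> \<le> (\<Sum>b\<in>?H. 2 * (cmod (\<phi> (oracle_perm n F Ss b)))\<^sup>2 + 2 * (cmod (\<phi> (oracle_perm n G Ss b)))\<^sup>2)"
    by (intro sum_mono tri)
  also have "\<dots> = 2 * (\<Sum>b\<in>?H. (cmod (\<phi> (oracle_perm n F Ss b)))\<^sup>2) + 2 * (\<Sum>b\<in>?H. (cmod (\<phi> (oracle_perm n G Ss b)))\<^sup>2)"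
    by (simp add: sum.distrib sum_distrib_left)
  also have "\<dots> = 4 * (\<Sum>b\<in>?H. (cmod (\<phi> b))\<^sup>2)"
    using sum.reindex_bij_betw[OF bij, of "\<lambda>b. (cmod (\<phi> b))\<^sup>2"] by simp
  finally show ?thesis .
qed

text \<open>Adding up over the slots may count a basis state several times. In return the weight is
  additive in the layer, and its total over v for fixed i is at most the number of slots.\<close>

definition query_weight :: "nat \<Rightarrow> qslot list \<Rightarrow> qstate \<Rightarrow> nat \<Rightarrow> nat \<Rightarrow> real" where
  "query_weight q Ss \<phi> i v =
     (\<Sum>S\<leftarrow>Ss. \<Sum>b | length b = q \<and> slot_query S b = (i, Some v). (cmod (\<phi> b))\<^sup>2)"

lemma query_weight_nonneg: "0 \<le> query_weight q Ss \<phi> i v"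
  unfolding query_weight_def by (intro sum_list_nonneg) (auto intro: sum_nonneg)

lemma sum_query_weight_le:
  assumes "finite A"
  shows "(\<Sum>v\<in>A. query_weight q Ss \<phi> i v) \<le> length Ss * sqnorm q \<phi>"
proof (induction Ss)
  case Nil then show ?case by (simp add: query_weight_def)
next
  case (Cons S Ss)
  have "(\<Sum>v\<in>A. \<Sum>b | length b = q \<and> slot_query S b = (i, Some v). (cmod (\<phi> b))\<^sup>2)
    = (\<Sum>b\<in>(\<Union>v\<in>A. {b. length b = q \<and> slot_query S b = (i, Some v)}). (cmod (\<phi> b))\<^sup>2)"
    using assms by (subst sum.UNION_disjoint) auto
  also have "\<dots> \<le> sqnorm q \<phi>"
    unfolding sqnorm_def by (intro sum_mono2) auto
  finally show ?case using Cons by (simp add: query_weight_def sum.distrib algebra_simps)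
qed

text \<open>Union bound over the slots and over the places P of disagreement: at a differing basis
  state some slot queries such a place. The places are proper inputs, since query weight does not
  record queries at \<open>None\<close>.\<close>

lemma sum_differing_le:
  assumes "finite P"
    and P: "\<And>i x. F i x \<noteq> G i x \<Longrightarrow> \<exists>v. x = Some v \<and> (i, v) \<in> P"
  shows "(\<Sum>b\<in>differing q F G Ss. (cmod (\<phi> b))\<^sup>2) \<le> (\<Sum>(i, v)\<in>P. query_weight q Ss \<phi> i v)"
proof (induction Ss)
  case Nil then show ?case by (simp add: query_weight_def differing_def)
next
  case (Cons S Ss)
  let ?D = "{b. length b = q \<and> case_prod F (slot_query S b) \<noteq> case_prod G (slot_query S b)}"
  let ?f = "\<lambda>b. (cmod (\<phi> b))\<^sup>2"
  have fin: "finite ?D" by simp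
  have "sum ?f ?D \<le> sum ?f (\<Union>p\<in>P. {b. length b = q \<and> slot_query S b = (fst p, Some (snd p))})"
  proof (rule sum_mono2)
    show "?D \<subseteq> (\<Union>p\<in>P. {b. length b = q \<and> slot_query S b = (fst p, Some (snd p))})"
    proof
      fix b assume "b \<in> ?D"
      then show "b \<in> (\<Union>p\<in>P. {b. length b = q \<and> slot_query S b = (fst p, Some (snd p))})"
        using P[of "fst (slot_query S b)" "snd (slot_query S b)"]
        by (cases "slot_query S b") force
    qed
  qed (use assms in auto)
  also have "\<dots> = (\<Sum>p\<in>P. \<Sum>b | length b = q \<and> slot_query S b = (fst p, Some (snd p)). ?f b)"
    using assms by (subst sum.UNION_disjoint) auto
  finally have 1: "sum ?f ?D \<le> \<dots>" .
  have "differing q F G (S # Ss) = ?D \<union> differing q F G Ss" by (auto simp: differing_def)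
  then have "sum ?f (differing q F G (S # Ss)) \<le> sum ?f ?D + sum ?f (differing q F G Ss)"
    using sum.union_inter[OF fin, of "differing q F G Ss" ?f]
      sum_nonneg[of "?D \<inter> differing q F G Ss" ?f]
    by (simp add: differing_def)
  also have "\<dots> \<le> (\<Sum>(i, v)\<in>P. query_weight q (S # Ss) \<phi> i v)"
    using 1 Cons by (simp add: query_weight_def sum.distrib case_prod_unfold)
  finally show ?case .
qed

section \<open>Measuring nearby states\<close>

lemma pmf_measure_all:
  assumes "sqnorm q \<psi> = 1"
  shows "pmf (measure_all q \<psi>) y = (if length y = q then (cmod (\<psi> y))\<^sup>2 else 0)"
  unfolding measure_all_def
proof (rule pmf_embed_pmf)
  have "(\<integral>\<^sup>+ x. ennreal (if length x = q then (cmod (\<psi> x))\<^sup>2 else 0) \<partial>count_space UNIV)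
    = (\<integral>\<^sup>+ x. ennreal ((cmod (\<psi> x))\<^sup>2) * indicator (bitstrings q) x \<partial>count_space UNIV)"
    by (intro nn_integral_cong) (auto simp: indicator_def)
  also have "\<dots> = (\<Sum>x\<in>bitstrings q. ennreal ((cmod (\<psi> x))\<^sup>2))"
    by (subst nn_integral_count_space_indicator[symmetric]) (auto simp: nn_integral_count_space_finite)
  also have "\<dots> = ennreal (sqnorm q \<psi>)"
    unfolding sqnorm_def by (subst sum_ennreal) auto
  finally show "(\<integral>\<^sup>+ x. ennreal (if length x = q then (cmod (\<psi> x))\<^sup>2 else 0) \<partial>count_space UNIV) = 1"
    using assms by simp
qed auto

lemma nn_integral_measure_all:
  assumes "sqnorm q \<psi> = 1"
  shows "(\<integral>\<^sup>+ y. h y \<partial>measure_all q \<psi>) = (\<Sum>y\<in>bitstrings q. h y * ennreal ((cmod (\<psi> y))\<^sup>2))"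
proof -
  have "set_pmf (measure_all q \<psi>) \<subseteq> bitstrings q"
    by (auto simp: set_pmf_iff pmf_measure_all[OF assms] split: if_splits)
  then have "(\<integral>\<^sup>+ y. h y \<partial>measure_all q \<psi>) = (\<Sum>y\<in>bitstrings q. h y * pmf (measure_all q \<psi>) y)"
    by (intro nn_integral_measure_pmf_support) (auto simp: set_pmf_iff)
  then show ?thesis by (simp add: pmf_measure_all[OF assms])
qed

text \<open>The squared moduli differ by a sum of moduli times a difference of moduli, and
  Cauchy-Schwarz with unit norms gives the factor 2. A test function h is used because h will be the
  success probability of all later rounds.\<close>

lemma nn_integral_measure_all_diff_le:
  assumes \<phi>: "sqnorm q \<phi> = 1" and \<psi>: "sqnorm q \<psi> = 1" and h: "\<And>y. h y \<le> 1"
  shows "(\<integral>\<^sup>+ y. h y \<partial>measure_all q \<phi>)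
    \<le> (\<integral>\<^sup>+ y. h y \<partial>measure_all q \<psi>) + ennreal (2 * l2norm q (\<lambda>b. \<phi> b - \<psi> b))"
proof -
  let ?B = "bitstrings q"
  have sq: "x\<^sup>2 \<le> y\<^sup>2 + (x + y) * e" if "0 \<le> x" "0 \<le> y" "x - y \<le> e" for x y e :: real
  proof -
    have "x\<^sup>2 - y\<^sup>2 = (x + y) * (x - y)" by (simp add: power2_eq_square algebra_simps)
    also have "\<dots> \<le> (x + y) * e" using that by (intro mult_left_mono) auto
    finally show ?thesis by simp
  qed
  have "(\<Sum>y\<in>?B. (cmod (\<phi> y) + cmod (\<psi> y)) * cmod (\<phi> y - \<psi> y))
    = (\<Sum>y\<in>?B. cmod (\<phi> y) * cmod (\<phi> y - \<psi> y)) + (\<Sum>y\<in>?B. cmod (\<psi> y) * cmod (\<phi> y - \<psi> y))"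
    by (simp add: algebra_simps sum.distrib)
  also have "\<dots> \<le> l2norm q \<phi> * l2norm q (\<lambda>b. \<phi> b - \<psi> b) + l2norm q \<psi> * l2norm q (\<lambda>b. \<phi> b - \<psi> b)"
    unfolding l2norm_def
    using L2_set_mult_ineq[of "\<lambda>y. cmod (\<phi> y)" "\<lambda>y. cmod (\<phi> y - \<psi> y)" ?B]
      L2_set_mult_ineq[of "\<lambda>y. cmod (\<psi> y)" "\<lambda>y. cmod (\<phi> y - \<psi> y)" ?B]
    by (intro add_mono) simp_all
  also have "\<dots> = 2 * l2norm q (\<lambda>b. \<phi> b - \<psi> b)"
    using \<phi> \<psi> by (simp add: l2norm_sqrt)
  finally have cs: "(\<Sum>y\<in>?B. (cmod (\<phi> y) + cmod (\<psi> y)) * cmod (\<phi> y - \<psi> y)) \<le> \<dots>" .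
  have "(\<integral>\<^sup>+ y. h y \<partial>measure_all q \<phi>) = (\<Sum>y\<in>?B. h y * ennreal ((cmod (\<phi> y))\<^sup>2))"
    by (rule nn_integral_measure_all[OF \<phi>])
  also have "\<dots> \<le> (\<Sum>y\<in>?B. h y * ennreal ((cmod (\<psi> y))\<^sup>2)
      + ennreal ((cmod (\<phi> y) + cmod (\<psi> y)) * cmod (\<phi> y - \<psi> y)))"
  proof (rule sum_mono)
    fix y
    let ?e = "(cmod (\<phi> y) + cmod (\<psi> y)) * cmod (\<phi> y - \<psi> y)"
    have "(cmod (\<phi> y))\<^sup>2 \<le> (cmod (\<psi> y))\<^sup>2 + ?e"
      by (intro sq norm_ge_zero norm_triangle_ineq2)
    then have "ennreal ((cmod (\<phi> y))\<^sup>2) \<le> ennreal ((cmod (\<psi> y))\<^sup>2) + ennreal ?e"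
      using ennreal_leI by (metis ennreal_plus zero_le_power2 mult_nonneg_nonneg add_nonneg_nonneg norm_ge_zero)
    then have "h y * ennreal ((cmod (\<phi> y))\<^sup>2) \<le> h y * ennreal ((cmod (\<psi> y))\<^sup>2) + h y * ennreal ?e"
      by (metis distrib_left mult_left_mono zero_le)
    also have "\<dots> \<le> h y * ennreal ((cmod (\<psi> y))\<^sup>2) + ennreal ?e"
      using mult_right_mono[OF h[of y], of "ennreal ?e"] by (intro add_left_mono) simp
    finally show "h y * ennreal ((cmod (\<phi> y))\<^sup>2) \<le> h y * ennreal ((cmod (\<psi> y))\<^sup>2) + ennreal ?e" .
  qed
  also have "\<dots> = (\<integral>\<^sup>+ y. h y \<partial>measure_all q \<psi>)
      + ennreal (\<Sum>y\<in>?B. (cmod (\<phi> y) + cmod (\<psi> y)) * cmod (\<phi> y - \<psi> y))"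
    by (simp add: sum.distrib nn_integral_measure_all[OF \<psi>] sum_ennreal)
  also have "\<dots> \<le> (\<integral>\<^sup>+ y. h y \<partial>measure_all q \<psi>) + ennreal (2 * l2norm q (\<lambda>b. \<phi> b - \<psi> b))"
    using cs by (intro add_left_mono ennreal_leI)
  finally show ?thesis .
qed

section \<open>Classical query complexity of Simon's problem\<close>

text \<open>Randomised decision trees with at most Q queries to g, given by their semantics instead
  of a syntax tree, so that a circuit run can be recognised as one without translation. Computation
  between queries is free. A sampled distribution may depend on g only through earlier answers. Bit
  strings suffice as samples, since they cover coins and measurement outcomes.\<close>

inductive query_alg :: "nat \<Rightarrow> nat \<Rightarrow> ((nat \<Rightarrow> nat) \<Rightarrow> 'a pmf) \<Rightarrow> bool" for N where
  ret: "query_alg N Q (\<lambda>g. return_pmf a)"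
| samp: "(\<And>y. query_alg N Q (k y)) \<Longrightarrow> query_alg N Q (\<lambda>g. bind_pmf (p :: bool list pmf) (\<lambda>y. k y g))"
| qry: "x < N \<Longrightarrow> (\<And>v. query_alg N Q (k v)) \<Longrightarrow> query_alg N (Suc Q) (\<lambda>g. k (g x) g)"

lemma query_alg_Suc: "query_alg N Q f \<Longrightarrow> query_alg N (Suc Q) f"
  by (induction Q f rule: query_alg.induct) (auto intro: query_alg.intros)

lemma query_alg_mono: "Q \<le> Q' \<Longrightarrow> query_alg N Q f \<Longrightarrow> query_alg N Q' f"
  by (induction Q' rule: dec_induct) (auto intro: query_alg_Suc)

text \<open>One query per point of J buys the table of g on J, which the continuation then uses as
  plain data. This is how an oracle depending on g only through J is simulated.\<close>

lemma query_alg_restrict: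
  assumes "finite J" "J \<subseteq> {..<N}" "\<And>\<gamma>. query_alg N Q (k \<gamma>)"
  shows "query_alg N (card J + Q) (\<lambda>g. k (restrict g J) g)"
  using assms
proof (induction J arbitrary: k rule: finite_induct)
  case empty
  then show ?case by simp
next
  case (insert x J)
  have "query_alg N (card J + Q) (\<lambda>g. k ((restrict g J)(x := v)) g)" for v
    using insert.IH[of "\<lambda>\<gamma>. k (\<gamma>(x := v))"] insert.prems by blast
  then have "query_alg N (Suc (card J + Q)) (\<lambda>g. k ((restrict g J)(x := g x)) g)"
    using insert.prems query_alg.qry[of x N _ "\<lambda>v g. k ((restrict g J)(x := v)) g"] by simp
  moreover have "(restrict g J)(x := g x) = restrict g (insert x J)" for g :: "nat \<Rightarrow> nat"
    by (auto simp: restrict_def)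
  ultimately have "query_alg N (Suc (card J + Q)) (\<lambda>g. k (restrict g (insert x J)) g)"
    by (simp only:)
  moreover have "card (insert x J) + Q = Suc (card J + Q)" using insert.hyps by simp
  ultimately show ?case by (simp only:)
qed

section \<open>Simon functions as permutations read at coset representatives\<close>

definition coset_rep :: "nat \<Rightarrow> nat \<Rightarrow> nat" where
  "coset_rep s x = min x (xor x s)"

lemma xor_less_power2: "x < 2 ^ n \<Longrightarrow> y < 2 ^ n \<Longrightarrow> xor x y < (2 ^ n :: nat)"
  by (metis take_bit_nat_eq_self_iff take_bit_xor)

lemma xor_xor_cancel [simp]: "xor (xor x s) s = (x :: nat)"
  by (simp add: xor.assoc)

lemma xor_eq_iff: "xor x y = s \<longleftrightarrow> y = xor x (s :: nat)"
  by (metis xor.assoc xor.commute xor_self_eq xor.right_neutral)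

lemma coset_rep_eq_iff: "coset_rep s x = coset_rep s y \<longleftrightarrow> y = x \<or> y = xor x s"
proof
  assume "coset_rep s x = coset_rep s y"
  then have "y = x \<or> y = xor x s \<or> x = xor y s \<or> xor x s = xor y s"
    unfolding coset_rep_def by (auto simp: min_def split: if_splits)
  then show "y = x \<or> y = xor x s" by (metis xor_xor_cancel)
qed (auto simp: coset_rep_def min.commute)

lemma coset_rep_less: "x < 2 ^ n \<Longrightarrow> s < 2 ^ n \<Longrightarrow> coset_rep s x < 2 ^ n"
  by (simp add: coset_rep_def)

text \<open>As s is nonzero, every coset has two elements, and xor with s exchanges the smaller with
  the larger ones.\<close>

lemma card_coset_reps:
  assumes "s \<in> {1..<2 ^ n}"
  shows "2 * card (coset_rep s ` {..<2 ^ n}) = 2 ^ n"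
proof -
  let ?A = "{..<2 ^ n :: nat}"
  have ne: "xor x s \<noteq> x" for x using assms xor_eq_iff[of x s x] by auto
  let ?R = "coset_rep s ` ?A"
  let ?L = "{x \<in> ?A. x < xor x s}" and ?G = "{x \<in> ?A. x > xor x s}"
  have lt: "xor x s < 2 ^ n" if "x < 2 ^ n" for x using that assms by (simp add: xor_less_power2)
  have R: "?R = ?L"
  proof (intro equalityI subsetI)
    fix y assume "y \<in> ?R"
    then obtain x where x: "x < 2 ^ n" "y = coset_rep s x" by auto
    then show "y \<in> ?L" using ne[of x] lt[of x]
      by (cases "x < xor x s") (auto simp: coset_rep_def min_def)
  next
    fix y assume "y \<in> ?L"
    then show "y \<in> ?R" by (intro image_eqI[of _ _ y]) (auto simp: coset_rep_def)
  qed
  have "bij_betw (\<lambda>x. xor x s) ?L ?G"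
    by (rule bij_betw_byWitness[where f' = "\<lambda>x. xor x s"]) (auto simp: lt)
  then have "card ?L = card ?G" by (rule bij_betw_same_card)
  moreover have "?A = ?L \<union> ?G"
  proof (intro equalityI subsetI)
    fix x assume "x \<in> ?A"
    then show "x \<in> ?L \<union> ?G" using ne[of x] by (cases "x < xor x s") auto
  qed auto
  moreover have "card (?L \<union> ?G) = card ?L + card ?G" by (rule card_Un_disjoint) auto
  ultimately have "card ?A = 2 * card ?L" by presburger
  then show ?thesis using R by simp
qed

definition injections :: "'a set \<Rightarrow> 'b set \<Rightarrow> ('a \<Rightarrow> 'b) set" where
  "injections A B = {h \<in> A \<rightarrow>\<^sub>E B. inj_on h A}"

lemma finite_injections: "finite A \<Longrightarrow> finite B \<Longrightarrow> finite (injections A B)"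
  by (rule finite_subset[of _ "A \<rightarrow>\<^sub>E B"]) (simp_all add: injections_def finite_PiE)

lemma card_injections_extending:
  assumes "finite A" "finite B" "card A = card B" "D \<subseteq> A" "inj_on \<gamma> D" "\<gamma> ` D \<subseteq> B"
  shows "card {h \<in> injections A B. \<forall>y\<in>D. h y = \<gamma> y} = fact (card A - card D)"
  using assms(4-6)
proof (induction "card A - card D" arbitrary: D \<gamma>)
  case 0
  then have D: "D = A" using card_seteq[OF assms(1), of D] by simp
  have "{h \<in> injections A B. \<forall>y\<in>D. h y = \<gamma> y} = {restrict \<gamma> A}"
  proof (intro equalityI subsetI)
    fix h assume "h \<in> {h \<in> injections A B. \<forall>y\<in>D. h y = \<gamma> y}"
    then have "h \<in> extensional A" "\<And>y. y \<in> A \<Longrightarrow> h y = \<gamma> y"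
      unfolding D injections_def by (simp_all add: PiE_iff)
    then have "h = restrict \<gamma> A"
      by (intro extensionalityI[of _ A]) simp_all
    then show "h \<in> {restrict \<gamma> A}" by simp
  next
    fix h assume "h \<in> {restrict \<gamma> A}"
    then show "h \<in> {h \<in> injections A B. \<forall>y\<in>D. h y = \<gamma> y}"
      using 0 unfolding D injections_def by (auto simp: inj_on_restrict_eq)
  qed
  then show ?case using D by simp
next
  case (Suc m)
  then have "D \<noteq> A" by auto
  then obtain x where x: "x \<in> A" "x \<notin> D" using Suc.prems by auto
  have finD: "finite D" using Suc.prems(1) assms(1) by (rule finite_subset)
  let ?E = "\<lambda>v. {h \<in> injections A B. \<forall>y\<in>insert x D. h y = (\<gamma>(x := v)) y}"
  have "{h \<in> injections A B. \<forall>y\<in>D. h y = \<gamma> y} = (\<Union>v\<in>B - \<gamma> ` D. ?E v)" (is "?L = ?R")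
  proof (intro equalityI subsetI)
    fix h assume h: "h \<in> ?L"
    have "h x \<notin> \<gamma> ` D"
    proof
      assume "h x \<in> \<gamma> ` D"
      then obtain y where y: "y \<in> D" "h x = h y" using h by auto
      have "inj_on h A" using h by (simp add: injections_def)
      then show False using y x Suc.prems(1) by (metis inj_onD subsetD)
    qed
    moreover have "h x \<in> B" using h x by (auto simp: injections_def)
    ultimately have "h x \<in> B - \<gamma> ` D" by simp
    moreover have "h \<in> ?E (h x)" using h by simp
    ultimately show "h \<in> ?R" by (rule UN_I)
  next
    fix h assume "h \<in> ?R"
    then obtain v where v: "h \<in> injections A B" "\<forall>y\<in>insert x D. h y = (\<gamma>(x := v)) y" by blast
    have "h y = \<gamma> y" if "y \<in> D" for y
      using v(2) that x(2) by (metis fun_upd_other insertCI)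
    with v(1) show "h \<in> ?L" by blast
  qed
  also have "card \<dots> = (\<Sum>v\<in>B - \<gamma> ` D. card (?E v))"
  proof (rule card_UN_disjoint)
    show "\<forall>v\<in>B - \<gamma> ` D. \<forall>w\<in>B - \<gamma> ` D. v \<noteq> w \<longrightarrow> ?E v \<inter> ?E w = {}"
      by (auto simp: ball_simps)
  qed (use assms(2) finite_injections[OF assms(1,2)] in simp_all)
  also have "\<dots> = (\<Sum>v\<in>B - \<gamma> ` D. fact m)"
  proof (rule sum.cong[OF refl])
    fix v assume v: "v \<in> B - \<gamma> ` D"
    have m: "m = card A - card (insert x D)" using Suc.hyps(2) x finD by (simp add: card_insert_disjoint)
    have inj: "inj_on (\<gamma>(x := v)) (insert x D)"
    proof -
      have "inj_on (\<gamma>(x := v)) D" using v Suc.prems(2) by (intro inj_on_fun_updI) auto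
      moreover have "(\<gamma>(x := v)) ` (D - {x}) = \<gamma> ` D" using x(2) by (intro image_cong) auto
      ultimately show ?thesis using v by (simp only: inj_on_insert) simp
    qed
    have img: "(\<gamma>(x := v)) ` insert x D \<subseteq> B" using v x Suc.prems(3) by auto
    have "insert x D \<subseteq> A" using x Suc.prems(1) by simp
    then show "card (?E v) = fact m"
      unfolding m by (rule Suc.hyps(1)[OF m _ inj img])
  qed
  also have "\<dots> = (card B - card D) * fact m"
    using Suc.prems by (simp add: card_Diff_subset finD card_image)
  also have "\<dots> = fact (card A - card D)"
    using Suc.hyps(2)[symmetric] assms(3) by simp
  finally show ?case .
qed

lemma card_injections_extending_le:
  assumes "finite A" "finite B" "card A = card B" "D \<subseteq> A"
  shows "card {h \<in> injections A B. \<forall>y\<in>D. h y = \<gamma> y} \<le> fact (card A - card D)"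
proof (cases "{h \<in> injections A B. \<forall>y\<in>D. h y = \<gamma> y} = {}")
  case False
  then obtain h where h: "h \<in> A \<rightarrow>\<^sub>E B" "inj_on h A" "\<forall>y\<in>D. h y = \<gamma> y" by (auto simp: injections_def)
  then have "\<gamma> ` D \<subseteq> B" using assms(4) by (force simp: PiE_iff)
  moreover have "inj_on \<gamma> D"
    using h assms(4) by (metis (mono_tags, lifting) inj_on_cong inj_on_subset)
  ultimately show ?thesis using card_injections_extending[OF assms] by simp
next
  case True
  show ?thesis unfolding True by simp
qed

text \<open>Generates a Simon function from a shift s and a permutation h of all N values, of which
  the values at the representatives are used. With this redundancy the number of h compatible with
  given answers becomes a factorial that does not mention s.\<close>

definition simon_fun :: "nat \<Rightarrow> nat \<Rightarrow> (nat \<Rightarrow> nat) \<Rightarrow> nat \<Rightarrow> nat" where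
  "simon_fun n s h = (\<lambda>x\<in>{..<2 ^ n}. h (coset_rep s x))"

abbreviation perms :: "nat \<Rightarrow> (nat \<Rightarrow> nat) set" where
  "perms n \<equiv> injections {..<2 ^ n} {..<2 ^ n}"

text \<open>The shifts still possible when the points of J have been asked and no collision was
  seen.\<close>

definition open_shifts :: "nat \<Rightarrow> nat set \<Rightarrow> nat set" where
  "open_shifts n J = {s \<in> {1..<2 ^ n}. \<forall>x\<in>J. \<forall>y\<in>J. xor x y \<noteq> s}"

lemma inj_on_coset_rep:
  assumes "s \<in> open_shifts n J" shows "inj_on (coset_rep s) J"
proof (rule inj_onI)
  fix x y assume *: "x \<in> J" "y \<in> J" "coset_rep s x = coset_rep s y"
  then have "y = x \<or> xor x y = s" by (metis coset_rep_eq_iff xor_eq_iff)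
  then show "x = y" using assms * by (auto simp: open_shifts_def)
qed

text \<open>For an open shift no two points of J share a coset, so the answers prescribe h at card J
  different representatives. That the bound is the same for all open shifts is the precise sense in
  which collision-free answers do not single one out.\<close>

lemma card_perms_coset_le:
  assumes "s \<in> open_shifts n J" "J \<subseteq> {..<2 ^ n}"
  shows "card {h \<in> perms n. \<forall>y\<in>J. simon_fun n s h y = \<gamma> y} \<le> fact (2 ^ n - card J)"
proof -
  let ?r = "coset_rep s" and ?\<gamma> = "\<gamma> \<circ> inv_into J (coset_rep s)"
  have inj: "inj_on ?r J" by (rule inj_on_coset_rep[OF assms(1)])
  have s: "s < 2 ^ n" using assms by (auto simp: open_shifts_def)
  have "{h \<in> perms n. \<forall>y\<in>J. simon_fun n s h y = \<gamma> y}
    = {h \<in> perms n. \<forall>y\<in>?r ` J. h y = ?\<gamma> y}"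
    using assms(2) inj by (auto simp: simon_fun_def)
  moreover have "?r ` J \<subseteq> {..<2 ^ n}" using assms(2) s by (auto intro: coset_rep_less)
  ultimately show ?thesis
    using card_injections_extending_le[of "{..<2 ^ n :: nat}" "{..<2 ^ n :: nat}" "?r ` J" ?\<gamma>]
    by (simp add: card_image inj)
qed

text \<open>Lazy sampling: as long as the queried points contain no collision, the answers are
  distinct uniform values and carry no information on which of the open shifts is the hidden one.
  The bound is on the expected number of shifts for which the algorithm succeeds; the query
  following the set \<open>J\<close> closes at most \<open>card J\<close> shifts, and the final guess serves one more.\<close>

lemma query_alg_simon_aux:
  assumes "query_alg (2 ^ n) Q f" "J \<subseteq> {..<2 ^ n}" "inj_on \<gamma> J" "\<gamma> ` J \<subseteq> {..<2 ^ n}"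
  shows "(\<Sum>s\<in>open_shifts n J. \<Sum>h | h \<in> perms n \<and> (\<forall>y\<in>J. simon_fun n s h y = \<gamma> y).
      ennreal (pmf (f (simon_fun n s h)) s))
    \<le> ennreal (real (fact (2 ^ n - card J) * (1 + Q * (card J + Q))))"
  using assms
proof (induction Q f arbitrary: J \<gamma> rule: query_alg.induct)
  case (ret Q a)
  let ?H = "\<lambda>s. {h \<in> perms n. \<forall>y\<in>J. simon_fun n s h y = \<gamma> y}"
  have fin: "finite (open_shifts n J)" by (simp add: open_shifts_def)
  have "(\<Sum>s\<in>open_shifts n J. \<Sum>h\<in>?H s. ennreal (pmf (return_pmf a) s))
    = (\<Sum>s\<in>open_shifts n J. if s = a then of_nat (card (?H s)) else 0)"
    by (intro sum.cong refl) (auto simp: indicator_def)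
  also have "\<dots> \<le> of_nat (fact (2 ^ n - card J))"
    using card_perms_coset_le[of a n J \<gamma>] ret fin
    by (auto simp: sum.delta intro!: of_nat_mono simp del: of_nat_fact)
  also have "\<dots> \<le> ennreal (real (fact (2 ^ n - card J) * (1 + Q * (card J + Q))))"
    by (subst ennreal_of_nat_eq_real_of_nat, intro ennreal_leI of_nat_mono) simp
  finally show ?case .
next
  case (samp Q k p)
  let ?H = "\<lambda>s. {h \<in> perms n. \<forall>y\<in>J. simon_fun n s h y = \<gamma> y}"
  let ?B = "ennreal (real (fact (2 ^ n - card J) * (1 + Q * (card J + Q))))"
  have "(\<Sum>s\<in>open_shifts n J. \<Sum>h\<in>?H s. ennreal (pmf (bind_pmf p (\<lambda>y. k y (simon_fun n s h))) s))
    = (\<integral>\<^sup>+ y. (\<Sum>s\<in>open_shifts n J. \<Sum>h\<in>?H s. ennreal (pmf (k y (simon_fun n s h)) s)) \<partial>p)"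
    unfolding ennreal_pmf_bind
    by (subst nn_integral_sum, simp, intro sum.cong refl nn_integral_sum[symmetric]) simp
  also have "\<dots> \<le> (\<integral>\<^sup>+ y. ?B \<partial>p)"
    by (intro nn_integral_mono) (use samp in auto)
  also have "\<dots> = ?B" by simp
  finally show ?case .
next
  case (qry x Q k)
  let ?H = "\<lambda>J \<gamma> s. {h \<in> perms n. \<forall>y\<in>J. simon_fun n s h y = \<gamma> y}"
  let ?N = "2 ^ n :: nat"
  have finJ: "finite J" using qry.prems finite_subset by blast
  have finH: "finite (?H J \<gamma> s)" for J \<gamma> s by (simp add: finite_injections)
  show ?case
  proof (cases "x \<in> J")
    case True
    have "(\<Sum>s\<in>open_shifts n J. \<Sum>h\<in>?H J \<gamma> s. ennreal (pmf (k (simon_fun n s h x) (simon_fun n s h)) s))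
      = (\<Sum>s\<in>open_shifts n J. \<Sum>h\<in>?H J \<gamma> s. ennreal (pmf (k (\<gamma> x) (simon_fun n s h)) s))"
      using True by (intro sum.cong refl) auto
    also have "\<dots> \<le> ennreal (real (fact (2 ^ n - card J) * (1 + Q * (card J + Q))))"
      by (rule qry.IH[OF qry.prems])
    also have "\<dots> \<le> ennreal (real (fact (2 ^ n - card J) * (1 + Suc Q * (card J + Suc Q))))"
      by (intro ennreal_leI of_nat_mono mult_left_mono add_left_mono mult_mono) auto
    finally show ?thesis .
  next
    case False
    let ?J = "insert x J"
    have J': "?J \<subseteq> {..<?N}" using qry by auto
    have card_less: "card J < ?N"
      using False J' finJ by (metis card_insert_disjoint card_lessThan card_mono finite_lessThan less_eq_Suc_le)
    define X where "X = (\<lambda>s h. ennreal (pmf (k (simon_fun n s h x) (simon_fun n s h)) s))"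
    have X1: "X s h \<le> 1" for s h by (simp add: X_def pmf_le_1)
    have sub: "open_shifts n ?J \<subseteq> open_shifts n J" by (auto simp: open_shifts_def)
    have fin: "finite (open_shifts n J)" by (simp add: open_shifts_def)
    \<comment> \<open>The shifts closed by asking x. Each is xor x y for an earlier y, and on these
      the success probability is estimated by 1.\<close>
    let ?C = "open_shifts n J - open_shifts n ?J"
    have "?C \<subseteq> (\<lambda>y. xor x y) ` J"
      by (auto simp: open_shifts_def xor.commute)
    then have cardC: "card ?C \<le> card J"
      by (meson card_image_le card_mono finJ finite_imageI le_trans)
    have closed: "(\<Sum>s\<in>?C. \<Sum>h\<in>?H J \<gamma> s. X s h) \<le> of_nat (card J * fact (?N - card J))"
    proof -
      have "(\<Sum>s\<in>?C. \<Sum>h\<in>?H J \<gamma> s. X s h) \<le> (\<Sum>s\<in>?C. of_nat (fact (?N - card J)))"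
      proof (rule sum_mono)
        fix s assume "s \<in> ?C"
        have "(\<Sum>h\<in>?H J \<gamma> s. X s h) \<le> (\<Sum>h\<in>?H J \<gamma> s. 1)" by (intro sum_mono X1)
        also have "\<dots> = of_nat (card (?H J \<gamma> s))" by simp
        also have "\<dots> \<le> of_nat (fact (?N - card J))"
          using card_perms_coset_le[of s n J \<gamma>] \<open>s \<in> ?C\<close> qry.prems by (intro of_nat_mono) auto
        finally show "(\<Sum>h\<in>?H J \<gamma> s. X s h) \<le> of_nat (fact (?N - card J))" .
      qed
      also have "\<dots> = of_nat (card ?C * fact (?N - card J))" by simp
      also have "\<dots> \<le> of_nat (card J * fact (?N - card J))"
        by (intro of_nat_mono mult_right_mono cardC) auto
      finally show ?thesis .
    qed
    \<comment> \<open>For a shift that stays open, x lies in a new coset; its value differs from all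
      earlier answers, and the permutations are split by that value.\<close>
    have split: "(\<Sum>h\<in>?H J \<gamma> s. X s h) \<le> (\<Sum>v\<in>{..<?N} - \<gamma> ` J. \<Sum>h\<in>?H ?J (\<gamma>(x := v)) s. X s h)"
      if s: "s \<in> open_shifts n ?J" for s
    proof -
      have slt: "s < ?N" using s by (auto simp: open_shifts_def)
      have cover: "?H J \<gamma> s \<subseteq> (\<Union>v\<in>{..<?N} - \<gamma> ` J. ?H ?J (\<gamma>(x := v)) s)"
      proof
        fix h assume h: "h \<in> ?H J \<gamma> s"
        have hp: "h \<in> {..<?N} \<rightarrow>\<^sub>E {..<?N}" "inj_on h {..<?N}" using h by (auto simp: injections_def)
        have "simon_fun n s h x < ?N"
          using hp(1) coset_rep_less[of x n s] slt qry.hyps(1) by (auto simp: simon_fun_def)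
        moreover have "simon_fun n s h x \<notin> \<gamma> ` J"
        proof
          assume "simon_fun n s h x \<in> \<gamma> ` J"
          then obtain y where y: "y \<in> J" "simon_fun n s h x = simon_fun n s h y" using h by auto
          then have "coset_rep s x = coset_rep s y"
            using hp(2) slt qry.hyps(1) qry.prems coset_rep_less
            by (auto simp: simon_fun_def subset_iff inj_on_def)
          then show False
            using inj_on_coset_rep[OF s] y(1) False by (auto simp: inj_on_def)
        qed
        moreover have "h \<in> ?H ?J (\<gamma>(x := simon_fun n s h x)) s" using h False by auto
        ultimately show "h \<in> (\<Union>v\<in>{..<?N} - \<gamma> ` J. ?H ?J (\<gamma>(x := v)) s)" by blast
      qed
      have "(\<Sum>h\<in>?H J \<gamma> s. X s h) \<le> (\<Sum>h\<in>(\<Union>v\<in>{..<?N} - \<gamma> ` J. ?H ?J (\<gamma>(x := v)) s). X s h)"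
      proof (rule sum_mono2)
        show "finite (\<Union>v\<in>{..<?N} - \<gamma> ` J. ?H ?J (\<gamma>(x := v)) s)"
          by (intro finite_UN_I finH) simp
      qed (use cover in simp_all)
      also have "\<dots> = (\<Sum>v\<in>{..<?N} - \<gamma> ` J. \<Sum>h\<in>?H ?J (\<gamma>(x := v)) s. X s h)"
      proof (rule sum.UNION_disjoint)
        show "\<forall>v\<in>{..<?N} - \<gamma> ` J. finite (?H ?J (\<gamma>(x := v)) s)" using finH by blast
      qed auto
      finally show ?thesis .
    qed
    have cardV: "card ({..<?N} - \<gamma> ` J) = ?N - card J"
      using qry.prems finJ by (simp add: card_Diff_subset card_image)
    let ?B = "ennreal (real (fact (?N - card ?J) * (1 + Q * (card ?J + Q))))"
    \<comment> \<open>The number of possible answers times the count after the query is the count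
      before it, so the only loss of a query is the closed shifts.\<close>
    have fact: "fact (?N - card J) = (?N - card J) * (fact (?N - card ?J) :: nat)"
      using card_less False finJ by (simp add: fact_reduce)
    have "(\<Sum>s\<in>open_shifts n ?J. \<Sum>h\<in>?H J \<gamma> s. X s h)
      \<le> (\<Sum>s\<in>open_shifts n ?J. \<Sum>v\<in>{..<?N} - \<gamma> ` J. \<Sum>h\<in>?H ?J (\<gamma>(x := v)) s. X s h)"
      by (intro sum_mono split)
    also have "\<dots> = (\<Sum>v\<in>{..<?N} - \<gamma> ` J. \<Sum>s\<in>open_shifts n ?J. \<Sum>h\<in>?H ?J (\<gamma>(x := v)) s. X s h)"
      by (rule sum.swap)
    also have "\<dots> = (\<Sum>v\<in>{..<?N} - \<gamma> ` J. \<Sum>s\<in>open_shifts n ?J. \<Sum>h\<in>?H ?J (\<gamma>(x := v)) s.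
        ennreal (pmf (k v (simon_fun n s h)) s))"
      by (intro sum.cong refl) (auto simp: X_def)
    also have "\<dots> \<le> (\<Sum>v\<in>{..<?N} - \<gamma> ` J. ?B)"
    proof (rule sum_mono)
      fix v assume v: "v \<in> {..<?N} - \<gamma> ` J"
      have "inj_on (\<gamma>(x := v)) ?J" using v False qry.prems by (auto simp: inj_on_def)
      moreover have "(\<gamma>(x := v)) ` ?J \<subseteq> {..<?N}" using v False qry.prems by auto
      ultimately show "(\<Sum>s\<in>open_shifts n ?J. \<Sum>h\<in>?H ?J (\<gamma>(x := v)) s.
        ennreal (pmf (k v (simon_fun n s h)) s)) \<le> ?B"
        by (intro qry.IH J')
    qed
    also have "\<dots> = of_nat (?N - card J) * ?B" using cardV by simp
    also have "\<dots> = ennreal (real (fact (?N - card J) * (1 + Q * (card ?J + Q))))"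
      unfolding fact ennreal_of_nat_eq_real_of_nat
      by (subst ennreal_mult'[symmetric], simp) (simp only: of_nat_mult mult.assoc)
    finally have rest: "(\<Sum>s\<in>open_shifts n ?J. \<Sum>h\<in>?H J \<gamma> s. X s h) \<le> \<dots>" .
    have "(\<Sum>s\<in>open_shifts n J. \<Sum>h\<in>?H J \<gamma> s. X s h)
      = (\<Sum>s\<in>?C. \<Sum>h\<in>?H J \<gamma> s. X s h) + (\<Sum>s\<in>open_shifts n ?J. \<Sum>h\<in>?H J \<gamma> s. X s h)"
      by (rule sum.subset_diff[OF sub fin])
    also have "\<dots> \<le> of_nat (card J * fact (?N - card J))
        + ennreal (real (fact (?N - card J) * (1 + Q * (card ?J + Q))))"
      by (intro add_mono closed rest)
    also have "\<dots> = ennreal (real (card J * fact (?N - card J) + fact (?N - card J) * (1 + Q * (card ?J + Q))))"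
      by (simp add: ennreal_of_nat_eq_real_of_nat ennreal_plus[symmetric] del: ennreal_plus)
    also have "\<dots> \<le> ennreal (real (fact (?N - card J) * (1 + Suc Q * (card J + Suc Q))))"
      using False finJ by (intro ennreal_leI of_nat_mono) (simp add: algebra_simps)
    finally show ?thesis by (simp add: X_def)
  qed
qed


lemma simon_fun_in_simon_pairs:
  assumes s: "s \<in> {1..<2 ^ n}" and h: "h \<in> perms n"
  shows "(simon_fun n s h, s) \<in> simon_pairs n"
proof -
  have h: "h \<in> {..<2 ^ n} \<rightarrow>\<^sub>E {..<2 ^ n}" "inj_on h {..<2 ^ n}"
    using h by (auto simp: injections_def)
  have rep: "coset_rep s x < 2 ^ n" if "x < 2 ^ n" for x using coset_rep_less that s by simp
  have "simon_fun n s h \<in> {..<2 ^ n} \<rightarrow>\<^sub>E {..<2 ^ n}"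
    using h(1) rep by (auto simp: simon_fun_def PiE_iff)
  moreover have "simon_fun n s h x = simon_fun n s h y \<longleftrightarrow> y = x \<or> y = xor x s"
    if "x < 2 ^ n" "y < 2 ^ n" for x y
    using that h(2) rep by (simp add: simon_fun_def inj_on_eq_iff coset_rep_eq_iff)
  ultimately show ?thesis using s by (simp add: simon_pairs_def)
qed

lemma finite_simon_pairs: "finite (simon_pairs n)"
  by (rule finite_subset[of _ "({..<2 ^ n} \<rightarrow>\<^sub>E {..<2 ^ n}) \<times> {1..<2 ^ n}"])
    (auto simp: simon_pairs_def finite_PiE)

text \<open>The values of h at the representatives are forced by g and the other half is free. All
  fibres thus have the same size, so a uniform (s, h) induces a uniform Simon pair.\<close>

lemma card_simon_fun_fibre:
  assumes "(g, s) \<in> simon_pairs n"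
  shows "card {p \<in> {1..<2 ^ n} \<times> perms n. (simon_fun n (fst p) (snd p), fst p) = (g, s)}
    = fact (2 ^ n - 2 ^ n div 2)"
proof -
  let ?N = "2 ^ n :: nat"
  let ?R = "coset_rep s ` {..<?N}"
  have s: "s \<in> {1..<?N}" and g: "g \<in> {..<?N} \<rightarrow>\<^sub>E {..<?N}"
    and gs: "\<And>x y. x < ?N \<Longrightarrow> y < ?N \<Longrightarrow> g x = g y \<longleftrightarrow> (y = x \<or> y = xor x s)"
    using assms by (auto simp: simon_pairs_def)
  have rep: "coset_rep s x < ?N" if "x < ?N" for x using coset_rep_less that s by simp
  have g_rep: "g (coset_rep s x) = g x" if "x < ?N" for x
  proof -
    have "coset_rep s x = x \<or> coset_rep s x = xor x s" by (auto simp: coset_rep_def min_def)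
    then show ?thesis using gs[OF that rep[OF that]] by auto
  qed
  have "{p \<in> {1..<?N} \<times> perms n. (simon_fun n (fst p) (snd p), fst p) = (g, s)}
    = {s} \<times> {h \<in> perms n. \<forall>y\<in>?R. h y = g y}"
  proof (intro equalityI subsetI)
    fix p assume p: "p \<in> {p \<in> {1..<?N} \<times> perms n. (simon_fun n (fst p) (snd p), fst p) = (g, s)}"
    have "snd p (coset_rep s x) = g (coset_rep s x)" if "x < ?N" for x
      using p that g_rep[OF that] by (auto simp: simon_fun_def)
    then show "p \<in> {s} \<times> {h \<in> perms n. \<forall>y\<in>?R. h y = g y}" using p by (cases p) auto
  next
    fix p assume p: "p \<in> {s} \<times> {h \<in> perms n. \<forall>y\<in>?R. h y = g y}"
    have "simon_fun n s (snd p) = g"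
    proof (rule extensionalityI[of _ "{..<?N}"])
      fix x assume "x \<in> {..<?N}"
      then show "simon_fun n s (snd p) x = g x" using p g_rep by (auto simp: simon_fun_def)
    qed (use g in \<open>auto simp: simon_fun_def PiE_iff\<close>)
    then show "p \<in> {p \<in> {1..<?N} \<times> perms n. (simon_fun n (fst p) (snd p), fst p) = (g, s)}"
      using p s by (cases p) auto
  qed
  moreover have "card {h \<in> perms n. \<forall>y\<in>?R. h y = g y} = fact (card {..<?N} - card ?R)"
  proof (rule card_injections_extending)
    show "inj_on g ?R"
    proof (rule inj_onI)
      fix x y assume xy: "x \<in> ?R" "y \<in> ?R" "g x = g y"
      then obtain a b where ab: "a < ?N" "b < ?N" "x = coset_rep s a" "y = coset_rep s b" by auto
      then have "g a = g b" using xy(3) g_rep by simp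
      then show "x = y" using gs[OF ab(1,2)] ab(3,4) by (simp add: coset_rep_eq_iff)
    qed
  qed (use rep g in \<open>auto simp: PiE_iff\<close>)
  moreover have "card ?R = ?N div 2" using card_coset_reps[OF s] by simp
  ultimately show ?thesis by (simp add: card_cartesian_product_singleton)
qed

text \<open>With no point asked all shifts are open; the count over (s, h) becomes one over Simon
  pairs after division by the common fibre size.\<close>

lemma query_alg_simon_bound:
  assumes "query_alg (2 ^ n) Q f"
  shows "(2 ^ n - 1) * (\<Sum>(g, s)\<in>simon_pairs n. pmf (f g) s) \<le> (1 + real Q * real Q) * card (simon_pairs n)"
proof -
  let ?N = "2 ^ n :: nat" and ?F = "fact (2 ^ n - 2 ^ n div 2) :: nat"
  let ?S = "{1..<?N} \<times> perms n" and ?\<Phi> = "\<lambda>p. (simon_fun n (fst p) (snd p), fst p)"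
  have fin: "finite (perms n)" by (simp add: finite_injections)
  have group: "(\<Sum>p\<in>?S. X (?\<Phi> p)) = real ?F * (\<Sum>p\<in>simon_pairs n. X p)" for X :: "_ \<Rightarrow> real"
  proof -
    have "(\<Sum>p\<in>?S. X (?\<Phi> p)) = (\<Sum>q\<in>simon_pairs n. \<Sum>p\<in>{p \<in> ?S. ?\<Phi> p = q}. X (?\<Phi> p))"
      by (rule sum.group[symmetric])
        (use fin finite_simon_pairs simon_fun_in_simon_pairs in auto)
    also have "\<dots> = (\<Sum>q\<in>simon_pairs n. real ?F * X q)"
    proof (rule sum.cong[OF refl])
      fix q assume q: "q \<in> simon_pairs n"
      have "(\<Sum>p\<in>{p \<in> ?S. ?\<Phi> p = q}. X (?\<Phi> p)) = (\<Sum>p\<in>{p \<in> ?S. ?\<Phi> p = q}. X q)"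
        by (rule sum.cong) auto
      then show "(\<Sum>p\<in>{p \<in> ?S. ?\<Phi> p = q}. X (?\<Phi> p)) = real ?F * X q"
        using card_simon_fun_fibre[of "fst q" "snd q" n] q by simp
    qed
    finally show ?thesis by (simp add: sum_distrib_left)
  qed
  have "card (perms n) = fact ?N"
    using card_injections_extending[of "{..<?N}" "{..<?N}" "{}"] by simp
  then have count: "(?N - 1) * fact ?N = real ?F * card (simon_pairs n)"
    using group[of "\<lambda>_. 1"] by (simp add: of_nat_diff card_cartesian_product)
  have "open_shifts n {} = {1..<?N}" by (auto simp: open_shifts_def)
  then have "(\<Sum>s\<in>{1..<?N}. \<Sum>h\<in>perms n. ennreal (pmf (f (simon_fun n s h)) s))
      \<le> ennreal (real (fact ?N * (1 + Q * Q)))"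
    using query_alg_simon_aux[OF assms, of "{}"] by simp
  then have "(\<Sum>s\<in>{1..<?N}. \<Sum>h\<in>perms n. pmf (f (simon_fun n s h)) s) \<le> real (fact ?N * (1 + Q * Q))"
    by (subst (asm) sum_ennreal, simp, subst (asm) sum_ennreal)
      (auto intro: sum_nonneg simp: ennreal_le_iff simp del: of_nat_mult of_nat_add of_nat_fact)
  then have le: "real ?F * (\<Sum>(g, s)\<in>simon_pairs n. pmf (f g) s) \<le> fact ?N * (1 + real Q * real Q)"
    using group[of "\<lambda>(g, s). pmf (f g) s"] by (simp add: sum.cartesian_product case_prod_unfold distrib_left)
  have "real ?F * ((2 ^ n - 1) * (\<Sum>(g, s)\<in>simon_pairs n. pmf (f g) s))
      \<le> (2 ^ n - 1) * (fact ?N * (1 + real Q * real Q))"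
    using mult_left_mono[OF le, of "2 ^ n - 1"] by (simp add: algebra_simps)
  also have "\<dots> = real ?F * ((1 + real Q * real Q) * card (simon_pairs n))"
    using count by (simp add: of_nat_diff algebra_simps)
  finally show ?thesis by (subst (asm) mult_le_cancel_left_pos) simp_all
qed

section \<open>Resampling one entry of a shuffle\<close>

text \<open>Level i is the tuple holding the inputs of the function with index i. The identity tuple
  is not stored, so level i sits at list position i - 1. The new value may destroy
  injectivity.\<close>

definition update_entry :: "(nat \<Rightarrow> nat) list \<Rightarrow> nat \<Rightarrow> nat \<Rightarrow> nat \<Rightarrow> (nat \<Rightarrow> nat) list" where
  "update_entry ts i j x = ts[i - 1 := (ts ! (i - 1))(j := x)]"

lemma length_update_entry [simp]: "length (update_entry ts i j x) = length ts"
  by (simp add: update_entry_def)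

lemma update_entry_same:
  "0 < i \<Longrightarrow> i \<le> length ts \<Longrightarrow> (update_entry ts i j x ! (i - 1)) = (ts ! (i - 1))(j := x)"
  by (simp add: update_entry_def)

lemma update_entry_other_index:
  "0 < i \<Longrightarrow> i \<le> length ts \<Longrightarrow> j' \<noteq> j \<Longrightarrow> (update_entry ts i j x ! m) j' = (ts ! m) j'"
  by (simp add: update_entry_def nth_list_update)

lemma update_entry_other_level:
  "m \<noteq> i - 1 \<Longrightarrow> update_entry ts i j x ! m = ts ! m"
  by (simp add: update_entry_def)

text \<open>The present value of entry j is itself free, which accounts for the summand 1 in their
  number.\<close>

definition free_values :: "nat \<Rightarrow> (nat \<Rightarrow> nat) list \<Rightarrow> nat \<Rightarrow> nat \<Rightarrow> nat set" where
  "free_values n ts i j = {..<2 ^ (2 * n)} - (ts ! (i - 1)) ` ({..<2 ^ n} - {j})"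

lemma finite_dist_tuples: "finite (dist_tuples n)"
  by (rule finite_subset[of _ "{..<2 ^ n} \<rightarrow>\<^sub>E {..<2 ^ (2 * n)}"]) (auto simp: dist_tuples_def finite_PiE)

lemma finite_shuffle_lists: "finite (shuffle_lists n d)"
proof -
  have "shuffle_lists n d = {ts. set ts \<subseteq> dist_tuples n \<and> length ts = d}"
    by (auto simp: shuffle_lists_def)
  then show ?thesis using finite_lists_length_eq[OF finite_dist_tuples] by simp
qed

lemma shuffle_listsD:
  assumes "ts \<in> shuffle_lists n d"
  shows "length ts = d"
    and "0 < i \<Longrightarrow> i \<le> d \<Longrightarrow> ts ! (i - 1) \<in> dist_tuples n"
    and "0 < i \<Longrightarrow> i \<le> d \<Longrightarrow> inj_on (ts ! (i - 1)) {..<2 ^ n}"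
    and "0 < i \<Longrightarrow> i \<le> d \<Longrightarrow> j < 2 ^ n \<Longrightarrow> (ts ! (i - 1)) j < 2 ^ (2 * n)"
proof -
  show len: "length ts = d" using assms by (simp add: shuffle_lists_def)
  show mem: "ts ! (i - 1) \<in> dist_tuples n" if "0 < i" "i \<le> d"
    using assms that len nth_mem[of "i - 1" ts] by (auto simp: shuffle_lists_def)
  show "inj_on (ts ! (i - 1)) {..<2 ^ n}" if "0 < i" "i \<le> d"
    using mem[OF that] by (simp add: dist_tuples_def)
  show "(ts ! (i - 1)) j < 2 ^ (2 * n)" if "0 < i" "i \<le> d" "j < 2 ^ n"
    using mem[OF that(1,2)] that(3) by (auto simp: dist_tuples_def)
qed

lemma card_free_values:
  assumes "ts \<in> shuffle_lists n d" "0 < i" "i \<le> d" "j < 2 ^ n"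
  shows "card (free_values n ts i j) = 2 ^ (2 * n) - 2 ^ n + 1"
proof -
  have inj: "inj_on (ts ! (i - 1)) ({..<2 ^ n} - {j})"
    using shuffle_listsD(3)[OF assms(1-3)] by (rule inj_on_subset) auto
  have "card (free_values n ts i j) = 2 ^ (2 * n) - card ((ts ! (i - 1)) ` ({..<2 ^ n} - {j}))"
    unfolding free_values_def using shuffle_listsD(4)[OF assms(1-3)]
    by (subst card_Diff_subset) auto
  also have "card ((ts ! (i - 1)) ` ({..<2 ^ n} - {j})) = 2 ^ n - 1"
    using assms(4) by (subst card_image[OF inj]) simp
  also have "(2 :: nat) ^ (2 * n) - (2 ^ n - 1) = 2 ^ (2 * n) - 2 ^ n + 1"
    using power_increasing[of n "2 * n" "2 :: nat"] by (simp add: Suc_diff_le)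
  finally show ?thesis .
qed

lemma update_entry_in_shuffle_lists:
  assumes "ts \<in> shuffle_lists n d" "0 < i" "i \<le> d" "j < 2 ^ n" "x \<in> free_values n ts i j"
  shows "update_entry ts i j x \<in> shuffle_lists n d"
proof -
  let ?t = "ts ! (i - 1)"
  have t: "?t \<in> {..<2 ^ n} \<rightarrow>\<^sub>E {..<2 ^ (2 * n)}" "inj_on ?t {..<2 ^ n}"
    using shuffle_listsD(2)[OF assms(1-3)] by (auto simp: dist_tuples_def)
  have "?t(j := x) \<in> {..<2 ^ n} \<rightarrow>\<^sub>E {..<2 ^ (2 * n)}"
    using t(1) assms(4,5) by (auto simp: PiE_iff free_values_def extensional_def)
  moreover have "inj_on (?t(j := x)) {..<2 ^ n}"
    using t(2) assms(5) unfolding inj_on_def free_values_def by (auto simp: image_iff)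
  ultimately have "?t(j := x) \<in> dist_tuples n" by (simp add: dist_tuples_def)
  then show ?thesis
    using assms(1) set_update_subset_insert[of ts "i - 1" "?t(j := x)"]
    by (auto simp: shuffle_lists_def update_entry_def)
qed

text \<open>Given all other entries, a single entry of a shuffle is uniform on its free values.\<close>

lemma sum_shuffle_lists_entry_le:
  fixes h :: "(nat \<Rightarrow> nat) list \<Rightarrow> real" and w :: "(nat \<Rightarrow> nat) list \<Rightarrow> nat \<Rightarrow> real"
  assumes i: "0 < i" "i \<le> d" and j: "j < 2 ^ n"
    and h: "\<And>ts x. length ts = d \<Longrightarrow> h (update_entry ts i j x) = h ts"
    and w: "\<And>ts x. length ts = d \<Longrightarrow> w (update_entry ts i j x) = w ts"
    and nonneg: "\<And>ts. 0 \<le> h ts" "\<And>ts x. 0 \<le> w ts x"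
    and le: "\<And>ts. ts \<in> shuffle_lists n d \<Longrightarrow> (\<Sum>x<2 ^ (2 * n). w ts x) \<le> k"
  shows "(2 ^ (2 * n) - 2 ^ n + 1) * (\<Sum>ts\<in>shuffle_lists n d. w ts ((ts ! (i - 1)) j) * h ts)
    \<le> k * (\<Sum>ts\<in>shuffle_lists n d. h ts)"
proof -
  let ?S = "shuffle_lists n d" and ?F = "\<lambda>ts. free_values n ts i j"
  let ?\<phi> = "\<lambda>ts. w ts ((ts ! (i - 1)) j) * h ts"
  \<comment> \<open>Exchanges the present entry with the proposed value x. Under this involution on
    pairs of a shuffle and a free value, w at the entry turns into w at x, while h and w themselves
    do not change.\<close>
  let ?u = "\<lambda>(ts, x). (update_entry ts i j x, (ts ! (i - 1)) j)"
  have len: "length ts = d" if "ts \<in> ?S" for ts using that by (rule shuffle_listsD(1))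
  have finF: "finite (?F ts)" for ts by (simp add: free_values_def)
  have upd: "(update_entry ts i j x ! (i - 1)) = (ts ! (i - 1))(j := x)" if "ts \<in> ?S" for ts x
    using update_entry_same i len[OF that] by blast
  have inv: "?u (?u p) = p" if "p \<in> Sigma ?S ?F" for p
    using that i len by (auto simp: upd update_entry_def)
  have maps: "?u p \<in> Sigma ?S ?F" if p: "p \<in> Sigma ?S ?F" for p
  proof -
    obtain ts x where p': "p = (ts, x)" "ts \<in> ?S" "x \<in> ?F ts" using p by auto
    have "((ts ! (i - 1))(j := x)) ` ({..<2 ^ n} - {j}) = (ts ! (i - 1)) ` ({..<2 ^ n} - {j})"
      by (intro image_cong) auto
    moreover have "(ts ! (i - 1)) j \<notin> (ts ! (i - 1)) ` ({..<2 ^ n} - {j})"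
      using shuffle_listsD(3)[OF p'(2) i] j by (auto simp: inj_on_def)
    ultimately have "(ts ! (i - 1)) j \<in> ?F (update_entry ts i j x)"
      using shuffle_listsD(4)[OF p'(2) i j] upd[OF p'(2)] by (simp add: free_values_def)
    then show ?thesis using update_entry_in_shuffle_lists[OF p'(2) i j p'(3)] p'(1) by simp
  qed
  have "(2 ^ (2 * n) - 2 ^ n + 1) * (\<Sum>ts\<in>?S. ?\<phi> ts) = (\<Sum>ts\<in>?S. \<Sum>x\<in>?F ts. ?\<phi> ts)"
    using card_free_values[OF _ i j] power_increasing[of n "2 * n" "2 :: real"]
    by (simp add: sum_distrib_left of_nat_diff add.commute)
  also have "\<dots> = (\<Sum>p\<in>Sigma ?S ?F. ?\<phi> (fst p))"
    using finite_shuffle_lists finF by (subst sum.Sigma) (auto simp: case_prod_unfold)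
  also have "\<dots> = (\<Sum>p\<in>Sigma ?S ?F. ?\<phi> (fst (?u p)))"
    by (rule sum.reindex_bij_witness[of _ ?u ?u]) (use inv maps in auto)
  also have "\<dots> = (\<Sum>p\<in>Sigma ?S ?F. w (fst p) (snd p) * h (fst p))"
    by (rule sum.cong) (auto simp: h w len upd simp del: One_nat_def)
  also have "\<dots> = (\<Sum>ts\<in>?S. h ts * (\<Sum>x\<in>?F ts. w ts x))"
    using finite_shuffle_lists finF
    by (simp add: sum_distrib_left, subst sum.Sigma) (auto simp: case_prod_unfold mult.commute)
  also have "\<dots> \<le> (\<Sum>ts\<in>?S. h ts * k)"
  proof (intro sum_mono mult_left_mono nonneg)
    fix ts assume ts: "ts \<in> ?S"
    have "(\<Sum>x\<in>?F ts. w ts x) \<le> (\<Sum>x<2 ^ (2 * n). w ts x)"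
      by (rule sum_mono2) (auto simp: free_values_def nonneg)
    also have "\<dots> \<le> k" by (rule le[OF ts])
    finally show "(\<Sum>x\<in>?F ts. w ts x) \<le> k" .
  qed
  also have "\<dots> = k * (\<Sum>ts\<in>?S. h ts)" by (simp add: sum_distrib_left mult.commute)
  finally show ?thesis .
qed

text \<open>The oracle shown to the query layer \<open>c\<close> of a quantum round: the functions with index above \<open>c\<close>
  are revealed only along the paths with index in \<open>J\<close>.\<close>

definition shadow_oracle :: "nat \<Rightarrow> nat \<Rightarrow> (nat \<Rightarrow> nat) \<Rightarrow> (nat \<Rightarrow> nat) list \<Rightarrow> nat \<Rightarrow> nat set \<Rightarrow> coracle" where
  "shadow_oracle n d g ts c J i x =
    (if i \<le> c \<or> d < i then shuffle_oracle n d g ts i x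
     else case x of None \<Rightarrow> None
       | Some v \<Rightarrow> if \<exists>j\<in>J. (ts ! (i - 1)) j = v
           then Some (shuffle_T d g ts (Suc i) (SOME j. j \<in> J \<and> (ts ! (i - 1)) j = v)) else None)"

lemma shuffle_T_pos: "0 < i \<Longrightarrow> i \<le> d \<Longrightarrow> shuffle_T d g ts i = ts ! (i - 1)"
  by (simp add: shuffle_T_def)

lemma shadow_oracle_differs:
  assumes ts: "ts \<in> shuffle_lists n d" and J: "J \<subseteq> {..<2 ^ n}"
    and neq: "shuffle_oracle n d g ts i x \<noteq> shadow_oracle n d g ts c J i x"
  shows "\<exists>v. x = Some v \<and> (i, v) \<in> (\<lambda>(i, j). (i, (ts ! (i - 1)) j)) ` ({c<..d} \<times> ({..<2 ^ n} - J))"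
proof -
  have i: "c < i" "i \<le> d" using neq by (auto simp: shadow_oracle_def split: if_splits)
  let ?t = "ts ! (i - 1)"
  have T: "shuffle_T d g ts i = ?t" using i by (intro shuffle_T_pos) auto
  have inj: "inj_on ?t {..<2 ^ n}" using shuffle_listsD(3)[OF ts, of i] i by simp
  obtain v where v: "x = Some v"
    using neq i by (cases x) (auto simp: shadow_oracle_def shuffle_oracle_def shuffle_f_def)
  \<comment> \<open>If no hidden entry equals v, both oracles look v up among the same entries, and
    injectivity makes \<open>THE\<close> and \<open>SOME\<close> agree.\<close>
  have "\<exists>j\<in>{..<2 ^ n} - J. ?t j = v"
  proof (rule ccontr)
    assume no: "\<not> (\<exists>j\<in>{..<2 ^ n} - J. ?t j = v)"
    then have ex: "(\<exists>j<2 ^ n. ?t j = v) \<longleftrightarrow> (\<exists>j\<in>J. ?t j = v)" using J by auto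
    have "(j < 2 ^ n \<and> ?t j = v) \<longleftrightarrow> (j \<in> J \<and> ?t j = v)" for j using no J by auto
    moreover have "(THE j. j < 2 ^ n \<and> ?t j = v) = (SOME j. j \<in> J \<and> ?t j = v)" if "\<exists>j\<in>J. ?t j = v"
    proof (rule the_equality)
      have "(SOME j. j \<in> J \<and> ?t j = v) \<in> J \<and> ?t (SOME j. j \<in> J \<and> ?t j = v) = v"
        using that by (intro someI_ex[of "\<lambda>j. j \<in> J \<and> ?t j = v"]) blast
      then show some: "(SOME j. j \<in> J \<and> ?t j = v) < 2 ^ n \<and> ?t (SOME j. j \<in> J \<and> ?t j = v) = v"
        using J by auto
      show "j = (SOME j. j \<in> J \<and> ?t j = v)" if "j < 2 ^ n \<and> ?t j = v" for j
        using some that inj by (auto simp: inj_on_def)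
    qed
    ultimately have "shuffle_oracle n d g ts i x = shadow_oracle n d g ts c J i x"
      using i ex by (simp add: shadow_oracle_def shuffle_oracle_def shuffle_f_def v T)
    then show False using neq by simp
  qed
  then show ?thesis using v i by force
qed

text \<open>Layer c sees the functions up to index c in full, and the values of function c are the
  entries of level c + 1. Only levels strictly above c + 1 are invisible outside J; one level is
  what each query layer uncovers.\<close>

lemma shadow_oracle_update_entry:
  assumes "length ts = d" "Suc c < i" "i \<le> d" "j \<notin> J"
  shows "shadow_oracle n d g (update_entry ts i j x) c J = shadow_oracle n d g ts c J"
proof (intro ext)
  fix a b
  let ?us = "update_entry ts i j x"
  have low: "shuffle_T d g ?us m = shuffle_T d g ts m" if "m \<le> Suc c" for m
    using that assms by (auto simp: shuffle_T_def update_entry_other_level)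
  have same: "(?us ! m) j' = (ts ! m) j'" if "j' \<in> J" for j' m
    using that assms by (intro update_entry_other_index) auto
  show "shadow_oracle n d g ?us c J a b = shadow_oracle n d g ts c J a b"
  proof (cases "a \<le> c \<or> d < a")
    case True
    show ?thesis
    proof (cases "d < a")
      case True
      then show ?thesis by (simp add: shadow_oracle_def shuffle_oracle_def)
    next
      case False
      then have "a \<le> c" using True by simp
      then show ?thesis
        using low[of a] low[of "Suc a"] by (auto simp: shadow_oracle_def shuffle_oracle_def shuffle_f_def split: option.split)
    qed
  next
    case False
    show ?thesis
    proof (cases b)
      case None
      then show ?thesis using False by (simp add: shadow_oracle_def)
    next
      case (Some v)
      have eq: "(j' \<in> J \<and> (?us ! (a - 1)) j' = v) \<longleftrightarrow> (j' \<in> J \<and> (ts ! (a - 1)) j' = v)" for j'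
        using same by auto
      have T: "shuffle_T d g ?us (Suc a) j' = shuffle_T d g ts (Suc a) j'" if "j' \<in> J" for j'
        using same[OF that] by (simp add: shuffle_T_def)
      show ?thesis
      proof (cases "\<exists>j'\<in>J. (ts ! (a - 1)) j' = v")
        case ex: True
        \<comment> \<open>\<open>SOME\<close> returns an index of J even when the tuple is not
          injective, as may happen after an arbitrary update.\<close>
        define j0 where "j0 = (SOME j'. j' \<in> J \<and> (ts ! (a - 1)) j' = v)"
        have "j0 \<in> J"
          unfolding j0_def using ex someI_ex[of "\<lambda>j'. j' \<in> J \<and> (ts ! (a - 1)) j' = v"] by blast
        moreover have "\<exists>j'\<in>J. (?us ! (a - 1)) j' = v" using ex eq by blast
        moreover have "(SOME j'. j' \<in> J \<and> (?us ! (a - 1)) j' = v) = j0" unfolding j0_def eq ..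
        ultimately show ?thesis
          using False ex Some T[of j0] by (simp add: shadow_oracle_def j0_def[symmetric] del: One_nat_def)
      next
        case ex: False
        then have "\<not> (\<exists>j'\<in>J. (?us ! (a - 1)) j' = v)" using eq by blast
        then show ?thesis using False ex Some by (simp add: shadow_oracle_def)
      qed
    qed
  qed
qed


section \<open>Moment bound for the query weight on hidden paths\<close>

definition index_weight :: "nat \<Rightarrow> nat \<Rightarrow> qslot list \<Rightarrow> qstate \<Rightarrow> (nat \<Rightarrow> nat) list \<Rightarrow> nat \<Rightarrow> nat \<Rightarrow> real" where
  "index_weight d q Ss \<phi> ts c j = (\<Sum>i\<in>{c<..d}. query_weight q Ss \<phi> i ((ts ! (i - 1)) j))"

definition hidden_weight :: "nat \<Rightarrow> nat \<Rightarrow> nat \<Rightarrow> qslot list \<Rightarrow> qstate \<Rightarrow> (nat \<Rightarrow> nat) list \<Rightarrow> nat \<Rightarrow> nat set \<Rightarrow> real" where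
  "hidden_weight n d q Ss \<phi> ts c J = (\<Sum>j\<in>{..<2 ^ n} - J. index_weight d q Ss \<phi> ts c j)"

lemma index_weight_nonneg: "0 \<le> index_weight d q Ss \<phi> ts c j"
  unfolding index_weight_def by (intro sum_nonneg query_weight_nonneg)

lemma hidden_weight_antimono:
  "J \<subseteq> J' \<Longrightarrow> hidden_weight n d q Ss \<phi> ts c J' \<le> hidden_weight n d q Ss \<phi> ts c J"
  unfolding hidden_weight_def by (intro sum_mono2) (auto intro: index_weight_nonneg)

lemma sqnorm_shadow_oracle_diff_le:
  assumes "wf_qlayer n q k Ss" "ts \<in> shuffle_lists n d" "J \<subseteq> {..<2 ^ n}"
  shows "sqnorm q (\<lambda>b. apply_oracle n (shuffle_oracle n d g ts) Ss \<phi> b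
      - apply_oracle n (shadow_oracle n d g ts c J) Ss \<phi> b)
    \<le> 4 * hidden_weight n d q Ss \<phi> ts c J"
proof -
  let ?I = "{c<..d} \<times> ({..<2 ^ n} - J)" and ?p = "\<lambda>(i, j). (i, (ts ! (i - 1)) j)"
  have "(\<Sum>b\<in>differing q (shuffle_oracle n d g ts) (shadow_oracle n d g ts c J) Ss. (cmod (\<phi> b))\<^sup>2)
    \<le> (\<Sum>(i, v)\<in>?p ` ?I. query_weight q Ss \<phi> i v)"
    by (rule sum_differing_le) (use shadow_oracle_differs[OF assms(2,3)] in auto)
  also have "\<dots> \<le> (\<Sum>p\<in>?I. (\<lambda>(i, v). query_weight q Ss \<phi> i v) (?p p))"
    by (intro order_trans[OF sum_image_le]) (auto intro: query_weight_nonneg)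
  also have "\<dots> = hidden_weight n d q Ss \<phi> ts c J"
    unfolding hidden_weight_def index_weight_def
    by (subst sum.swap, subst sum.cartesian_product) (simp add: case_prod_unfold)
  finally show ?thesis
    using sqnorm_apply_oracle_diff_le[OF assms(1), of "shuffle_oracle n d g ts" \<phi>
        "shadow_oracle n d g ts c J"] by linarith
qed

text \<open>This is r! times the r-th elementary symmetric polynomial in the weights of the indices
  outside J. Unlike in a power of the hidden weight, indices are drawn without repetition, so that
  each factor can be averaged over an entry which the remaining factors do not read.\<close>

primrec hit_moment :: "nat \<Rightarrow> nat \<Rightarrow> nat \<Rightarrow> qslot list \<Rightarrow> qstate \<Rightarrow> (nat \<Rightarrow> nat) list \<Rightarrow> nat \<Rightarrow> nat \<Rightarrow> nat set \<Rightarrow> real" where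
  "hit_moment n d q Ss \<phi> ts c 0 J = 1"
| "hit_moment n d q Ss \<phi> ts c (Suc r) J =
     (\<Sum>j\<in>{..<2 ^ n} - J. index_weight d q Ss \<phi> ts c j * hit_moment n d q Ss \<phi> ts c r (insert j J))"

lemma hit_moment_nonneg: "0 \<le> hit_moment n d q Ss \<phi> ts c r J"
  by (induction r arbitrary: J) (auto intro!: sum_nonneg mult_nonneg_nonneg index_weight_nonneg)

abbreviation index_lists :: "nat \<Rightarrow> nat \<Rightarrow> nat list set" where
  "index_lists n r \<equiv> {xs. set xs \<subseteq> {..<2 ^ n} \<and> length xs = r}"

text \<open>Covers are lists of exact length r with repetitions allowed, because a later union bound
  counts them as (2^n)^r.\<close>

definition uncoverable :: "nat \<Rightarrow> nat \<Rightarrow> nat \<Rightarrow> qslot list \<Rightarrow> qstate \<Rightarrow> (nat \<Rightarrow> nat) list \<Rightarrow> nat \<Rightarrow> nat \<Rightarrow> nat set \<Rightarrow> real \<Rightarrow> bool" where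
  "uncoverable n d q Ss \<phi> ts c r J \<epsilon> \<longleftrightarrow>
     (\<forall>xs\<in>index_lists n r. \<epsilon> \<le> hidden_weight n d q Ss \<phi> ts c (J \<union> set xs))"

text \<open>Whichever indices have been drawn, weight at least \<epsilon> is left outside, so each
  of the r nested sums contributes a factor \<epsilon>.\<close>

lemma uncoverable_hit_moment:
  assumes "uncoverable n d q Ss \<phi> ts c r J \<epsilon>" "0 \<le> \<epsilon>"
  shows "\<epsilon> ^ r \<le> hit_moment n d q Ss \<phi> ts c r J"
  using assms(1)
proof (induction r arbitrary: J)
  case (Suc r)
  \<comment> \<open>Pads a list to the required length with the index 0, which is always legal. A
    larger cover only lowers the hidden weight, so the lower bound passes to J itself.\<close>
  have "replicate (Suc r) 0 \<in> index_lists n (Suc r)" by auto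
  then have "\<epsilon> \<le> hidden_weight n d q Ss \<phi> ts c (J \<union> set (replicate (Suc r) 0))"
    using Suc.prems unfolding uncoverable_def by blast
  also have "\<dots> \<le> hidden_weight n d q Ss \<phi> ts c J" by (rule hidden_weight_antimono) auto
  finally have \<epsilon>: "\<epsilon> \<le> hidden_weight n d q Ss \<phi> ts c J" .
  have step: "\<epsilon> ^ r \<le> hit_moment n d q Ss \<phi> ts c r (insert j J)" if "j < 2 ^ n" for j
  proof (rule Suc.IH)
    show "uncoverable n d q Ss \<phi> ts c r (insert j J) \<epsilon>"
      unfolding uncoverable_def
    proof
      fix xs assume "xs \<in> index_lists n r"
      then have "j # xs \<in> index_lists n (Suc r)" using that by simp
      then have "\<epsilon> \<le> hidden_weight n d q Ss \<phi> ts c (J \<union> set (j # xs))"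
        using Suc.prems unfolding uncoverable_def by blast
      then show "\<epsilon> \<le> hidden_weight n d q Ss \<phi> ts c (insert j J \<union> set xs)" by simp
    qed
  qed
  have "\<epsilon> ^ Suc r \<le> hidden_weight n d q Ss \<phi> ts c J * \<epsilon> ^ r"
    using \<epsilon> assms(2) by (simp add: mult_right_mono)
  also have "\<dots> \<le> hit_moment n d q Ss \<phi> ts c (Suc r) J"
    unfolding hidden_weight_def sum_distrib_right hit_moment.simps
    by (intro sum_mono mult_left_mono step index_weight_nonneg) auto
  finally show ?case .
qed simp

text \<open>Dependence on the levels above c only along the paths of J, expressed as invariance
  under changing a single other entry to any value. This is the form that resampling
  consumes.\<close>

definition ignores_entries :: "nat \<Rightarrow> nat \<Rightarrow> nat set \<Rightarrow> ((nat \<Rightarrow> nat) list \<Rightarrow> 'a) \<Rightarrow> bool" where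
  "ignores_entries d c J \<Phi> \<longleftrightarrow>
     (\<forall>ts i j x. length ts = d \<longrightarrow> c < i \<longrightarrow> i \<le> d \<longrightarrow> j \<notin> J \<longrightarrow> \<Phi> (update_entry ts i j x) = \<Phi> ts)"

text \<open>J0 is what the state has seen, J contains the indices already drawn. A path in J but not
  in J0 is read neither by the state nor by the remaining factors, whose indices avoid J.\<close>

lemma hit_moment_update_entry:
  assumes "ignores_entries d c J0 \<Phi>" "length ts = d" "c < i" "i \<le> d" "j \<notin> J0" "j \<in> J"
  shows "hit_moment n d q Ss (\<Phi> (update_entry ts i j x)) (update_entry ts i j x) c r J
    = hit_moment n d q Ss (\<Phi> ts) ts c r J"
  using assms(6)
proof (induction r arbitrary: J)
  case (Suc r)
  have "\<Phi> (update_entry ts i j x) = \<Phi> ts" using assms by (auto simp: ignores_entries_def)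
  then have "index_weight d q Ss (\<Phi> (update_entry ts i j x)) (update_entry ts i j x) c j'
      = index_weight d q Ss (\<Phi> ts) ts c j'" if "j' \<noteq> j" for j'
    using that assms by (simp add: index_weight_def update_entry_other_index)
  note weight = this
  show ?case
    unfolding hit_moment.simps
  proof (rule sum.cong[OF refl])
    fix j' assume "j' \<in> {..<2 ^ n} - J"
    then have "j' \<noteq> j" using Suc.prems by auto
    then show "index_weight d q Ss (\<Phi> (update_entry ts i j x)) (update_entry ts i j x) c j' *
        hit_moment n d q Ss (\<Phi> (update_entry ts i j x)) (update_entry ts i j x) c r (insert j' J)
      = index_weight d q Ss (\<Phi> ts) ts c j' * hit_moment n d q Ss (\<Phi> ts) ts c r (insert j' J)"
      using weight Suc.IH[of "insert j' J"] Suc.prems by simp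
  qed
qed simp

text \<open>Bound for the mean hidden weight of a layer: 2^n paths, d levels, total query weight k
  per level, and probability at most 1 / (2^(2*n) - 2^n + 1) that an entry takes a given
  value.\<close>

definition hit_rate :: "nat \<Rightarrow> nat \<Rightarrow> nat \<Rightarrow> real" where
  "hit_rate n d k = 2 ^ n * real d * real k / (2 ^ (2 * n) - 2 ^ n + 1)"

lemma entry_count_pos: "(0 :: real) < 2 ^ (2 * n) - 2 ^ n + 1"
proof -
  have "(2 :: real) ^ n \<le> 2 ^ (2 * n)" by (rule power_increasing) auto
  then show ?thesis by linarith
qed

lemma hit_rate_nonneg: "0 \<le> hit_rate n d k"
  unfolding hit_rate_def using entry_count_pos[of n] by simp

text \<open>Peel off one index j and one level i. Given all that the query weights and the remaining
  moment read, this entry is uniform on its free values, and the query weights on the level sum to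
  at most k. Each drawn index thus yields one factor \<open>hit_rate n d k\<close>.\<close>

lemma sum_hit_moment_le:
  assumes \<Phi>: "ignores_entries d c J0 \<Phi>" and norm: "\<And>ts. ts \<in> shuffle_lists n d \<Longrightarrow> sqnorm q (\<Phi> ts) = 1"
    and Ss: "length Ss \<le> k" and "J0 \<subseteq> J"
  shows "(\<Sum>ts\<in>shuffle_lists n d. hit_moment n d q Ss (\<Phi> ts) ts c r J)
    \<le> hit_rate n d k ^ r * card (shuffle_lists n d)"
  using assms(4)
proof (induction r arbitrary: J)
  case (Suc r)
  let ?S = "shuffle_lists n d"
  let ?K = "2 ^ (2 * n) - 2 ^ n + 1 :: real"
  let ?M = "hit_rate n d k ^ r * card ?S"
  note K = entry_count_pos[of n]
  have M: "0 \<le> ?M" using hit_rate_nonneg by simp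
  have one: "(\<Sum>ts\<in>?S. query_weight q Ss (\<Phi> ts) i ((ts ! (i - 1)) j)
        * hit_moment n d q Ss (\<Phi> ts) ts c r (insert j J)) \<le> k / ?K * ?M"
    if ij: "j \<in> {..<2 ^ n} - J" "i \<in> {c<..d}" for i j
  proof -
    have j: "j \<notin> J0" using ij Suc.prems by auto
    have "?K * (\<Sum>ts\<in>?S. query_weight q Ss (\<Phi> ts) i ((ts ! (i - 1)) j)
        * hit_moment n d q Ss (\<Phi> ts) ts c r (insert j J))
      \<le> k * (\<Sum>ts\<in>?S. hit_moment n d q Ss (\<Phi> ts) ts c r (insert j J))"
    proof (rule sum_shuffle_lists_entry_le)
      fix ts :: "(nat \<Rightarrow> nat) list" and x assume "length ts = d"
      then show "hit_moment n d q Ss (\<Phi> (update_entry ts i j x)) (update_entry ts i j x) c r (insert j J)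
          = hit_moment n d q Ss (\<Phi> ts) ts c r (insert j J)"
        using hit_moment_update_entry[OF \<Phi>] ij j by simp
      show "query_weight q Ss (\<Phi> (update_entry ts i j x)) i = query_weight q Ss (\<Phi> ts) i"
        using \<Phi> \<open>length ts = d\<close> ij j by (simp add: ignores_entries_def)
    next
      fix ts assume ts: "ts \<in> ?S"
      have "(\<Sum>x<2 ^ (2 * n). query_weight q Ss (\<Phi> ts) i x) \<le> length Ss * sqnorm q (\<Phi> ts)"
        by (rule sum_query_weight_le) simp
      also have "\<dots> \<le> k" using norm[OF ts] Ss by simp
      finally show "(\<Sum>x<2 ^ (2 * n). query_weight q Ss (\<Phi> ts) i x) \<le> k" .
    qed (use ij in \<open>auto intro: hit_moment_nonneg query_weight_nonneg\<close>)
    also have "\<dots> \<le> k * ?M"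
      by (intro mult_left_mono Suc.IH) (use Suc.prems in auto)
    finally show ?thesis using K by (simp add: field_simps)
  qed
  have "(\<Sum>ts\<in>?S. hit_moment n d q Ss (\<Phi> ts) ts c (Suc r) J)
    = (\<Sum>j\<in>{..<2 ^ n} - J. \<Sum>i\<in>{c<..d}. \<Sum>ts\<in>?S. query_weight q Ss (\<Phi> ts) i ((ts ! (i - 1)) j)
        * hit_moment n d q Ss (\<Phi> ts) ts c r (insert j J))"
    unfolding hit_moment.simps index_weight_def sum_distrib_right
    by (subst sum.swap, rule sum.cong[OF refl], rule sum.swap)
  also have "\<dots> \<le> (\<Sum>j\<in>{..<2 ^ n} - J. \<Sum>i\<in>{c<..d}. k / ?K * ?M)"
    by (intro sum_mono one)
  also have "\<dots> = real (card ({..<2 ^ n} - J)) * (real (d - c) * (k / ?K * ?M))"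
    by simp
  also have "\<dots> \<le> 2 ^ n * (real d * (k / ?K * ?M))"
  proof (intro mult_mono)
    show "real (card ({..<2 ^ n} - J)) \<le> 2 ^ n"
      using card_mono[of "{..<2 ^ n :: nat}" "{..<2 ^ n} - J"] by (simp add: of_nat_le_iff[symmetric] del: of_nat_le_iff)
  qed (use K M hit_rate_nonneg in auto)
  also have "\<dots> = hit_rate n d k ^ Suc r * card ?S" by (simp add: hit_rate_def)
  finally show ?case .
qed simp

text \<open>Markov's inequality for the r-th moment. The exponent r can be chosen as large as the
  union bounds to come demand.\<close>

lemma card_uncoverable_le:
  assumes "ignores_entries d c J \<Phi>" "\<And>ts. ts \<in> shuffle_lists n d \<Longrightarrow> sqnorm q (\<Phi> ts) = 1"
    and "length Ss \<le> k" "0 < \<epsilon>"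
  shows "real (card {ts \<in> shuffle_lists n d. uncoverable n d q Ss (\<Phi> ts) ts c r J \<epsilon>})
    \<le> (hit_rate n d k / \<epsilon>) ^ r * card (shuffle_lists n d)"
proof -
  let ?S = "shuffle_lists n d"
  let ?U = "{ts \<in> ?S. uncoverable n d q Ss (\<Phi> ts) ts c r J \<epsilon>}"
  have "real (card ?U) * \<epsilon> ^ r = (\<Sum>ts\<in>?U. \<epsilon> ^ r)" by simp
  also have "\<dots> \<le> (\<Sum>ts\<in>?U. hit_moment n d q Ss (\<Phi> ts) ts c r J)"
    by (intro sum_mono uncoverable_hit_moment) (use assms(4) in auto)
  also have "\<dots> \<le> (\<Sum>ts\<in>?S. hit_moment n d q Ss (\<Phi> ts) ts c r J)"
    by (intro sum_mono2) (auto intro: hit_moment_nonneg finite_shuffle_lists)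
  also have "\<dots> \<le> hit_rate n d k ^ r * card ?S"
    by (rule sum_hit_moment_le[OF assms(1-3)]) auto
  finally show ?thesis using assms(4) by (simp add: field_simps power_divide)
qed

section \<open>Shadow runs of a quantum round\<close>

text \<open>The default in the uncoverable case keeps length and range, so that the chosen list
  always lies in the finite set over which the union bound runs.\<close>

definition choose_indices :: "nat \<Rightarrow> nat \<Rightarrow> nat \<Rightarrow> qslot list \<Rightarrow> qstate \<Rightarrow> (nat \<Rightarrow> nat) list \<Rightarrow> nat \<Rightarrow> nat \<Rightarrow> nat set \<Rightarrow> real \<Rightarrow> nat list" where
  "choose_indices n d q Ss \<phi> ts c r J \<epsilon> =
    (if uncoverable n d q Ss \<phi> ts c r J \<epsilon> then replicate r 0
     else SOME xs. xs \<in> index_lists n r \<and> hidden_weight n d q Ss \<phi> ts c (J \<union> set xs) < \<epsilon>)"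

lemma choose_indices_spec:
  assumes "\<not> uncoverable n d q Ss \<phi> ts c r J \<epsilon>"
  shows "choose_indices n d q Ss \<phi> ts c r J \<epsilon> \<in> index_lists n r \<and>
    hidden_weight n d q Ss \<phi> ts c (J \<union> set (choose_indices n d q Ss \<phi> ts c r J \<epsilon>)) < \<epsilon>"
proof -
  have "\<exists>xs. xs \<in> index_lists n r \<and> hidden_weight n d q Ss \<phi> ts c (J \<union> set xs) < \<epsilon>"
    using assms unfolding uncoverable_def by (meson not_le)
  from someI_ex[OF this] show ?thesis using assms by (simp add: choose_indices_def)
qed

lemma choose_indices_in: "choose_indices n d q Ss \<phi> ts c r J \<epsilon> \<in> index_lists n r"
proof (cases "uncoverable n d q Ss \<phi> ts c r J \<epsilon>")
  case True
  then show ?thesis by (auto simp: choose_indices_def)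
next
  case False
  then show ?thesis using choose_indices_spec by blast
qed

text \<open>The set J only grows. New indices are picked with full knowledge of the tuples and of
  the current state, whereas g enters only through the oracle calls.\<close>

primrec shadow_run :: "nat \<Rightarrow> nat \<Rightarrow> nat \<Rightarrow> (nat \<Rightarrow> nat) \<Rightarrow> (nat \<Rightarrow> nat) list \<Rightarrow> real \<Rightarrow> (nat \<Rightarrow> nat)
    \<Rightarrow> (gate list \<times> qslot list) list \<Rightarrow> nat \<Rightarrow> nat set \<Rightarrow> qstate \<Rightarrow> qstate" where
  "shadow_run n d q g ts \<epsilon> R [] c J \<phi> = \<phi>"
| "shadow_run n d q g ts \<epsilon> R (LS # r) c J \<phi> =
    (let \<phi>' = apply_layer (fst LS) \<phi>; J' = J \<union> set (choose_indices n d q (snd LS) \<phi>' ts c (R c) J \<epsilon>)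
     in shadow_run n d q g ts \<epsilon> R r (Suc c) J' (apply_oracle n (shadow_oracle n d g ts c J') (snd LS) \<phi>'))"

primrec shadow_fails :: "nat \<Rightarrow> nat \<Rightarrow> nat \<Rightarrow> (nat \<Rightarrow> nat) \<Rightarrow> (nat \<Rightarrow> nat) list \<Rightarrow> real \<Rightarrow> (nat \<Rightarrow> nat)
    \<Rightarrow> (gate list \<times> qslot list) list \<Rightarrow> nat \<Rightarrow> nat set \<Rightarrow> qstate \<Rightarrow> bool" where
  "shadow_fails n d q g ts \<epsilon> R [] c J \<phi> = False"
| "shadow_fails n d q g ts \<epsilon> R (LS # r) c J \<phi> =
    (let \<phi>' = apply_layer (fst LS) \<phi>; J' = J \<union> set (choose_indices n d q (snd LS) \<phi>' ts c (R c) J \<epsilon>)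
     in uncoverable n d q (snd LS) \<phi>' ts c (R c) J \<epsilon> \<or>
        shadow_fails n d q g ts \<epsilon> R r (Suc c) J' (apply_oracle n (shadow_oracle n d g ts c J') (snd LS) \<phi>'))"

definition wf_rounds :: "nat \<Rightarrow> nat \<Rightarrow> nat \<Rightarrow> (gate list \<times> qslot list) list \<Rightarrow> bool" where
  "wf_rounds n q k rs = (\<forall>LS\<in>set rs. wf_layer q (fst LS) \<and> wf_qlayer n q k (snd LS))"

abbreviation query_run :: "nat \<Rightarrow> coracle \<Rightarrow> (gate list \<times> qslot list) list \<Rightarrow> qstate \<Rightarrow> qstate" where
  "query_run n F rs \<equiv> fold (\<lambda>(L, Ss) \<psi>. apply_oracle n F Ss (apply_layer L \<psi>)) rs"

lemma sqnorm_query_run: "wf_rounds n q k rs \<Longrightarrow> sqnorm q (query_run n F rs \<phi>) = sqnorm q \<phi>"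
  by (induction rs arbitrary: \<phi>)
    (auto simp: wf_rounds_def sqnorm_apply_layer sqnorm_apply_oracle case_prod_unfold)

lemma sqnorm_shadow_run:
  "wf_rounds n q k rs \<Longrightarrow> sqnorm q (shadow_run n d q g ts \<epsilon> R rs c J \<phi>) = sqnorm q \<phi>"
  by (induction rs arbitrary: \<phi> c J)
    (auto simp: wf_rounds_def sqnorm_apply_layer sqnorm_apply_oracle Let_def)

text \<open>Hybrid argument: layers and the true oracle are isometries, so an earlier deviation is
  carried along unchanged, and replacing the oracle of one layer adds at most 2 sqrt
  \<epsilon>.\<close>

lemma l2norm_query_run_shadow_run_le:
  assumes "wf_rounds n q k rs" "ts \<in> shuffle_lists n d" "J \<subseteq> {..<2 ^ n}"
    and "\<not> shadow_fails n d q g ts \<epsilon> R rs c J \<psi>"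
  shows "l2norm q (\<lambda>b. query_run n (shuffle_oracle n d g ts) rs \<phi> b - shadow_run n d q g ts \<epsilon> R rs c J \<psi> b)
    \<le> l2norm q (\<lambda>b. \<phi> b - \<psi> b) + length rs * (2 * sqrt \<epsilon>)"
  using assms(1,3,4)
proof (induction rs arbitrary: c J \<phi> \<psi>)
  case (Cons LS rs)
  obtain L Ss where LS: "LS = (L, Ss)" by (cases LS)
  let ?F = "shuffle_oracle n d g ts"
  let ?\<psi> = "apply_layer L \<psi>" and ?\<phi> = "apply_layer L \<phi>"
  let ?xs = "choose_indices n d q Ss ?\<psi> ts c (R c) J \<epsilon>"
  let ?J = "J \<union> set ?xs"
  let ?G = "shadow_oracle n d g ts c ?J"
  have wf: "wf_layer q L" "wf_qlayer n q k Ss" "wf_rounds n q k rs"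
    using Cons.prems(1) by (auto simp: LS wf_rounds_def)
  have nf: "\<not> uncoverable n d q Ss ?\<psi> ts c (R c) J \<epsilon>"
    "\<not> shadow_fails n d q g ts \<epsilon> R rs (Suc c) ?J (apply_oracle n ?G Ss ?\<psi>)"
    using Cons.prems(3) by (auto simp: LS Let_def)
  have J: "?J \<subseteq> {..<2 ^ n}" using Cons.prems(2) choose_indices_in[of n d q Ss ?\<psi> ts c "R c" J \<epsilon>] by auto
  have "l2norm q (\<lambda>b. apply_oracle n ?F Ss ?\<psi> b - apply_oracle n ?G Ss ?\<psi> b)
      \<le> sqrt (4 * hidden_weight n d q Ss ?\<psi> ts c ?J)"
    unfolding l2norm_sqrt
    by (intro real_sqrt_le_mono sqnorm_shadow_oracle_diff_le[OF wf(2) assms(2) J])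
  also have "\<dots> \<le> sqrt (4 * \<epsilon>)"
    using choose_indices_spec[OF nf(1)] by (intro real_sqrt_le_mono) simp
  also have "\<dots> = 2 * sqrt \<epsilon>" by (simp add: real_sqrt_mult)
  finally have step: "l2norm q (\<lambda>b. apply_oracle n ?F Ss ?\<psi> b - apply_oracle n ?G Ss ?\<psi> b) \<le> 2 * sqrt \<epsilon>" .
  have "l2norm q (\<lambda>b. apply_oracle n ?F Ss ?\<phi> b - apply_oracle n ?F Ss ?\<psi> b) = l2norm q (\<lambda>b. \<phi> b - \<psi> b)"
    unfolding l2norm_sqrt apply_oracle_diff[symmetric] apply_layer_diff[symmetric]
      sqnorm_apply_oracle[OF wf(2)] sqnorm_apply_layer[OF wf(1)] ..
  then have "l2norm q (\<lambda>b. apply_oracle n ?F Ss ?\<phi> b - apply_oracle n ?G Ss ?\<psi> b)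
      \<le> l2norm q (\<lambda>b. \<phi> b - \<psi> b) + 2 * sqrt \<epsilon>"
    using l2norm_triangle[of q "apply_oracle n ?F Ss ?\<phi>" "apply_oracle n ?G Ss ?\<psi>" "apply_oracle n ?F Ss ?\<psi>"] step
    by linarith
  with Cons.IH[OF wf(3) J nf(2), of "apply_oracle n ?F Ss ?\<phi>"] show ?case
    by (simp add: LS Let_def algebra_simps)
qed simp

text \<open>Only the function with index d contains g. As c < d, this function lies above c and is
  revealed only along J. Here it counts that there are d query layers against d + 1
  functions.\<close>

lemma shadow_oracle_restrict:
  assumes "c < d"
  shows "shadow_oracle n d (restrict g J) ts c J = shadow_oracle n d g ts c J"
proof (intro ext)
  fix i x
  show "shadow_oracle n d (restrict g J) ts c J i x = shadow_oracle n d g ts c J i x"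
  proof (cases "i \<le> c \<or> d < i")
    case True
    have "shuffle_T d (restrict g J) ts m = shuffle_T d g ts m" if "m \<le> d" for m
      using that by (simp add: shuffle_T_def)
    then show ?thesis
      using True assms by (cases x) (auto simp: shadow_oracle_def shuffle_oracle_def shuffle_f_def)
  next
    case False
    show ?thesis
    proof (cases "\<exists>v. x = Some v \<and> (\<exists>j\<in>J. (ts ! (i - 1)) j = v)")
      case True
      then obtain v where v: "x = Some v" "\<exists>j\<in>J. (ts ! (i - 1)) j = v" by blast
      define j0 where "j0 = (SOME j. j \<in> J \<and> (ts ! (i - 1)) j = v)"
      have "j0 \<in> J"
        unfolding j0_def using v(2) someI_ex[of "\<lambda>j. j \<in> J \<and> (ts ! (i - 1)) j = v"] by blast
      then have "shuffle_T d (restrict g J) ts (Suc i) j0 = shuffle_T d g ts (Suc i) j0"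
        by (simp add: shuffle_T_def)
      then show ?thesis
        using False v by (simp add: shadow_oracle_def j0_def[symmetric] del: One_nat_def)
    next
      case False': False
      then show ?thesis using False by (auto simp: shadow_oracle_def split: option.split)
    qed
  qed
qed

text \<open>The indices of a layer depend on the tuples and the state reached so far, so they are
  known before g is read there. Reading g on all of J afresh in every layer costs at most B queries
  each time.\<close>

lemma query_alg_shadow_run:
  assumes "\<And>\<psi>. query_alg (2 ^ n) Q (k \<psi>)" and "c + length rs \<le> d" "J \<subseteq> {..<2 ^ n}"
    and "card J + (\<Sum>i<length rs. R (c + i)) \<le> B"
  shows "query_alg (2 ^ n) (length rs * B + Q) (\<lambda>g. k (shadow_run n d q g ts \<epsilon> R rs c J \<phi>) g)"
  using assms(2-4)
proof (induction rs arbitrary: c J \<phi>)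
  case Nil
  then show ?case using assms(1) by simp
next
  case (Cons LS rs)
  let ?\<phi> = "apply_layer (fst LS) \<phi>"
  let ?xs = "choose_indices n d q (snd LS) ?\<phi> ts c (R c) J \<epsilon>"
  let ?J = "J \<union> set ?xs"
  have xs: "set ?xs \<subseteq> {..<2 ^ n}" "length ?xs = R c" using choose_indices_in[of n d q] by blast+
  have J: "?J \<subseteq> {..<2 ^ n}" using Cons.prems xs by simp
  have "card ?J \<le> card J + card (set ?xs)" by (rule card_Un_le)
  then have cardJ: "card ?J \<le> card J + R c" using card_length[of ?xs] xs(2) by linarith
  have sum: "(\<Sum>i<length (LS # rs). R (c + i)) = R c + (\<Sum>i<length rs. R (Suc c + i))"
    using sum.lessThan_Suc_shift[of "\<lambda>i. R (c + i)" "length rs"] by simp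
  define \<kappa> where "\<kappa> = (\<lambda>\<gamma> g. k (shadow_run n d q g ts \<epsilon> R rs (Suc c) ?J
      (apply_oracle n (shadow_oracle n d \<gamma> ts c ?J) (snd LS) ?\<phi>)) g)"
  have "query_alg (2 ^ n) (length rs * B + Q) (\<kappa> \<gamma>)" for \<gamma>
    unfolding \<kappa>_def by (rule Cons.IH) (use Cons.prems sum cardJ J in auto)
  then have "query_alg (2 ^ n) (card ?J + (length rs * B + Q)) (\<lambda>g. \<kappa> (restrict g ?J) g)"
    using J by (intro query_alg_restrict) (auto intro: finite_subset)
  moreover have "\<kappa> (restrict g ?J) g = k (shadow_run n d q g ts \<epsilon> R (LS # rs) c J \<phi>) g" for g
    using Cons.prems(1) by (simp add: \<kappa>_def shadow_oracle_restrict Let_def)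
  ultimately have "query_alg (2 ^ n) (card ?J + (length rs * B + Q))
      (\<lambda>g. k (shadow_run n d q g ts \<epsilon> R (LS # rs) c J \<phi>) g)" by simp
  moreover have "card ?J + (length rs * B + Q) \<le> length (LS # rs) * B + Q"
    using cardJ Cons.prems(3) sum by simp
  ultimately show ?case using query_alg_mono by blast
qed

text \<open>At layer c either no list of \<open>R c\<close> indices suffices, or one of the (2^n)^(R
  c) lists leads to a failure further on.\<close>

primrec failure_bound :: "nat \<Rightarrow> real \<Rightarrow> (nat \<Rightarrow> nat) \<Rightarrow> nat \<Rightarrow> nat \<Rightarrow> real" where
  "failure_bound n \<rho> R 0 c = 0"
| "failure_bound n \<rho> R (Suc l) c = \<rho> ^ R c + (2 ^ n) ^ R c * failure_bound n \<rho> R l (Suc c)"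

lemma card_index_lists: "card (index_lists n r) = (2 ^ n) ^ r"
  using card_lists_length_eq[of "{..<2 ^ n :: nat}" r] by simp

lemma finite_index_lists: "finite (index_lists n r)"
  using finite_lists_length_eq[of "{..<2 ^ n :: nat}" r] by simp

lemma ignores_entries_apply_oracle:
  assumes "ignores_entries d c J \<Phi>" "J \<subseteq> J'"
  shows "ignores_entries d (Suc c) J' (\<lambda>ts. apply_oracle n (shadow_oracle n d g ts c J') Ss (apply_layer L (\<Phi> ts)))"
  using assms shadow_oracle_update_entry unfolding ignores_entries_def
  by (metis Suc_lessD subsetD)

text \<open>The list chosen at a layer depends on the whole shuffle, so the state that follows need
  not ignore the hidden entries. Fixing the list beforehand restores this invariance; the failure
  event is covered by the union over all lists, and the induction applies to each.\<close>

lemma card_shadow_fails_le: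
  assumes "wf_rounds n q k rs" "c + length rs \<le> d" "0 < \<epsilon>" "ignores_entries d c J \<Phi>"
    and "\<And>ts. ts \<in> shuffle_lists n d \<Longrightarrow> sqnorm q (\<Phi> ts) = 1"
  shows "real (card {ts \<in> shuffle_lists n d. shadow_fails n d q g ts \<epsilon> R rs c J (\<Phi> ts)})
    \<le> failure_bound n (hit_rate n d k / \<epsilon>) R (length rs) c * card (shuffle_lists n d)"
  using assms
proof (induction rs arbitrary: c J \<Phi>)
  case (Cons LS rs)
  obtain L Ss where LS: "LS = (L, Ss)" by (cases LS)
  let ?S = "shuffle_lists n d" and ?\<rho> = "hit_rate n d k / \<epsilon>"
  have wf: "wf_layer q L" "wf_qlayer n q k Ss" "wf_rounds n q k rs"
    using Cons.prems(1) by (auto simp: LS wf_rounds_def)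
  have len: "length Ss \<le> k" using wf(2) by (simp add: wf_qlayer_def)
  let ?\<Phi> = "\<lambda>ts. apply_layer L (\<Phi> ts)"
  have ign: "ignores_entries d c J ?\<Phi>" using Cons.prems(4) by (simp add: ignores_entries_def)
  have norm: "sqnorm q (?\<Phi> ts) = 1" if "ts \<in> ?S" for ts
    using Cons.prems(5)[OF that] by (simp add: sqnorm_apply_layer[OF wf(1)])
  let ?U = "{ts \<in> ?S. uncoverable n d q Ss (?\<Phi> ts) ts c (R c) J \<epsilon>}"
  let ?\<Psi> = "\<lambda>xs ts. apply_oracle n (shadow_oracle n d g ts c (J \<union> set xs)) Ss (?\<Phi> ts)"
  let ?B = "\<lambda>xs. {ts \<in> ?S. shadow_fails n d q g ts \<epsilon> R rs (Suc c) (J \<union> set xs) (?\<Psi> xs ts)}"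
  let ?X = "index_lists n (R c)"
  have U: "real (card ?U) \<le> ?\<rho> ^ R c * card ?S"
    by (rule card_uncoverable_le[OF ign norm len Cons.prems(3)])
  have B: "real (card (?B xs)) \<le> failure_bound n ?\<rho> R (length rs) (Suc c) * card ?S" for xs
  proof (rule Cons.IH[OF wf(3) _ Cons.prems(3)])
    show "ignores_entries d (Suc c) (J \<union> set xs) (?\<Psi> xs)"
      by (rule ignores_entries_apply_oracle[OF Cons.prems(4)]) auto
    show "Suc c + length rs \<le> d" using Cons.prems(2) by simp
    show "sqnorm q (?\<Psi> xs ts) = 1" if "ts \<in> ?S" for ts
      using norm[OF that] by (simp add: sqnorm_apply_oracle[OF wf(2)])
  qed
  have "{ts \<in> ?S. shadow_fails n d q g ts \<epsilon> R (LS # rs) c J (\<Phi> ts)} \<subseteq> ?U \<union> (\<Union>xs\<in>?X. ?B xs)"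
  proof
    fix ts assume ts: "ts \<in> {ts \<in> ?S. shadow_fails n d q g ts \<epsilon> R (LS # rs) c J (\<Phi> ts)}"
    let ?xs = "choose_indices n d q Ss (?\<Phi> ts) ts c (R c) J \<epsilon>"
    have "ts \<in> ?U \<or> ts \<in> ?B ?xs" using ts unfolding LS shadow_fails.simps Let_def fst_conv snd_conv by blast
    moreover have "?xs \<in> ?X" by (rule choose_indices_in)
    ultimately show "ts \<in> ?U \<union> (\<Union>xs\<in>?X. ?B xs)" by blast
  qed
  then have "card {ts \<in> ?S. shadow_fails n d q g ts \<epsilon> R (LS # rs) c J (\<Phi> ts)} \<le> card (?U \<union> (\<Union>xs\<in>?X. ?B xs))"
    by (intro card_mono finite_UnI finite_UN_I finite_index_lists finite_subset[OF _ finite_shuffle_lists[of n d]]) auto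
  also have "\<dots> \<le> card ?U + card (\<Union>xs\<in>?X. ?B xs)" by (rule card_Un_le)
  also have "\<dots> \<le> card ?U + (\<Sum>xs\<in>?X. card (?B xs))"
    by (intro add_left_mono card_UN_le finite_index_lists)
  finally have "real (card {ts \<in> ?S. shadow_fails n d q g ts \<epsilon> R (LS # rs) c J (\<Phi> ts)})
      \<le> real (card ?U) + (\<Sum>xs\<in>?X. real (card (?B xs)))"
    unfolding of_nat_add[symmetric] of_nat_sum[symmetric] of_nat_le_iff .
  also have "\<dots> \<le> ?\<rho> ^ R c * card ?S
      + (\<Sum>xs\<in>?X. failure_bound n ?\<rho> R (length rs) (Suc c) * card ?S)"
    by (intro add_mono U sum_mono B)
  also have "\<dots> = failure_bound n ?\<rho> R (length (LS # rs)) c * card ?S"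
    by (simp add: card_index_lists algebra_simps)
  finally show ?case .
qed simp

section \<open>Union bounds over the history\<close>

lemma calg_ok_set_pmf: "calg_ok a \<kappa> P \<Longrightarrow> l \<in> set_pmf (run_calg a F) \<Longrightarrow> P l"
  by (induction a arbitrary: \<kappa>) auto

lemma nn_integral_pmf_mono:
  "(\<And>x. x \<in> set_pmf p \<Longrightarrow> f x \<le> g x) \<Longrightarrow> (\<integral>\<^sup>+x. f x \<partial>measure_pmf p) \<le> (\<integral>\<^sup>+x. g x \<partial>measure_pmf p)"
  by (intro nn_integral_mono_AE) (simp add: AE_measure_pmf_iff)

lemma nn_integral_pmf_le_const:
  fixes f :: "'a \<Rightarrow> ennreal"
  assumes "\<And>x. x \<in> set_pmf p \<Longrightarrow> f x \<le> c" shows "(\<integral>\<^sup>+x. f x \<partial>measure_pmf p) \<le> c"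
  using nn_integral_pmf_mono[of p f "\<lambda>_. c"] assms by simp

text \<open>Union bound over the oracle answers: \<open>S\<close> stays the full sample space along every branch.\<close>

lemma sum_run_calg_le:
  fixes h :: "'a \<Rightarrow> 'b \<Rightarrow> ennreal"
  assumes "calg_ok a \<kappa> P" "finite S" "finite Y" "Y \<noteq> {}"
    and Y: "\<And>t i x. t \<in> S \<Longrightarrow> F t i x \<in> Y"
    and h: "\<And>l. P l \<Longrightarrow> (\<Sum>t\<in>S. h l t) \<le> B"
  shows "(\<Sum>t\<in>S. \<integral>\<^sup>+l. h l t \<partial>run_calg a (F t)) \<le> of_nat (card Y ^ \<kappa>) * B"
  using assms(1)
proof (induction a arbitrary: \<kappa>)
  case (Ret a)
  have "1 \<le> card Y ^ \<kappa>" using assms(3,4) by (simp add: Suc_le_eq card_gt_0_iff)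
  then have "(1 :: ennreal) \<le> of_nat (card Y ^ \<kappa>)" by (metis of_nat_1 of_nat_mono)
  then have "1 * B \<le> of_nat (card Y ^ \<kappa>) * B" by (intro mult_right_mono) auto
  moreover have "(\<Sum>t\<in>S. \<integral>\<^sup>+l. h l t \<partial>run_calg (Ret a) (F t)) = (\<Sum>t\<in>S. h a t)"
    by (simp add: nn_integral_return)
  moreover have "(\<Sum>t\<in>S. h a t) \<le> B" using Ret by (intro h) simp
  ultimately show ?case by simp
next
  case (Flip f)
  have "(\<Sum>t\<in>S. \<integral>\<^sup>+l. h l t \<partial>run_calg (Flip f) (F t))
      = (\<integral>\<^sup>+b. (\<Sum>t\<in>S. \<integral>\<^sup>+l. h l t \<partial>run_calg (f b) (F t)) \<partial>bernoulli_pmf (1 / 2))"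
    unfolding run_calg.simps nn_integral_bind_pmf by (rule nn_integral_sum[symmetric]) simp
  also have "\<dots> \<le> of_nat (card Y ^ \<kappa>) * B"
    by (intro nn_integral_pmf_le_const Flip.IH) (use Flip.prems in auto)
  finally show ?case .
next
  case (Qry i x g)
  then obtain \<kappa>' where \<kappa>: "\<kappa> = Suc \<kappa>'" by (cases \<kappa>) auto
  have "(\<Sum>t\<in>S. \<integral>\<^sup>+l. h l t \<partial>run_calg (Qry i x g) (F t))
      \<le> (\<Sum>t\<in>S. \<Sum>y\<in>Y. \<integral>\<^sup>+l. h l t \<partial>run_calg (g y) (F t))"
  proof (rule sum_mono)
    fix t assume "t \<in> S"
    then show "(\<integral>\<^sup>+l. h l t \<partial>run_calg (Qry i x g) (F t)) \<le> (\<Sum>y\<in>Y. \<integral>\<^sup>+l. h l t \<partial>run_calg (g y) (F t))"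
      using member_le_sum[of "F t i x" Y "\<lambda>y. \<integral>\<^sup>+l. h l t \<partial>run_calg (g y) (F t)"] Y assms(3) by simp
  qed
  also have "\<dots> = (\<Sum>y\<in>Y. \<Sum>t\<in>S. \<integral>\<^sup>+l. h l t \<partial>run_calg (g y) (F t))" by (rule sum.swap)
  also have "\<dots> \<le> (\<Sum>y\<in>Y. of_nat (card Y ^ \<kappa>') * B)"
    by (intro sum_mono Qry.IH) (use Qry.prems \<kappa> in auto)
  also have "\<dots> = of_nat (card Y ^ \<kappa>) * B" by (simp add: \<kappa> mult.assoc)
  finally show ?case .
qed

text \<open>The measurement of a round is a parameter, so that the circuit and its shadow version
  become two instances.\<close>

primrec kernel_rounds :: "coracle \<Rightarrow> (qspec \<Rightarrow> bool list pmf) \<Rightarrow> (nat \<Rightarrow> 'm \<times> bool list \<Rightarrow> ('m \<times> qspec) calg)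
     \<Rightarrow> nat \<Rightarrow> nat \<Rightarrow> 'm \<times> bool list \<Rightarrow> ('m \<times> bool list) pmf" where
  "kernel_rounds F \<mu> A 0 i st = return_pmf st"
| "kernel_rounds F \<mu> A (Suc k) i st =
     bind_pmf (run_calg (A i st) F) (\<lambda>(mem, sp).
       bind_pmf (\<mu> sp) (\<lambda>y. kernel_rounds F \<mu> A k (Suc i) (mem, y)))"

text \<open>The expected number of bad specifications met in the run governed by \<tau>; it bounds
  the probability of meeting any.\<close>

primrec expected_failures :: "coracle \<Rightarrow> (qspec \<Rightarrow> bool list pmf) \<Rightarrow> (qspec \<Rightarrow> bool) \<Rightarrow> (nat \<Rightarrow> 'm \<times> bool list \<Rightarrow> ('m \<times> qspec) calg)
     \<Rightarrow> nat \<Rightarrow> nat \<Rightarrow> 'm \<times> bool list \<Rightarrow> ennreal" where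
  "expected_failures F \<tau> bad A 0 i st = 0"
| "expected_failures F \<tau> bad A (Suc k) i st =
     (\<integral>\<^sup>+l. of_bool (bad (snd l)) + (\<integral>\<^sup>+y. expected_failures F \<tau> bad A k (Suc i) (fst l, y) \<partial>\<tau> (snd l))
       \<partial>run_calg (A i st) F)"

lemma cq_rounds_kernel:
  "cq_rounds n F A k i st = kernel_rounds F (\<lambda>sp. measure_all (fst sp) (qrun n F sp)) A k i st"
  by (induction k arbitrary: i st) auto

text \<open>Hybrid argument over the rounds: the induction hypothesis replaces all later rounds
  while the current one still follows \<tau>, then \<open>close\<close> replaces the current one.
  Failures are therefore counted along the run with \<tau>.\<close>

lemma kernel_rounds_le:
  fixes h :: "'m \<times> bool list \<Rightarrow> ennreal" and \<tau> \<mu> :: "qspec \<Rightarrow> bool list pmf"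
  assumes ok: "\<And>j st. i \<le> j \<Longrightarrow> j < i + k \<Longrightarrow> calg_ok (A j st) \<kappa> (\<lambda>(mem, sp). valid sp)"
    and close: "\<And>sp f. valid sp \<Longrightarrow> (\<And>y. f y \<le> (1 :: ennreal)) \<Longrightarrow>
      (\<integral>\<^sup>+y. f y \<partial>\<tau> sp) \<le> (\<integral>\<^sup>+y. f y \<partial>\<mu> sp) + \<eta> + of_bool (bad sp)"
    and h: "\<And>st. h st \<le> 1"
  shows "(\<integral>\<^sup>+x. h x \<partial>kernel_rounds F \<tau> A k i st)
    \<le> (\<integral>\<^sup>+x. h x \<partial>kernel_rounds F \<mu> A k i st) + of_nat k * \<eta> + expected_failures F \<tau> bad A k i st"
  using ok
proof (induction k arbitrary: i st)
  case 0
  then show ?case by simp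
next
  case (Suc k)
  let ?V = "\<lambda>mem y. expected_failures F \<tau> bad A k (Suc i) (mem, y)"
  let ?H = "\<lambda>\<mu> mem y. (\<integral>\<^sup>+x. h x \<partial>kernel_rounds F \<mu> A k (Suc i) (mem, y))"
  have IH: "?H \<tau> mem y \<le> ?H \<mu> mem y + of_nat k * \<eta> + ?V mem y" for mem y
    by (rule Suc.IH) (use Suc.prems in auto)
  have le: "(\<integral>\<^sup>+y. ?H \<tau> mem y \<partial>\<tau> sp) \<le> (\<integral>\<^sup>+y. ?H \<mu> mem y \<partial>\<mu> sp) + of_nat (Suc k) * \<eta>
      + (of_bool (bad sp) + (\<integral>\<^sup>+y. ?V mem y \<partial>\<tau> sp))" if "valid sp" for mem sp
  proof -
    have "(\<integral>\<^sup>+y. ?H \<tau> mem y \<partial>\<tau> sp) \<le> (\<integral>\<^sup>+y. ?H \<mu> mem y + of_nat k * \<eta> + ?V mem y \<partial>\<tau> sp)"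
      by (intro nn_integral_mono IH)
    also have "\<dots> = (\<integral>\<^sup>+y. ?H \<mu> mem y \<partial>\<tau> sp) + of_nat k * \<eta> + (\<integral>\<^sup>+y. ?V mem y \<partial>\<tau> sp)"
      by (simp add: nn_integral_add)
    also have "(\<integral>\<^sup>+y. ?H \<mu> mem y \<partial>\<tau> sp) \<le> (\<integral>\<^sup>+y. ?H \<mu> mem y \<partial>\<mu> sp) + \<eta> + of_bool (bad sp)"
      by (intro close that nn_integral_pmf_le_const h)
    finally show ?thesis by (simp add: algebra_simps)
  qed
  have "(\<integral>\<^sup>+x. h x \<partial>kernel_rounds F \<tau> A (Suc k) i st)
    = (\<integral>\<^sup>+l. (\<integral>\<^sup>+y. ?H \<tau> (fst l) y \<partial>\<tau> (snd l)) \<partial>run_calg (A i st) F)"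
    by (simp add: case_prod_unfold)
  also have "\<dots> \<le> (\<integral>\<^sup>+l. (\<integral>\<^sup>+y. ?H \<mu> (fst l) y \<partial>\<mu> (snd l)) + of_nat (Suc k) * \<eta>
      + (of_bool (bad (snd l)) + (\<integral>\<^sup>+y. ?V (fst l) y \<partial>\<tau> (snd l))) \<partial>run_calg (A i st) F)"
  proof (intro nn_integral_pmf_mono le)
    fix l assume "l \<in> set_pmf (run_calg (A i st) F)"
    moreover have "calg_ok (A i st) \<kappa> (\<lambda>(mem, sp). valid sp)" by (rule Suc.prems) auto
    ultimately show "valid (snd l)" using calg_ok_set_pmf by (force simp: case_prod_unfold)
  qed
  also have "\<dots> = (\<integral>\<^sup>+x. h x \<partial>kernel_rounds F \<mu> A (Suc k) i st) + of_nat (Suc k) * \<eta>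
      + expected_failures F \<tau> bad A (Suc k) i st"
    by (subst nn_integral_add, simp, simp, subst nn_integral_add) (simp_all add: case_prod_unfold)
  finally show ?case .
qed

text \<open>Union bound over the histories: for each fixed history the specification does not depend on
  the shuffle, which is then still uniform.\<close>

lemma sum_expected_failures_le:
  fixes A :: "nat \<Rightarrow> 'm \<times> bool list \<Rightarrow> ('m \<times> qspec) calg" and \<tau> :: "'t \<Rightarrow> qspec \<Rightarrow> bool list pmf"
  assumes ok: "\<And>j st. i \<le> j \<Longrightarrow> j < i + k \<Longrightarrow> calg_ok (A j st) \<kappa> (\<lambda>(mem, sp). valid sp)"
    and S: "finite S" and Y: "finite Y" "Y \<noteq> {}" "\<And>t i x. t \<in> S \<Longrightarrow> F t i x \<in> Y"
    and supp: "\<And>sp t. valid sp \<Longrightarrow> set_pmf (\<tau> t sp) \<subseteq> bitstrings (fst sp)" "\<And>sp. valid sp \<Longrightarrow> fst sp \<le> \<kappa>"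
    and bad: "\<And>sp. valid sp \<Longrightarrow> (\<Sum>t\<in>S. of_bool (bad t sp)) \<le> (D :: ennreal)"
  shows "(\<Sum>t\<in>S. expected_failures (F t) (\<tau> t) (bad t) A k i st)
    \<le> of_nat k * of_nat ((card Y ^ \<kappa> * 2 ^ \<kappa>) ^ k) * D"
  using ok
proof (induction k arbitrary: i st)
  case 0
  then show ?case by simp
next
  case (Suc k)
  let ?V = "\<lambda>t mem y. expected_failures (F t) (\<tau> t) (bad t) A k (Suc i) (mem, y)"
  let ?W = "card Y ^ \<kappa> * 2 ^ \<kappa>"
  let ?B = "of_nat (2 ^ \<kappa>) * (of_nat (Suc k) * of_nat (?W ^ k) * D) :: ennreal"
  have W: "1 \<le> ?W ^ k" using Y by (simp add: Suc_le_eq card_gt_0_iff)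
  have IH: "(\<Sum>t\<in>S. ?V t mem y) \<le> of_nat k * of_nat (?W ^ k) * D" for mem y
    by (rule Suc.IH) (use Suc.prems in auto)
  have leaf: "(\<Sum>t\<in>S. of_bool (bad t sp) + (\<integral>\<^sup>+y. ?V t mem y \<partial>\<tau> t sp)) \<le> ?B" if "valid sp" for mem sp
  proof -
    \<comment> \<open>The probability of an outcome is estimated by 1 and all outcomes are added up.
      Each outcome is then fixed independently of the shuffle, at the price of at most 2^\<kappa>
      terms.\<close>
    have "(\<integral>\<^sup>+y. ?V t mem y \<partial>\<tau> t sp) \<le> (\<Sum>y\<in>bitstrings (fst sp). ?V t mem y)" for t
      by (intro nn_integral_pmf_le_const member_le_sum) (use supp(1)[OF that, of t] in auto)
    then have "(\<Sum>t\<in>S. \<integral>\<^sup>+y. ?V t mem y \<partial>\<tau> t sp) \<le> (\<Sum>t\<in>S. \<Sum>y\<in>bitstrings (fst sp). ?V t mem y)"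
      by (rule sum_mono)
    also have "\<dots> = (\<Sum>y\<in>bitstrings (fst sp). \<Sum>t\<in>S. ?V t mem y)" by (rule sum.swap)
    also have "\<dots> \<le> (\<Sum>y\<in>bitstrings (fst sp). of_nat k * of_nat (?W ^ k) * D)" by (intro sum_mono IH)
    also have "\<dots> = of_nat (2 ^ fst sp) * (of_nat k * of_nat (?W ^ k) * D)" by simp
    also have "\<dots> \<le> of_nat (2 ^ \<kappa>) * (of_nat k * of_nat (?W ^ k) * D)"
      using supp(2)[OF that] by (intro mult_right_mono of_nat_mono power_increasing) auto
    finally have 1: "(\<Sum>t\<in>S. \<integral>\<^sup>+y. ?V t mem y \<partial>\<tau> t sp) \<le> \<dots>" .
    have "1 * 1 * D \<le> of_nat (2 ^ \<kappa>) * of_nat (?W ^ k) * D"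
      using W by (intro mult_right_mono mult_mono) (auto simp: of_nat_mono[of 1, simplified] simp del: of_nat_power of_nat_mult)
    then have 2: "(\<Sum>t\<in>S. of_bool (bad t sp)) \<le> of_nat (2 ^ \<kappa>) * (of_nat (?W ^ k) * D)"
      using bad[OF that] by (simp add: mult.assoc)
    have "(\<Sum>t\<in>S. of_bool (bad t sp) + (\<integral>\<^sup>+y. ?V t mem y \<partial>\<tau> t sp))
      \<le> of_nat (2 ^ \<kappa>) * (of_nat (?W ^ k) * D) + of_nat (2 ^ \<kappa>) * (of_nat k * of_nat (?W ^ k) * D)"
      unfolding sum.distrib by (intro add_mono 1 2)
    also have "\<dots> = ?B" by (simp add: algebra_simps)
    finally show ?thesis .
  qed
  have "(\<Sum>t\<in>S. expected_failures (F t) (\<tau> t) (bad t) A (Suc k) i st) \<le> of_nat (card Y ^ \<kappa>) * ?B"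
    unfolding expected_failures.simps
  proof (rule sum_run_calg_le[where P = "\<lambda>(mem, sp). valid sp"])
    show "calg_ok (A i st) \<kappa> (\<lambda>(mem, sp). valid sp)" by (rule Suc.prems) auto
  qed (use S Y leaf in auto)
  also have "\<dots> = of_nat (Suc k) * of_nat (?W ^ Suc k) * D"
    by (simp add: algebra_simps)
  finally show ?case .
qed

section \<open>Simulating the circuit by a classical query algorithm\<close>

text \<open>Given the tuples, an oracle answer depends on g only for index d at an entry of level d,
  where it is a single value of g; all other answers come from the tuples. Level d is a shuffled
  tuple because d is positive.\<close>

lemma query_alg_run_calg:
  assumes "calg_ok a \<kappa> P" "\<And>l. P l \<Longrightarrow> query_alg (2 ^ n) Q (k l)"
    and ts: "ts \<in> shuffle_lists n d" and d: "1 \<le> d"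
  shows "query_alg (2 ^ n) (\<kappa> + Q) (\<lambda>g. bind_pmf (run_calg a (shuffle_oracle n d g ts)) (\<lambda>l. k l g))"
  using assms(1)
proof (induction a arbitrary: \<kappa>)
  case (Ret a)
  then have "query_alg (2 ^ n) Q (k a)" by (intro assms(2)) simp
  then show ?case unfolding run_calg.simps bind_return_pmf by (rule query_alg_mono[rotated]) simp
next
  case (Flip f)
  \<comment> \<open>Coins are recoded as one-bit strings to fit the sample space of
    \<open>query_alg\<close>.\<close>
  have "query_alg (2 ^ n) (\<kappa> + Q) (\<lambda>g. bind_pmf (map_pmf (\<lambda>b. [b]) (bernoulli_pmf (1 / 2)))
      (\<lambda>y. bind_pmf (run_calg (f (hd y)) (shuffle_oracle n d g ts)) (\<lambda>l. k l g)))"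
    by (rule query_alg.samp, rule Flip.IH) (use Flip.prems in auto)
  then show ?case by (simp add: bind_map_pmf bind_assoc_pmf)
next
  case (Qry i x c)
  then obtain \<kappa>' where \<kappa>: "\<kappa> = Suc \<kappa>'" by (cases \<kappa>) auto
  have IH: "query_alg (2 ^ n) (\<kappa>' + Q) (\<lambda>g. bind_pmf (run_calg (c y) (shuffle_oracle n d g ts)) (\<lambda>l. k l g))" for y
    by (rule Qry.IH) (use Qry.prems \<kappa> in auto)
  have T: "shuffle_T d g ts i' = (if i' = 0 then id else if i' \<le> d then ts ! (i' - 1) else g)" for g i'
    by (simp add: shuffle_T_def)
  show ?case
  proof (cases "i = d \<and> (\<exists>v. x = Some v \<and> (\<exists>j<2 ^ n. (ts ! (d - 1)) j = v))")
    case True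
    then obtain j where j: "i = d" "j < 2 ^ n" "x = Some ((ts ! (d - 1)) j)" by blast
    have "(THE j'. j' < 2 ^ n \<and> (ts ! (d - 1)) j' = (ts ! (d - 1)) j) = j"
      using shuffle_listsD(3)[OF ts, of d] d j(2) by (intro the_equality) (auto simp: inj_on_def)
    then have "shuffle_oracle n d g ts i x = Some (g j)" for g
      using j d by (auto simp: shuffle_oracle_def shuffle_f_def T)
    then show ?thesis
      using query_alg.qry[OF j(2), of "\<kappa>' + Q" "\<lambda>v g. bind_pmf (run_calg (c (Some v)) (shuffle_oracle n d g ts)) (\<lambda>l. k l g)"] IH
      by (simp add: \<kappa>)
  next
    case False
    have "shuffle_oracle n d g ts i x = shuffle_oracle n d g' ts i x" for g g'
    proof (cases "i < d")
      case True
      then have "shuffle_T d g ts i = shuffle_T d g' ts i" "shuffle_T d g ts (Suc i) = shuffle_T d g' ts (Suc i)"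
        by (simp_all add: T)
      then show ?thesis by (auto simp: shuffle_oracle_def shuffle_f_def split: option.split)
    next
      case ge: False
      show ?thesis
      proof (cases "i = d")
        case True
        then show ?thesis
          using False d by (auto simp: shuffle_oracle_def shuffle_f_def T split: option.split)
      next
        case False
        then show ?thesis using ge by (simp add: shuffle_oracle_def)
      qed
    qed
    then have eq: "shuffle_oracle n d g ts i x = shuffle_oracle n d id ts i x" for g by blast
    have "query_alg (2 ^ n) (Suc (\<kappa>' + Q))
        (\<lambda>g. bind_pmf (run_calg (c (shuffle_oracle n d id ts i x)) (shuffle_oracle n d g ts)) (\<lambda>l. k l g))"
      by (rule query_alg_Suc, rule IH)
    then show ?thesis unfolding run_calg.simps \<kappa> by (subst eq) simp
  qed
qed

definition basis_state :: "bool list \<Rightarrow> qstate" where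
  "basis_state x = (\<lambda>b. if b = x then 1 else 0)"

lemma sqnorm_basis_state: "length x = q \<Longrightarrow> sqnorm q (basis_state x) = 1"
proof -
  assume x: "length x = q"
  have "sqnorm q (basis_state x) = (\<Sum>b\<in>bitstrings q. if b = x then 1 else 0)"
    unfolding sqnorm_def basis_state_def by (intro sum.cong) auto
  then show ?thesis using x by (simp add: sum.delta)
qed

text \<open>Every round starts anew with no revealed path: what the circuit learnt earlier sits in
  the specification and is met by the choice of indices.\<close>

definition shadow_state :: "nat \<Rightarrow> nat \<Rightarrow> (nat \<Rightarrow> nat) \<Rightarrow> (nat \<Rightarrow> nat) list \<Rightarrow> real \<Rightarrow> (nat \<Rightarrow> nat) \<Rightarrow> qspec \<Rightarrow> qstate" where
  "shadow_state n d g ts \<epsilon> R sp = (case sp of (q, init, Ls, Qs) \<Rightarrow>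
     apply_layer (Ls ! length Qs) (shadow_run n d q g ts \<epsilon> R (zip Ls Qs) 0 {} (basis_state init)))"

definition shadow_bad :: "nat \<Rightarrow> nat \<Rightarrow> (nat \<Rightarrow> nat) \<Rightarrow> (nat \<Rightarrow> nat) list \<Rightarrow> real \<Rightarrow> (nat \<Rightarrow> nat) \<Rightarrow> qspec \<Rightarrow> bool" where
  "shadow_bad n d g ts \<epsilon> R sp = (case sp of (q, init, Ls, Qs) \<Rightarrow>
     shadow_fails n d q g ts \<epsilon> R (zip Ls Qs) 0 {} (basis_state init))"

lemma wf_specD:
  assumes "wf_spec n d k (q, init, Ls, Qs)"
  shows "q \<le> k" "wf_rounds n q k (zip Ls Qs)" "length (zip Ls Qs) = d" "wf_layer q (Ls ! length Qs)"
    "sqnorm q (basis_state init) = 1"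
  using assms
  by (auto simp: wf_spec_def wf_rounds_def sqnorm_basis_state dest: set_zip_leftD set_zip_rightD)

lemma qrun_eq: "qrun n F (q, init, Ls, Qs) = apply_layer (Ls ! length Qs) (query_run n F (zip Ls Qs) (basis_state init))"
  by (simp add: qrun_def basis_state_def)

lemma sqnorm_qrun:
  assumes "wf_spec n d k sp" shows "sqnorm (fst sp) (qrun n F sp) = 1"
proof -
  obtain q init Ls Qs where sp: "sp = (q, init, Ls, Qs)" by (cases sp)
  note wf = wf_specD[OF assms[unfolded sp]]
  show ?thesis unfolding sp qrun_eq fst_conv
    by (simp add: sqnorm_apply_layer[OF wf(4)] sqnorm_query_run[OF wf(2)] wf(5))
qed

text \<open>A bad specification is charged the trivial bound 1. Otherwise the d layers move the
  state by at most 2 d sqrt \<epsilon>, and measuring doubles this.\<close>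

lemma measure_qrun_le_measure_shadow:
  assumes "wf_spec n d k sp" "ts \<in> shuffle_lists n d" "\<And>y. f y \<le> (1 :: ennreal)"
  shows "(\<integral>\<^sup>+y. f y \<partial>measure_all (fst sp) (qrun n (shuffle_oracle n d g ts) sp))
    \<le> (\<integral>\<^sup>+y. f y \<partial>measure_all (fst sp) (shadow_state n d g ts \<epsilon> R sp)) + ennreal (4 * real d * sqrt \<epsilon>)
      + of_bool (shadow_bad n d g ts \<epsilon> R sp)"
proof (cases "shadow_bad n d g ts \<epsilon> R sp")
  case True
  have "(\<integral>\<^sup>+y. f y \<partial>measure_all (fst sp) (qrun n (shuffle_oracle n d g ts) sp)) \<le> 1"
    by (intro nn_integral_pmf_le_const assms(3))
  then show ?thesis using True by (simp add: add_increasing)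
next
  case False
  obtain q init Ls Qs where sp: "sp = (q, init, Ls, Qs)" by (cases sp)
  note wf = wf_specD[OF assms(1)[unfolded sp]]
  let ?\<phi> = "basis_state init" and ?L = "Ls ! length Qs"
  let ?real = "query_run n (shuffle_oracle n d g ts) (zip Ls Qs) ?\<phi>"
  let ?shadow = "shadow_run n d q g ts \<epsilon> R (zip Ls Qs) 0 {} ?\<phi>"
  have zero: "l2norm q (\<lambda>b. ?\<phi> b - ?\<phi> b) = 0" by (simp add: l2norm_sqrt sqnorm_def)
  have "\<not> shadow_fails n d q g ts \<epsilon> R (zip Ls Qs) 0 {} ?\<phi>"
    using False by (simp add: shadow_bad_def sp)
  from l2norm_query_run_shadow_run_le[OF wf(2) assms(2) _ this, of ?\<phi>]
  have "l2norm q (\<lambda>b. ?real b - ?shadow b) \<le> real d * (2 * sqrt \<epsilon>)"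
    unfolding wf(3) zero by simp
  then have dist: "l2norm q (\<lambda>b. apply_layer ?L ?real b - apply_layer ?L ?shadow b) \<le> real d * (2 * sqrt \<epsilon>)"
    unfolding l2norm_sqrt apply_layer_diff[symmetric] sqnorm_apply_layer[OF wf(4)] .
  have "sqnorm q (apply_layer ?L ?real) = 1" "sqnorm q (apply_layer ?L ?shadow) = 1"
    by (simp_all add: sqnorm_apply_layer[OF wf(4)] sqnorm_query_run[OF wf(2)] sqnorm_shadow_run[OF wf(2)] wf(5))
  then have "(\<integral>\<^sup>+y. f y \<partial>measure_all q (apply_layer ?L ?real))
      \<le> (\<integral>\<^sup>+y. f y \<partial>measure_all q (apply_layer ?L ?shadow))
        + ennreal (2 * l2norm q (\<lambda>b. apply_layer ?L ?real b - apply_layer ?L ?shadow b))"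
    by (rule nn_integral_measure_all_diff_le) (rule assms(3))
  also have "\<dots> \<le> (\<integral>\<^sup>+y. f y \<partial>measure_all q (apply_layer ?L ?shadow)) + ennreal (4 * real d * sqrt \<epsilon>)"
    using dist by (intro add_left_mono ennreal_leI) simp
  finally show ?thesis by (simp add: sp qrun_eq shadow_state_def add_increasing2)
qed

lemma card_shadow_bad_le:
  assumes "wf_spec n d k sp" "0 < \<epsilon>"
  shows "real (card {ts \<in> shuffle_lists n d. shadow_bad n d g ts \<epsilon> R sp})
    \<le> failure_bound n (hit_rate n d k / \<epsilon>) R d 0 * card (shuffle_lists n d)"
proof -
  obtain q init Ls Qs where sp: "sp = (q, init, Ls, Qs)" by (cases sp)
  note wf = wf_specD[OF assms(1)[unfolded sp]]
  have "ignores_entries d 0 {} (\<lambda>ts. basis_state init)" by (simp add: ignores_entries_def)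
  from card_shadow_fails_le[OF wf(2) _ assms(2) this] show ?thesis
    using wf(3,5) by (simp add: shadow_bad_def sp)
qed

text \<open>A round costs \<kappa> queries for its classical part, and each of its d layers costs at
  most the number of all indices chosen in that round.\<close>

lemma query_alg_kernel_rounds:
  assumes ok: "\<And>j st. i \<le> j \<Longrightarrow> j < i + r \<Longrightarrow> calg_ok (A j st) \<kappa> (\<lambda>(mem, sp). wf_spec n d \<kappa> sp)"
    and ts: "ts \<in> shuffle_lists n d" and d: "1 \<le> d" and k: "\<And>st. query_alg (2 ^ n) Q (k st)"
  shows "query_alg (2 ^ n) (r * (\<kappa> + d * (\<Sum>i<d. R i)) + Q) (\<lambda>g. bind_pmf
      (kernel_rounds (shuffle_oracle n d g ts) (\<lambda>sp. measure_all (fst sp) (shadow_state n d g ts \<epsilon> R sp)) A r i st)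
      (\<lambda>st. k st g))"
  using ok
proof (induction r arbitrary: i st)
  case 0
  then show ?case using k by (simp add: bind_return_pmf)
next
  case (Suc r)
  let ?B = "\<Sum>i<d. R i"
  let ?Q = "r * (\<kappa> + d * ?B) + Q"
  let ?rounds = "\<lambda>g j st. bind_pmf (kernel_rounds (shuffle_oracle n d g ts)
      (\<lambda>sp. measure_all (fst sp) (shadow_state n d g ts \<epsilon> R sp)) A r j st) (\<lambda>st. k st g)"
  have "query_alg (2 ^ n) (d * ?B + ?Q) (\<lambda>g. bind_pmf (measure_all (fst sp) (shadow_state n d g ts \<epsilon> R sp))
      (\<lambda>y. ?rounds g (Suc i) (mem, y)))" if sp_wf: "wf_spec n d \<kappa> sp" for mem sp
  proof -
    obtain q init Ls Qs where sp: "sp = (q, init, Ls, Qs)" by (cases sp)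
    note wf = wf_specD[OF sp_wf[unfolded sp]]
    define K where "K = (\<lambda>\<psi> g. bind_pmf (measure_all q (apply_layer (Ls ! length Qs) \<psi>)) (\<lambda>y. ?rounds g (Suc i) (mem, y)))"
    have "query_alg (2 ^ n) ?Q (K \<psi>)" for \<psi>
      unfolding K_def by (rule query_alg.samp, rule Suc.IH) (use Suc.prems in auto)
    then have "query_alg (2 ^ n) (length (zip Ls Qs) * ?B + ?Q)
        (\<lambda>g. K (shadow_run n d q g ts \<epsilon> R (zip Ls Qs) 0 {} (basis_state init)) g)"
      by (rule query_alg_shadow_run) (use wf(3) in auto)
    then show ?thesis unfolding wf(3) by (simp add: K_def sp shadow_state_def)
  qed
  moreover have okA: "calg_ok (A i st) \<kappa> (\<lambda>(mem, sp). wf_spec n d \<kappa> sp)" by (rule Suc.prems) auto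
  ultimately have "query_alg (2 ^ n) (\<kappa> + (d * ?B + ?Q)) (\<lambda>g. bind_pmf (run_calg (A i st) (shuffle_oracle n d g ts))
      (\<lambda>l. bind_pmf (measure_all (fst (snd l)) (shadow_state n d g ts \<epsilon> R (snd l))) (\<lambda>y. ?rounds g (Suc i) (fst l, y))))"
    by (intro query_alg_run_calg[OF okA _ ts d]) auto
  then show ?case by (simp add: bind_assoc_pmf case_prod_unfold algebra_simps)
qed

section \<open>Assembling the success bound\<close>

lemma less_power_double: "x < 2 ^ n \<Longrightarrow> x < (2 ^ (2 * n) :: nat)"
  by (erule order.strict_trans2) (rule power_increasing, auto)

lemma shuffle_lists_nonempty: "shuffle_lists n d \<noteq> {}"
proof -
  have "restrict id {..<2 ^ n} \<in> dist_tuples n"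
    by (auto simp: dist_tuples_def inj_on_def intro: less_power_double)
  then have "replicate d (restrict id {..<2 ^ n}) \<in> shuffle_lists n d" by (auto simp: shuffle_lists_def)
  then show ?thesis by blast
qed

lemma simon_pairs_nonempty:
  assumes "1 \<le> n" shows "simon_pairs n \<noteq> {}"
proof -
  have "(2 :: nat) ^ 1 \<le> 2 ^ n" using assms by (intro power_increasing) auto
  moreover have "restrict id {..<2 ^ n} \<in> perms n" by (auto simp: injections_def inj_on_def)
  ultimately have "(simon_fun n 1 (restrict id {..<2 ^ n}), 1) \<in> simon_pairs n"
    by (intro simon_fun_in_simon_pairs) auto
  then show ?thesis by blast
qed

text \<open>Supplies the number 2^(2*n) + 1 of branches at a classical query in the union bound over
  histories.\<close>

lemma shuffle_oracle_range:
  assumes "ts \<in> shuffle_lists n d" "g \<in> {..<2 ^ n} \<rightarrow>\<^sub>E {..<2 ^ n}"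
  shows "shuffle_oracle n d g ts i x \<in> insert None (Some ` {..<2 ^ (2 * n)})"
proof (cases x)
  case None
  then show ?thesis by (auto simp: shuffle_oracle_def shuffle_f_def)
next
  case (Some v)
  show ?thesis
  proof (cases "i \<le> d \<and> (\<exists>j<2 ^ n. shuffle_T d g ts i j = v)")
    case True
    then obtain j where j: "j < 2 ^ n" "shuffle_T d g ts i j = v" by blast
    have inj: "inj_on (shuffle_T d g ts i) {..<2 ^ n}"
      using True shuffle_listsD(3)[OF assms(1), of i] by (simp add: shuffle_T_def)
    have the: "(THE j. j < 2 ^ n \<and> shuffle_T d g ts i j = v) = j"
      using j inj by (intro the_equality) (auto simp: inj_on_def)
    have "g j < 2 ^ (2 * n)" using assms(2) j(1) by (auto intro: less_power_double)
    then have "shuffle_T d g ts (Suc i) j < 2 ^ (2 * n)"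
      using shuffle_listsD(4)[OF assms(1), of "Suc i" j] j(1) by (auto simp: shuffle_T_def)
    then show ?thesis using True the Some by (auto simp: shuffle_oracle_def shuffle_f_def)
  next
    case False
    then show ?thesis using Some by (auto simp: shuffle_oracle_def shuffle_f_def)
  qed
qed

lemma failure_bound_nonneg: "0 \<le> \<rho> \<Longrightarrow> 0 \<le> failure_bound n \<rho> R l c"
  by (induction l arbitrary: c) auto

lemma shuffled_simon_success_eq:
  assumes "1 \<le> n"
  shows "shuffled_simon_success d C n = (\<Sum>(g, s)\<in>simon_pairs n. \<Sum>ts\<in>shuffle_lists n d.
      pmf (cq_output C n (shuffle_oracle n d g ts)) s) / (card (simon_pairs n) * card (shuffle_lists n d))"
proof -
  have map: "pmf (map_pmf (\<lambda>out. out = s) P) True = pmf P s" for P :: "nat pmf" and s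
  proof -
    have "(\<lambda>out. out = s) -` {True} = {s}" by auto
    then show ?thesis by (simp add: pmf_map measure_pmf_single)
  qed
  show ?thesis
    unfolding shuffled_simon_success_def
    by (simp add: pmf_bind_pmf_of_set simon_pairs_nonempty[OF assms] finite_simon_pairs
        shuffle_lists_nonempty finite_shuffle_lists case_prod_unfold map sum_divide_distrib mult.commute)
qed

text \<open>The three summands are the success of the simulating query algorithm, the drift of the
  states over all rounds, and the failures. W counts the continuations of one round: at most
  \<kappa> answers and \<kappa> measured bits.\<close>

lemma shuffled_simon_success_le:
  fixes A :: "nat \<Rightarrow> nat \<Rightarrow> 'm \<times> bool list \<Rightarrow> ('m \<times> qspec) calg"
  assumes n: "1 \<le> n" and d: "1 \<le> d" and \<epsilon>: "0 < \<epsilon>"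
    and ok: "\<And>i st. i \<in> {1..m n} \<Longrightarrow> calg_ok (A n i st) \<kappa> (\<lambda>(mem, sp). wf_spec n d \<kappa> sp)"
    and fin: "\<And>st. calg_ok (Afin n st) \<kappa> (\<lambda>_. True)"
    and Q: "Q = m n * (\<kappa> + d * (\<Sum>i<d. R i)) + \<kappa>"
    and W: "W = (2 ^ (2 * n) + 1) ^ \<kappa> * 2 ^ \<kappa>"
  shows "shuffled_simon_success d (m, A, Afin, init) n
    \<le> (1 + real Q * real Q) / (2 ^ n - 1) + m n * (4 * real d * sqrt \<epsilon>)
      + m n * real (W ^ m n) * failure_bound n (hit_rate n d \<kappa> / \<epsilon>) R d 0"
proof -
  let ?SP = "simon_pairs n" and ?SL = "shuffle_lists n d" and ?m = "m n"
  let ?C = "(m, A, Afin, init)"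
  let ?F = "\<lambda>g ts. shuffle_oracle n d g ts"
  let ?\<eta> = "4 * real d * sqrt \<epsilon>"
  let ?fb = "failure_bound n (hit_rate n d \<kappa> / \<epsilon>) R d 0"
  let ?\<tau> = "\<lambda>g ts sp. measure_all (fst sp) (qrun n (?F g ts) sp)"
  let ?\<mu> = "\<lambda>g ts sp. measure_all (fst sp) (shadow_state n d g ts \<epsilon> R sp)"
  let ?bad = "\<lambda>g ts. shadow_bad n d g ts \<epsilon> R"
  let ?st = "(init n, [])"
  define sim where "sim = (\<lambda>ts g. bind_pmf (kernel_rounds (?F g ts) (?\<mu> g ts) (A n) ?m 1 ?st)
      (\<lambda>st. run_calg (Afin n st) (?F g ts)))"
  define V where "V = (\<lambda>g ts. expected_failures (?F g ts) (?\<tau> g ts) (?bad g ts) (A n) ?m 1 ?st)"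
  have \<eta>: "0 \<le> ?\<eta>" using \<epsilon> by simp
  have fb: "0 \<le> ?fb" using hit_rate_nonneg \<epsilon> by (intro failure_bound_nonneg) simp
  have okA: "calg_ok (A n j st) \<kappa> (\<lambda>(mem, sp). wf_spec n d \<kappa> sp)" if "1 \<le> j" "j < 1 + ?m" for j st
    by (rule ok) (use that in auto)
  have real_le: "ennreal (pmf (cq_output ?C n (?F g ts)) s)
      \<le> ennreal (pmf (sim ts g) s) + of_nat ?m * ennreal ?\<eta> + V g ts" if ts: "ts \<in> ?SL" for g s ts
  proof -
    have "ennreal (pmf (cq_output ?C n (?F g ts)) s)
      = (\<integral>\<^sup>+st. ennreal (pmf (run_calg (Afin n st) (?F g ts)) s)
          \<partial>kernel_rounds (?F g ts) (?\<tau> g ts) (A n) ?m 1 ?st)"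
      by (simp add: cq_output_def ennreal_pmf_bind cq_rounds_kernel)
    also have "\<dots> \<le> (\<integral>\<^sup>+st. ennreal (pmf (run_calg (Afin n st) (?F g ts)) s)
          \<partial>kernel_rounds (?F g ts) (?\<mu> g ts) (A n) ?m 1 ?st) + of_nat ?m * ennreal ?\<eta> + V g ts"
      unfolding V_def
    proof (rule kernel_rounds_le[OF okA])
      show "(\<integral>\<^sup>+y. f y \<partial>?\<tau> g ts sp) \<le> (\<integral>\<^sup>+y. f y \<partial>?\<mu> g ts sp) + ennreal ?\<eta> + of_bool (?bad g ts sp)"
        if "wf_spec n d \<kappa> sp" "\<And>y. f y \<le> 1" for sp f
        by (rule measure_qrun_le_measure_shadow[OF that(1) ts that(2)])
    qed (simp_all add: pmf_le_1)
    finally show ?thesis by (simp add: sim_def ennreal_pmf_bind)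
  qed
  have V_le: "(\<Sum>ts\<in>?SL. V g ts) \<le> ennreal (?m * real (W ^ ?m) * (?fb * card ?SL))"
    if g: "g \<in> {..<2 ^ n} \<rightarrow>\<^sub>E {..<2 ^ n}" for g
  proof -
    let ?Y = "insert None (Some ` {..<2 ^ (2 * n)}) :: nat option set"
    have "card ?Y = 2 ^ (2 * n) + 1" by (subst card_insert_disjoint) (auto simp: card_image)
    then have W': "W = card ?Y ^ \<kappa> * 2 ^ \<kappa>" by (simp add: W)
    have "(\<Sum>ts\<in>?SL. V g ts) \<le> of_nat ?m * of_nat (W ^ ?m) * ennreal (?fb * card ?SL)"
      unfolding V_def W'
    proof (rule sum_expected_failures_le[OF okA finite_shuffle_lists])
      show "?F g ts i x \<in> ?Y" if "ts \<in> ?SL" for ts i x by (rule shuffle_oracle_range[OF that g])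
      show "set_pmf (?\<tau> g ts sp) \<subseteq> bitstrings (fst sp)" if "wf_spec n d \<kappa> sp" for ts sp
        using pmf_measure_all[OF sqnorm_qrun[OF that]] by (auto simp: set_pmf_iff split: if_splits)
      show "fst sp \<le> \<kappa>" if "wf_spec n d \<kappa> sp" for sp
        using that by (auto simp: wf_spec_def split: prod.splits)
      fix sp assume sp: "wf_spec n d \<kappa> sp"
      have "(\<Sum>ts\<in>?SL. of_bool (?bad g ts sp)) = (\<Sum>ts\<in>{ts \<in> ?SL. ?bad g ts sp}. 1 :: ennreal)"
        by (rule sum.mono_neutral_cong_right) (auto intro: finite_shuffle_lists)
      also have "\<dots> = ennreal (card {ts \<in> ?SL. ?bad g ts sp})"
        by (simp add: ennreal_of_nat_eq_real_of_nat)
      also have "\<dots> \<le> ennreal (?fb * card ?SL)"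
        by (intro ennreal_leI card_shadow_bad_le[OF sp \<epsilon>])
      finally show "(\<Sum>ts\<in>?SL. of_bool (?bad g ts sp)) \<le> ennreal (?fb * card ?SL)" .
    qed auto
    also have "\<dots> = ennreal (?m * real (W ^ ?m) * (?fb * card ?SL))"
      by (simp only: ennreal_of_nat_eq_real_of_nat ennreal_mult' of_nat_0_le_iff mult_nonneg_nonneg)
    finally show ?thesis .
  qed
  have g: "fst p \<in> {..<2 ^ n} \<rightarrow>\<^sub>E {..<2 ^ n}" if "p \<in> ?SP" for p
    using that by (auto simp: simon_pairs_def)
  have "ennreal (\<Sum>p\<in>?SP. \<Sum>ts\<in>?SL. pmf (cq_output ?C n (?F (fst p) ts)) (snd p))
      = (\<Sum>p\<in>?SP. \<Sum>ts\<in>?SL. ennreal (pmf (cq_output ?C n (?F (fst p) ts)) (snd p)))"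
    by (simp add: sum_nonneg)
  also have "\<dots> \<le> (\<Sum>p\<in>?SP. \<Sum>ts\<in>?SL. ennreal (pmf (sim ts (fst p)) (snd p)) + of_nat ?m * ennreal ?\<eta> + V (fst p) ts)"
    by (intro sum_mono real_le)
  also have "\<dots> = (\<Sum>p\<in>?SP. \<Sum>ts\<in>?SL. ennreal (pmf (sim ts (fst p)) (snd p)))
      + (\<Sum>p\<in>?SP. \<Sum>ts\<in>?SL. ennreal (?m * ?\<eta>)) + (\<Sum>p\<in>?SP. \<Sum>ts\<in>?SL. V (fst p) ts)"
    using \<eta> by (simp only: sum.distrib ennreal_of_nat_eq_real_of_nat ennreal_mult' of_nat_0_le_iff)
  also have "\<dots> \<le> (\<Sum>p\<in>?SP. \<Sum>ts\<in>?SL. ennreal (pmf (sim ts (fst p)) (snd p)))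
      + (\<Sum>p\<in>?SP. \<Sum>ts\<in>?SL. ennreal (?m * ?\<eta>)) + (\<Sum>p\<in>?SP. ennreal (?m * real (W ^ ?m) * (?fb * card ?SL)))"
    by (intro add_left_mono sum_mono V_le g)
  also have "\<dots> = ennreal ((\<Sum>p\<in>?SP. \<Sum>ts\<in>?SL. pmf (sim ts (fst p)) (snd p))
      + (\<Sum>p\<in>?SP. \<Sum>ts\<in>?SL. ?m * ?\<eta>) + (\<Sum>p\<in>?SP. ?m * real (W ^ ?m) * (?fb * card ?SL)))"
  proof -
    have nn: "0 \<le> ?m * real (W ^ ?m) * (?fb * card ?SL)" using fb by (intro mult_nonneg_nonneg) auto
    show ?thesis
      using \<eta> nn by (simp only: ennreal_plus sum_nonneg pmf_nonneg mult_nonneg_nonneg of_nat_0_le_iff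
          add_nonneg_nonneg sum_ennreal)
  qed
  finally have main: "(\<Sum>p\<in>?SP. \<Sum>ts\<in>?SL. pmf (cq_output ?C n (?F (fst p) ts)) (snd p))
      \<le> (\<Sum>p\<in>?SP. \<Sum>ts\<in>?SL. pmf (sim ts (fst p)) (snd p))
      + (\<Sum>p\<in>?SP. \<Sum>ts\<in>?SL. ?m * ?\<eta>) + (\<Sum>p\<in>?SP. ?m * real (W ^ ?m) * (?fb * card ?SL))"
    using \<eta> fb \<epsilon> by (subst (asm) ennreal_le_iff) (auto intro!: add_nonneg_nonneg sum_nonneg mult_nonneg_nonneg)
  have "(2 :: real) ^ 1 \<le> 2 ^ n" using n by (intro power_increasing) auto
  then have N: "0 < (2 :: real) ^ n - 1" by simp
  have sim_le: "(\<Sum>p\<in>?SP. pmf (sim ts (fst p)) (snd p)) \<le> (1 + real Q * real Q) / (2 ^ n - 1) * card ?SP"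
    if ts: "ts \<in> ?SL" for ts
  proof -
    \<comment> \<open>The tuples are plain data for the simulation, and they are independent of the
      Simon pair, which stays uniform.\<close>
    have "query_alg (2 ^ n) Q (sim ts)"
      unfolding sim_def Q
    proof (rule query_alg_kernel_rounds[OF okA ts d])
      fix st
      have "query_alg (2 ^ n) (\<kappa> + 0) (\<lambda>g. bind_pmf (run_calg (Afin n st) (?F g ts)) (\<lambda>l. return_pmf l))"
        by (rule query_alg_run_calg[OF fin _ ts d]) (rule query_alg.ret)
      then show "query_alg (2 ^ n) \<kappa> (\<lambda>g. run_calg (Afin n st) (?F g ts))"
        by (simp only: add_0_right bind_return_pmf')
    qed
    from query_alg_simon_bound[OF this] show ?thesis
      using N by (simp add: case_prod_unfold field_simps)
  qed
  have "(\<Sum>p\<in>?SP. \<Sum>ts\<in>?SL. pmf (sim ts (fst p)) (snd p)) = (\<Sum>ts\<in>?SL. \<Sum>p\<in>?SP. pmf (sim ts (fst p)) (snd p))"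
    by (rule sum.swap)
  also have "\<dots> \<le> (\<Sum>ts\<in>?SL. (1 + real Q * real Q) / (2 ^ n - 1) * card ?SP)"
    by (intro sum_mono sim_le)
  finally have "(\<Sum>p\<in>?SP. \<Sum>ts\<in>?SL. pmf (cq_output ?C n (?F (fst p) ts)) (snd p))
      \<le> ((1 + real Q * real Q) / (2 ^ n - 1) + ?m * ?\<eta> + ?m * real (W ^ ?m) * ?fb) * (card ?SP * card ?SL)"
    using main by (simp add: algebra_simps)
  moreover have "0 < real (card ?SP * card ?SL)"
    using simon_pairs_nonempty[OF n] finite_simon_pairs shuffle_lists_nonempty finite_shuffle_lists
    by (simp add: card_gt_0_iff)
  ultimately show ?thesis
    unfolding shuffled_simon_success_eq[OF n] case_prod_unfold by (simp add: pos_divide_le_eq)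
qed

text \<open>The factor 4 turns the assumption on \<rho>^4 into the exponent b * 5^c. The growth 5 =
  4 + 1 splits the bound of the next layer into 4 * b * 5^c factors that cancel the number of lists
  and b * 5^c factors that remain.\<close>

lemma failure_bound_le:
  assumes "0 \<le> \<rho>" "\<rho> ^ 4 \<le> (1 / 2 ^ n :: real)"
  shows "failure_bound n \<rho> (\<lambda>c. 4 * b * 5 ^ c) l c \<le> l * (1 / 2 ^ n) ^ (b * 5 ^ c)"
proof (induction l arbitrary: c)
  case (Suc l)
  let ?u = "1 / 2 ^ n :: real" and ?e = "b * 5 ^ c"
  have "\<rho> ^ (4 * b * 5 ^ c) = (\<rho> ^ 4) ^ ?e" by (simp add: power_mult[symmetric] mult.assoc)
  also have "\<dots> \<le> ?u ^ ?e" using assms by (intro power_mono) auto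
  finally have 1: "\<rho> ^ (4 * b * 5 ^ c) \<le> ?u ^ ?e" .
  have "(2 ^ n) ^ (4 * b * 5 ^ c) * failure_bound n \<rho> (\<lambda>c. 4 * b * 5 ^ c) l (Suc c)
      \<le> (2 ^ n) ^ (4 * b * 5 ^ c) * (l * ?u ^ (b * 5 ^ Suc c))"
    by (intro mult_left_mono Suc.IH) auto
  also have "\<dots> = l * (((2 ^ n) * ?u) ^ (4 * b * 5 ^ c) * ?u ^ ?e)"
    unfolding power_mult_distrib by (simp add: power_add[symmetric] algebra_simps)
  also have "\<dots> = l * ?u ^ ?e" by simp
  finally show ?case using 1 by (simp add: algebra_simps)
qed simp

text \<open>Each degree spends a factor sqrt r on its n, so the induction has to treat all r at
  once.\<close>

lemma poly_times_power_tendsto_0: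
  fixes p :: "nat poly" and r :: real
  assumes "0 < r" "r < 1"
  shows "(\<lambda>n. real (poly p n) * r ^ n) \<longlonglongrightarrow> 0"
  using assms
proof (induction p arbitrary: r)
  case 0
  then show ?case by simp
next
  case (pCons a p)
  let ?s = "sqrt r"
  have s: "0 < ?s" "?s < 1" using pCons.prems by (auto simp: real_sqrt_lt_1_iff)
  have "(\<lambda>n. real a * r ^ n + (real n * ?s ^ n) * (real (poly p n) * ?s ^ n)) \<longlonglongrightarrow> real a * 0 + 0 * (0 :: real)"
    using pCons.prems s powser_times_n_limit_0[of ?s]
    by (intro tendsto_intros LIMSEQ_realpow_zero pCons.IH) auto
  moreover have "?s ^ n * ?s ^ n = r ^ n" for n
    using pCons.prems by (simp add: power_mult_distrib[symmetric])
  then have "real a * r ^ n + (real n * ?s ^ n) * (real (poly p n) * ?s ^ n) = real (poly (pCons a p) n) * r ^ n" for n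
    by (simp add: algebra_simps)
  ultimately show ?case by simp
qed

lemma poly_nat_pos: "q \<noteq> 0 \<Longrightarrow> 1 \<le> n \<Longrightarrow> 0 < poly (q :: nat poly) n"
  by (induction q) auto

lemma negl_fn_poly_times_power:
  fixes P :: "nat poly"
  assumes "0 < r" "r < 1" "\<forall>\<^sub>F n in sequentially. f n \<le> real (poly P n) * r ^ n"
  shows "negl_fn f"
  unfolding negl_fn_def
proof (intro allI impI)
  fix q :: "nat poly" assume q: "q \<noteq> 0"
  have "\<forall>\<^sub>F n in sequentially. real (poly (P * q) n) * r ^ n < 1"
    using poly_times_power_tendsto_0[OF assms(1,2), of "P * q"] by (rule order_tendstoD) simp
  then show "\<forall>\<^sub>F n in sequentially. f n < 1 / real (poly q n)"
    using assms(3) eventually_ge_at_top[of 1]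
  proof eventually_elim
    case (elim n)
    have "0 < real (poly q n)" using poly_nat_pos[OF q] elim by simp
    have "f n * real (poly q n) \<le> (real (poly P n) * r ^ n) * real (poly q n)"
      using elim(2) by (intro mult_right_mono) auto
    also have "\<dots> = real (poly (P * q) n) * r ^ n" by simp
    also have "\<dots> < 1" by (rule elim(1))
    finally show ?case using \<open>0 < real (poly q n)\<close> by (simp add: pos_less_divide_eq)
  qed
qed

theorem mainTheorem6:
  fixes d :: nat and C :: "'m cqcircuit"
  assumes "d \<ge> 1" and "is_CQ d C"
  shows "negl_fn (shuffled_simon_success d C)"
proof -
  obtain m A Afin init where C: "C = (m, A, Afin, init)" by (cases C)
  obtain p :: "nat poly" where p: "\<And>n. m n \<le> poly p n"
    "\<And>n i st. i \<in> {1..m n} \<Longrightarrow> calg_ok (A n i st) (poly p n) (\<lambda>(mem, sp). wf_spec n d (poly p n) sp)"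
    "\<And>n st. calg_ok (Afin n st) (poly p n) (\<lambda>_. True)"
    using assms(2) unfolding is_CQ_def C prod.case by blast
  \<comment> \<open>Balances the errors: the hit rate is about 2^(-n) = r^(4n) and \<epsilon> will
    be r^(2n), so their ratio is about r^(2n). One factor r^n absorbs the polynomial in the hit
    rate, and a layer drifts by the order of sqrt \<epsilon> = r^n.\<close>
  define r :: real where "r = root 4 (1 / 2)"
  have r: "0 < r" "r < 1" "r ^ 4 = 1 / 2" by (auto simp: r_def)
  \<comment> \<open>With increments 4 * b * 5^i the d layers of a round cost c * b queries; S bounds
    all queries of the simulation.\<close>
  define c where "c = d * (\<Sum>i<d. 4 * 5 ^ i)"
  define S where "S = p * (p + smult c (4 * p ^ 2 + 1)) + p"
  \<comment> \<open>The coefficient 5 * d collects 4 * d from the drift and d from the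
    failures.\<close>
  define P where "P = 2 * (1 + S * S) + smult (5 * d) p"
  have "(\<lambda>n. real (poly (smult (2 * d) p) n) * r ^ n) \<longlonglongrightarrow> 0"
    by (rule poly_times_power_tendsto_0[OF r(1,2)])
  then have "\<forall>\<^sub>F n in sequentially. real (poly (smult (2 * d) p) n) * r ^ n < 1"
    by (rule order_tendstoD) simp
  then have "\<forall>\<^sub>F n in sequentially. shuffled_simon_success d C n \<le> real (poly P n) * r ^ n"
    using eventually_ge_at_top[of 1]
  proof eventually_elim
    case (elim n)
    define \<kappa> where "\<kappa> = poly p n"
    define u :: real where "u = 1 / 2 ^ n"
    \<comment> \<open>The number of histories is at most (2^n)^(4 * \<kappa>^2). The summand 1
      leaves a factor 1 / 2^n after they are cancelled.\<close>
    define b where "b = 4 * \<kappa> ^ 2 + 1"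
    define R where "R = (\<lambda>c. 4 * b * 5 ^ c :: nat)"
    define W :: nat where "W = (2 ^ (2 * n) + 1) ^ \<kappa> * 2 ^ \<kappa>"
    define Q where "Q = m n * (\<kappa> + d * (\<Sum>i<d. R i)) + \<kappa>"
    let ?\<epsilon> = "(r ^ n) ^ 2"
    let ?\<rho> = "hit_rate n d \<kappa> / ?\<epsilon>"
    have "(r ^ n) ^ 4 = (r ^ 4) ^ n" unfolding power_mult[symmetric] by (simp add: mult.commute)
    then have u4: "(r ^ n) ^ 4 = u" unfolding r(3) u_def by (simp add: power_divide)
    have rn: "0 < r ^ n" "r ^ n \<le> 1" using r by (auto simp: power_le_one)
    have "u \<le> (r ^ n) ^ 1" unfolding u4[symmetric] using rn by (intro power_decreasing) auto
    then have u: "0 < u" "u \<le> r ^ n" by (auto simp: u_def)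
    have "(2 :: real) ^ 1 \<le> 2 ^ n" using elim by (intro power_increasing) auto
    then have N: "2 \<le> (2 :: real) ^ n" by simp
    have rate: "hit_rate n d \<kappa> \<le> 2 * real d * real \<kappa> * u"
    proof -
      have sq: "(2 :: real) ^ (2 * n) = 2 ^ n * 2 ^ n" by (simp add: power_add[symmetric] mult_2)
      have "2 * (2 :: real) ^ n \<le> 2 ^ n * 2 ^ n" using N by (intro mult_right_mono) auto
      then have den: "(2 :: real) ^ n * 2 ^ n / 2 \<le> 2 ^ (2 * n) - 2 ^ n + 1" unfolding sq by linarith
      have "hit_rate n d \<kappa> \<le> 2 ^ n * real d * real \<kappa> / (2 ^ n * 2 ^ n / 2)"
        unfolding hit_rate_def using den entry_count_pos[of n] by (intro divide_left_mono) auto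
      also have "\<dots> = 2 * real d * real \<kappa> * u" by (simp add: u_def)
      finally show ?thesis .
    qed
    have "2 * real d * real \<kappa> * r ^ n \<le> 1" using elim(1) by (simp add: \<kappa>_def)
    have "?\<rho> \<le> 2 * real d * real \<kappa> * u / ?\<epsilon>" using rate rn by (intro divide_right_mono) auto
    also have "\<dots> = (2 * real d * real \<kappa> * r ^ n) * r ^ n"
      using rn by (simp add: u4[symmetric] power2_eq_square power4_eq_xxxx)
    also have "\<dots> \<le> 1 * r ^ n"
      using \<open>2 * real d * real \<kappa> * r ^ n \<le> 1\<close> rn by (intro mult_right_mono) auto
    finally have \<rho>: "?\<rho> \<le> r ^ n" by simp
    have \<rho>0: "0 \<le> ?\<rho>" using hit_rate_nonneg by simp
    have "?\<rho> ^ 4 \<le> (r ^ n) ^ 4" using \<rho> \<rho>0 by (rule power_mono)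
    then have fb: "failure_bound n ?\<rho> R d 0 \<le> d * u ^ b"
      using failure_bound_le[OF \<rho>0, of n b d 0] unfolding u4 u_def R_def by simp
    have main: "shuffled_simon_success d C n \<le> (1 + real Q * real Q) / (2 ^ n - 1)
        + m n * (4 * real d * sqrt ?\<epsilon>) + m n * real (W ^ m n) * failure_bound n ?\<rho> R d 0"
      unfolding C
    proof (rule shuffled_simon_success_le)
      show "calg_ok (A n i st) \<kappa> (\<lambda>(mem, sp). wf_spec n d \<kappa> sp)" if "i \<in> {1..m n}" for i st
        unfolding \<kappa>_def by (rule p(2)[OF that])
      show "calg_ok (Afin n st) \<kappa> (\<lambda>_. True)" for st unfolding \<kappa>_def by (rule p(3))
      show "Q = m n * (\<kappa> + d * (\<Sum>i<d. R i)) + \<kappa>" by (rule Q_def)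
      show "W = (2 ^ (2 * n) + 1) ^ \<kappa> * 2 ^ \<kappa>" by (rule W_def)
    qed (use elim assms(1) r in simp_all)
    have "(\<Sum>i<d. R i) = b * (\<Sum>i<d. 4 * 5 ^ i)"
      by (simp add: R_def sum_distrib_left algebra_simps)
    then have "Q = m n * (\<kappa> + c * b) + \<kappa>" by (simp add: Q_def c_def algebra_simps)
    also have "\<dots> \<le> \<kappa> * (\<kappa> + c * b) + \<kappa>" using p(1)[of n] by (simp add: \<kappa>_def)
    also have "\<dots> = poly S n" by (simp add: S_def b_def \<kappa>_def)
    finally have Q: "real Q \<le> real (poly S n)" by simp
    have "(1 + real Q * real Q) / (2 ^ n - 1) \<le> (1 + real (poly S n) * real (poly S n)) / (2 ^ n / 2)"
      using Q N by (intro frac_le add_left_mono mult_mono) auto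
    also have "\<dots> = 2 * (1 + real (poly S n) * real (poly S n)) * u" by (simp add: u_def)
    also have "\<dots> \<le> 2 * (1 + real (poly S n) * real (poly S n)) * r ^ n"
      using u by (intro mult_left_mono) auto
    finally have t1: "(1 + real Q * real Q) / (2 ^ n - 1) \<le> \<dots>" .
    have "sqrt ?\<epsilon> = r ^ n" using rn by simp
    then have "m n * (4 * real d * sqrt ?\<epsilon>) \<le> real \<kappa> * (4 * real d * r ^ n)"
      using p(1)[of n] rn by (auto simp: \<kappa>_def intro!: mult_right_mono)
    then have t2: "m n * (4 * real d * sqrt ?\<epsilon>) \<le> 4 * real d * real \<kappa> * r ^ n"
      by (simp add: algebra_simps)
    have "W \<le> (2 ^ (2 * n + 1)) ^ \<kappa> * 2 ^ \<kappa>"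
      unfolding W_def by (intro mult_right_mono power_mono) auto
    also have "\<dots> = 2 ^ ((2 * n + 2) * \<kappa>)" by (simp add: power_mult[symmetric] power_add[symmetric] algebra_simps)
    \<comment> \<open>Uses 2 * n + 2 \<le> 4 * n for positive n.\<close>
    also have "\<dots> \<le> 2 ^ (4 * n * \<kappa>)" using elim by (intro power_increasing mult_right_mono) auto
    finally have "W ^ m n \<le> (2 ^ (4 * n * \<kappa>)) ^ m n" by (rule power_mono) simp
    also have "\<dots> \<le> (2 ^ (4 * n * \<kappa>)) ^ \<kappa>" using p(1)[of n] by (intro power_increasing) (auto simp: \<kappa>_def)
    also have "\<dots> = (2 ^ n) ^ (4 * \<kappa> ^ 2)" by (simp add: power_mult[symmetric] power2_eq_square algebra_simps)
    finally have Wm: "real (W ^ m n) \<le> (2 ^ n) ^ (4 * \<kappa> ^ 2)"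
      by (metis of_nat_le_iff of_nat_numeral of_nat_power)
    have "m n * real (W ^ m n) * failure_bound n ?\<rho> R d 0 \<le> real \<kappa> * (2 ^ n) ^ (4 * \<kappa> ^ 2) * (real d * u ^ b)"
      using Wm fb p(1)[of n] failure_bound_nonneg[OF \<rho>0]
      by (intro mult_mono) (auto simp: \<kappa>_def)
    also have "\<dots> = real \<kappa> * real d * ((2 ^ n * u) ^ (4 * \<kappa> ^ 2) * u)"
      unfolding power_mult_distrib by (simp add: b_def algebra_simps)
    also have "\<dots> = real d * real \<kappa> * u" by (simp add: u_def)
    also have "\<dots> \<le> real d * real \<kappa> * r ^ n" using u by (intro mult_left_mono) auto
    finally have t3: "m n * real (W ^ m n) * failure_bound n ?\<rho> R d 0 \<le> real d * real \<kappa> * r ^ n" .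
    have "real (poly P n) * r ^ n = 2 * (1 + real (poly S n) * real (poly S n)) * r ^ n
        + 4 * real d * real \<kappa> * r ^ n + real d * real \<kappa> * r ^ n"
      by (simp add: P_def \<kappa>_def algebra_simps)
    then show ?case using main t1 t2 t3 by linarith
  qed
  then show ?thesis by (rule negl_fn_poly_times_power[OF r(1,2)])
qed

end
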